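(* Let $n\ge5$. The map $\widetilde{\epsilon}_n:\mathcal{T}_n/\!\sim\;\to\mathcal{M}_n$ induced by $\Delta\mapsto Q_\Delta$ is bijective.
   Context: $\mathcal{P}_n$ is a regular $n$-gon with one puncture in its center. For border vertices $a \neq b$, $\delta_{a,b}$ is the counterclockwise border path from $a$ to $b$ and $|\delta_{a,b}|$ the number of border vertices on it (including $a,b$); $\delta_{a,a}$ goes once around. A diagonal is an edge (homotopy class of non-self-crossing interior paths from $a$ to $b$ homotopic to $\delta_{a,b}$, with $|\delta_{a,b}|\ge3$) together with a tag $\epsilon\in\{\pm1\}$, with $\epsilon=1$ forced if $a\ne b$; edges with $a=b$ are drawn as arcs from the puncture to $a$. Two puncture diagonals at $a,c$ with tags $\epsilon,\epsilon'$ cross iff $a\ne c$ and $\epsilon\ne\epsilon'$; otherwise crossing means intersecting in the interior for all representatives. A triangulation is a maximal set of pairwise non-crossing diagonals; $\mathcal{T}_n$ is the set of triangulations of $\mathcal{P}_n$. The quiver $Q_\Delta$ has a vertex $v_\beta$ for each $\beta\in\Delta$, an arrow between $v_\beta,v_\gamma$ when $\beta,\gamma$ bound a common triangle, oriented $v_\beta\to v_\gamma$ if $\gamma$ is obtained from $\beta$ by anticlockwise rotation about their common vertex (two diagonals from the puncture to the same vertex are treated as loops around the puncture, giving separate triangles), with oriented $2$-cycles deleted. $\mathcal{M}_n$ is the mutation class of a quiver of Dynkin type $D_n$ (all quivers obtained from an orientation of $D_n$ by finitely many Fomin–Zelevinsky quiver mutations), taken up to isomorphism of quivers; every $Q_\Delta$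 lies in $\mathcal{M}_n$. The equivalence relation $\sim$ on $\mathcal{T}_n$ is generated by $\Delta\sim\Delta(i)$, where $\Delta(i)$ is $\Delta$ rotated $i$ steps clockwise, and $\Delta\sim\Delta^{-1}$, where $\Delta^{-1}$ is obtained by inverting all tags; $Q_\Delta$ is constant up to isomorphism on $\sim$-classes, so $\widetilde{\epsilon}_n$ is well defined. *)

theory Defs
  imports Main
begin

text \<open>Border vertices are 0,...,n-1, numbered counterclockwise.  A diagonal is encoded
as a triple (a, k, e):
  * 2 <= k <= n-1: the edge from a to b = (a + k) mod n homotopic to the
    counterclockwise border path delta_{a,b}, which has k+1 border vertices; tag e = 1.
  * k = n: the edge with a = b (delta_{a,a} goes once around, n+1 vertices), drawn as
    the arc from the puncture to a, with tag e in {1,-1}.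
Lifting to the universal cover of the polygon minus the puncture (border = the integer
line, puncture at infinity), the edge (a,k) with k < n lifts to the chords [a+jn, a+jn+k]
and a puncture arc at a lifts to the rays from a+jn to infinity.\<close>

type_synonym diag = "nat \<times> nat \<times> int"

definition diags :: "nat \<Rightarrow> diag set" where
  "diags n = {(a, k, e). a < n \<and> 2 \<le> k \<and> k \<le> n \<and> (e = 1 \<or> e = -1) \<and> (k < n \<longrightarrow> e = 1)}"

text \<open>Crossing: two puncture diagonals cross iff their vertices differ and their tags
differ; otherwise two diagonals cross iff some lifts cross in the interior, i.e. the lifted
chords interleave strictly (resp. the lifted ray lies strictly inside the lifted chord).\<close>

fun crosses :: "nat \<Rightarrow> diag \<Rightarrow> diag \<Rightarrow> bool" where
  "crosses n (a, k, e) (c, l, f) =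
    (if k = n \<and> l = n then a \<noteq> c \<and> e \<noteq> f
     else if k = n then
       (\<exists>j::int. int c + j * int n < int a \<and> int a < int c + j * int n + int l)
     else if l = n then
       (\<exists>j::int. int a + j * int n < int c \<and> int c < int a + j * int n + int k)
     else
       (\<exists>j::int.
          (int a < int c + j * int n \<and> int c + j * int n < int a + int k
             \<and> int a + int k < int c + j * int n + int l)
        \<or> (int c + j * int n < int a \<and> int a < int c + j * int n + int l
             \<and> int c + j * int n + int l < int a + int k)))"

definition noncrossing :: "nat \<Rightarrow> diag set \<Rightarrow> bool" where
  "noncrossing n S \<longleftrightarrow> (\<forall>\<beta>\<in>S. \<forall>\<gamma>\<in>S. \<not> crosses n \<beta> \<gamma>)"

definition triangulation :: "nat \<Rightarrow> diag set \<Rightarrow> bool" where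
  "triangulation n \<Delta> \<longleftrightarrow> \<Delta> \<subseteq> diags n \<and> noncrossing n \<Delta> \<and>
     (\<forall>\<Delta>'. \<Delta> \<subseteq> \<Delta>' \<and> \<Delta>' \<subseteq> diags n \<and> noncrossing n \<Delta>' \<longrightarrow> \<Delta>' = \<Delta>)"

definition triangulations :: "nat \<Rightarrow> diag set set" where
  "triangulations n = {\<Delta>. triangulation n \<Delta>}"

text \<open>If both puncture diagonals at a are present, they are treated as (copies of) the loop
around the puncture based at a, which lifts to the chords [a+jn, a+jn+n].\<close>

definition has_pair :: "nat \<Rightarrow> diag set \<Rightarrow> nat \<Rightarrow> bool" where
  "has_pair n \<Delta> a \<longleftrightarrow> (a, n, 1) \<in> \<Delta> \<and> (a, n, -1) \<in> \<Delta>"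

text \<open>Vertices of the lifted picture: integers (lifted border vertices) and None (the
puncture at infinity).  labels n Delta u v = the diagonals of Delta one of whose lifts is
the arc from u to v.\<close>

definition labels :: "nat \<Rightarrow> diag set \<Rightarrow> int \<Rightarrow> int option \<Rightarrow> diag set" where
  "labels n \<Delta> u v = {d \<in> \<Delta>. case d of (a, k, e) \<Rightarrow>
      (\<exists>j::int. u = int a + j * int n) \<and>
      (if k < n then v = Some (u + int k)
       else if has_pair n \<Delta> a then v = Some (u + int n)
       else v = None)}"

definition side_present :: "nat \<Rightarrow> diag set \<Rightarrow> int \<Rightarrow> int option \<Rightarrow> bool" where
  "side_present n \<Delta> u v \<longleftrightarrow> v = Some (u + 1) \<or> labels n \<Delta> u v \<noteq> {}"

fun vlt :: "int \<Rightarrow> int option \<Rightarrow> bool" where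
  "vlt v None = True"
| "vlt v (Some w) = (v < w)"

text \<open>Triangles of the triangulation, one representative (u, v, w) per deck-translation
orbit (smallest vertex u in [0, n)); its vertices u < v < w are in counterclockwise order.\<close>

definition triangles :: "nat \<Rightarrow> diag set \<Rightarrow> (int \<times> int \<times> int option) set" where
  "triangles n \<Delta> = {(u, v, w). 0 \<le> u \<and> u < int n \<and> u < v \<and> vlt v w \<and>
      side_present n \<Delta> u (Some v) \<and> side_present n \<Delta> u w \<and> side_present n \<Delta> v w}"

text \<open>Number of arrows beta -> gamma before deleting 2-cycles: in a triangle with
counterclockwise vertices u, v, w, the anticlockwise rotation about the common vertex gives
uv -> uw (at u), uw -> vw (at w), vw -> uv (at v).\<close>

definition arrow_count :: "nat \<Rightarrow> diag set \<Rightarrow> diag \<Rightarrow> diag \<Rightarrow> nat" where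
  "arrow_count n \<Delta> \<beta> \<gamma> =
     card {(u, v, w) \<in> triangles n \<Delta>. \<beta> \<in> labels n \<Delta> u (Some v) \<and> \<gamma> \<in> labels n \<Delta> u w}
   + card {(u, v, w) \<in> triangles n \<Delta>. \<beta> \<in> labels n \<Delta> u w \<and> \<gamma> \<in> labels n \<Delta> v w}
   + card {(u, v, w) \<in> triangles n \<Delta>. \<beta> \<in> labels n \<Delta> v w \<and> \<gamma> \<in> labels n \<Delta> u (Some v)}"

text \<open>The quiver Q_Delta (vertex set Delta) after deleting oriented 2-cycles, as its
skew-symmetric exchange matrix: entry = #arrows beta->gamma minus #arrows gamma->beta.\<close>

definition quiver_of :: "nat \<Rightarrow> diag set \<Rightarrow> diag \<Rightarrow> diag \<Rightarrow> int" where
  "quiver_of n \<Delta> \<beta> \<gamma> = int (arrow_count n \<Delta> \<beta> \<gamma>) - int (arrow_count n \<Delta> \<gamma> \<beta>)"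

text \<open>A quiver without loops and oriented 2-cycles on vertex set V is given by its
skew-symmetric matrix B (B x y = number of arrows x -> y minus number y -> x).\<close>

definition quiver_iso :: "'a set \<Rightarrow> ('a \<Rightarrow> 'a \<Rightarrow> int) \<Rightarrow> 'b set \<Rightarrow> ('b \<Rightarrow> 'b \<Rightarrow> int) \<Rightarrow> bool" where
  "quiver_iso V B W C \<longleftrightarrow>
     (\<exists>f. bij_betw f V W \<and> (\<forall>x\<in>V. \<forall>y\<in>V. C (f x) (f y) = B x y))"

definition D_adj :: "nat \<Rightarrow> nat \<Rightarrow> nat \<Rightarrow> bool" where
  "D_adj n i j \<longleftrightarrow> i < n \<and> j < n \<and>
     ((j = i + 1 \<and> j \<le> n - 2) \<or> (i = j + 1 \<and> i \<le> n - 2) \<or>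
      (i = n - 3 \<and> j = n - 1) \<or> (j = n - 3 \<and> i = n - 1))"

definition D_orientation :: "nat \<Rightarrow> (nat \<Rightarrow> nat \<Rightarrow> int) \<Rightarrow> bool" where
  "D_orientation n B \<longleftrightarrow> (\<forall>i j. B i j = - B j i) \<and>
     (\<forall>i j. if D_adj n i j then B i j = 1 \<or> B i j = -1 else B i j = 0)"

definition mutate :: "nat \<Rightarrow> (nat \<Rightarrow> nat \<Rightarrow> int) \<Rightarrow> nat \<Rightarrow> nat \<Rightarrow> int" where
  "mutate k B i j = (if i = k \<or> j = k then - B i j
                     else B i j + sgn (B i k) * max (B i k * B k j) 0)"

inductive_set mutation_class_D :: "nat \<Rightarrow> (nat \<Rightarrow> nat \<Rightarrow> int) set" for n where
  orient: "D_orientation n B \<Longrightarrow> B \<in> mutation_class_D n"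
| mut: "B \<in> mutation_class_D n \<Longrightarrow> k < n \<Longrightarrow> mutate k B \<in> mutation_class_D n"

definition rotate_tri :: "nat \<Rightarrow> nat \<Rightarrow> diag set \<Rightarrow> diag set" where
  "rotate_tri n i \<Delta> = (\<lambda>(a, k, e). ((a + (n - i mod n)) mod n, k, e)) ` \<Delta>"

definition invert_tags :: "nat \<Rightarrow> diag set \<Rightarrow> diag set" where
  "invert_tags n \<Delta> = (\<lambda>(a, k, e). (a, k, if k = n then - e else e)) ` \<Delta>"

definition tri_gen :: "nat \<Rightarrow> diag set \<Rightarrow> diag set \<Rightarrow> bool" where
  "tri_gen n \<Delta> \<Delta>' \<longleftrightarrow> \<Delta> \<in> triangulations n \<and> \<Delta>' \<in> triangulations n \<and>
     ((\<exists>i. \<Delta>' = rotate_tri n i \<Delta>) \<or> \<Delta>' = invert_tags n \<Delta>)"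

definition tri_equiv :: "nat \<Rightarrow> diag set \<Rightarrow> diag set \<Rightarrow> bool" where
  "tri_equiv n = (\<lambda>x y. tri_gen n x y \<or> tri_gen n y x)\<^sup>*\<^sup>*"

end

theory Submission
  imports Defs
begin

text \<open>Flipping a diagonal of a triangulation mutates its quiver at that diagonal, and every
triangulation can be flipped into a star, i.e. into \<open>n\<close> puncture diagonals with equal tags, whose
quiver is an oriented \<open>n\<close>-cycle.  An explicit sequence of mutations turns this cycle into an
orientation of \<open>D\<^sub>n\<close>, and mutations at sinks and sources connect all orientations of \<open>D\<^sub>n\<close>; hence
the map lands in the mutation class and is surjective.

For injectivity one shows more: every isomorphism of quivers \<open>Q\<^sub>\<Delta> \<rightarrow> Q\<^sub>\<Delta>'\<close> is induced by a rotation,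
possibly followed by the inversion of tags.  This holds if \<open>\<Delta>\<close> is a star, since for \<open>n \<ge> 5\<close> only
stars have an oriented \<open>n\<close>-cycle as quiver.  It is inherited along flips: flip \<open>d\<close> in \<open>\<Delta>\<close> and its
image in \<open>\<Delta>'\<close>; the new triangulations have isomorphic quivers, so they correspond under a symmetry,
and since a flip is determined by the remaining diagonals, so do the old ones.\<close>

section \<open>Arcs in the universal cover\<close>

text \<open>With the puncture as a point \<open>None\<close> at infinity, the universal cover turns
  topology into order statements about integers: crossing means interleaving of endpoints. Two
  features resist this. Opposite tags cross although their arcs do not interleave, so tags always
  need a separate argument. And a pair of oppositely tagged diagonals at one vertex is drawn as a
  loop of width \<open>n\<close>, so a flip that creates or destroys a pair also redraws a diagonal
  that stays; such flips are computed apart from those in quadrilaterals.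

  Rigidity speaks of a given isomorphism and not of the mere existence of a symmetry, because the
  induction needs the symmetry found after a flip to agree with the given map on the diagonals that
  were kept. Progress towards a star is measured by the number of border vertices joined to the
  puncture.\<close>

fun olt :: "int option \<Rightarrow> int option \<Rightarrow> bool" where
  "olt None w = False"
| "olt (Some v) w = vlt v w"

text \<open>Strict interleaving of endpoints, with \<open>None\<close> as the largest point. One
  formula covers chord against chord and chord against ray; two rays never satisfy it, whence the
  extra tag clause in \<open>crosses_iff_crs\<close>.\<close>

definition crs :: "int \<Rightarrow> int option \<Rightarrow> int \<Rightarrow> int option \<Rightarrow> bool" where
  "crs u v p q \<longleftrightarrow> u < p \<and> vlt p v \<and> olt v q \<or> p < u \<and> vlt u q \<and> olt q v"

abbreviation osh :: "int \<Rightarrow> int option \<Rightarrow> int option" where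
  "osh c \<equiv> map_option (\<lambda>x. x + c)"

text \<open>The arc itself, independent of any triangulation: a puncture diagonal is always a ray
  here, whereas \<open>labels\<close> redraws a pair as a loop. Crossings are decided with
  \<open>is_lift\<close>, triangles with \<open>labels\<close>.\<close>

definition is_lift :: "nat \<Rightarrow> diag \<Rightarrow> int \<Rightarrow> int option \<Rightarrow> bool" where
  "is_lift n d u v \<longleftrightarrow> (case d of (a, k, e) \<Rightarrow>
     (\<exists>j. u = int a + j * int n) \<and> v = (if k < n then Some (u + int k) else None))"

abbreviation is_ray :: "nat \<Rightarrow> diag \<Rightarrow> bool" where
  "is_ray n d \<equiv> fst (snd d) = n"

abbreviation tag :: "diag \<Rightarrow> int" where
  "tag d \<equiv> snd (snd d)"

lemma crs_sym: "crs u v p q \<longleftrightarrow> crs p q u v"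
  by (auto simp: crs_def)

lemma crs_None_None [simp]: "\<not> crs u None p None"
  by (auto simp: crs_def)

lemma vlt_osh [simp]: "vlt (u + c) (osh c v) = vlt u v"
  by (cases v) auto

lemma olt_osh [simp]: "olt (osh c u) (osh c v) = olt u v"
  by (cases u; cases v) auto

lemma crs_shift [simp]: "crs (u + c) (osh c v) (p + c) (osh c q) = crs u v p q"
  by (auto simp: crs_def)

lemma crs_border [simp]: "\<not> crs u v p (Some (p + 1))" "\<not> crs p (Some (p + 1)) u v"
  by (cases v; auto simp: crs_def)+

lemma osh_comp [simp]: "osh c (osh d v) = osh (d + c) v"
  by (cases v) auto

lemma osh_0 [simp]: "osh 0 v = v"
  by (cases v) auto

lemma is_lift_shift: "is_lift n d u v \<Longrightarrow> is_lift n d (u + j * int n) (osh (j * int n) v)"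
proof -
  assume "is_lift n d u v"
  moreover obtain a k e where d: "d = (a,k,e)" by (cases d)
  ultimately obtain i where "u = int a + i * int n" "v = (if k < n then Some (u + int k) else None)"
    by (auto simp: is_lift_def)
  then show ?thesis
    by (auto simp: is_lift_def d distrib_right intro!: exI[of _ "i + j"])
qed

lemma is_lift_vlt: "d \<in> diags n \<Longrightarrow> is_lift n d u v \<Longrightarrow> vlt u v"
  by (auto simp: is_lift_def diags_def split: prod.splits if_splits)

lemma is_lift_ex: "\<exists>v. is_lift n d (int (fst d)) v"
  by (cases d) (auto simp: is_lift_def intro!: exI[of _ "0::int"])

lemma is_lift_same_diag:
  assumes "is_lift n d u v" "is_lift n d p q"
  shows "\<exists>j. p = u + j * int n \<and> q = osh (j * int n) v"
proof -
  obtain a k e where d: "d = (a,k,e)" by (cases d)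
  obtain i where i: "u = int a + i * int n" using assms d by (auto simp: is_lift_def)
  obtain l where l: "p = int a + l * int n" using assms d by (auto simp: is_lift_def)
  have "p = u + (l - i) * int n" using i l by (simp add: algebra_simps)
  then show ?thesis using assms d by (intro exI[of _ "l - i"]) (auto simp: is_lift_def)
qed

lemma cong_nat_eq:
  assumes "int a + i * int n = int b + j * int n" "a < n" "b < n"
  shows "a = b"
proof -
  have "(int a + i * int n) mod int n = (int b + j * int n) mod int n" using assms(1) by presburger
  then show ?thesis using assms(2,3) by simp
qed

lemma is_lift_same_arc:
  assumes "is_lift n d u v" "is_lift n c u v" "d \<in> diags n" "c \<in> diags n"
  shows "fst d = fst c \<and> fst (snd d) = fst (snd c)"
  using assms
  by (auto simp: is_lift_def diags_def split: prod.splits if_splits dest: cong_nat_eq)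

lemma is_lift_inj:
  assumes "is_lift n d u v" "is_lift n c u v" "d \<in> diags n" "c \<in> diags n" "v \<noteq> None \<or> tag d = tag c"
  shows "d = c"
  using is_lift_same_arc[OF assms(1-4)] assms
  by (auto simp: is_lift_def diags_def split: prod.splits if_splits)

lemma is_lift_bounds:
  assumes "is_lift n d u (Some v)" "d \<in> diags n"
  shows "u + 2 \<le> v" "v < u + int n" "\<not> is_ray n d"
  using assms by (auto simp: is_lift_def diags_def split: prod.splits if_splits)

lemma is_lift_None_iff: "d \<in> diags n \<Longrightarrow> is_lift n d u v \<Longrightarrow> v = None \<longleftrightarrow> is_ray n d"
  by (auto simp: is_lift_def diags_def split: prod.splits if_splits)

text \<open>The diagonal below a given arc; flips construct the new diagonal from its endpoints in
  this way.\<close>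

definition dg :: "nat \<Rightarrow> int \<Rightarrow> int \<Rightarrow> int option \<Rightarrow> diag" where
  "dg n e u v = (nat (u mod int n), (case v of None \<Rightarrow> n | Some w \<Rightarrow> nat (w - u)),
                 (case v of None \<Rightarrow> e | Some w \<Rightarrow> 1))"

lemma dg_diags:
  assumes "n \<ge> 2" "v = None \<longrightarrow> e = 1 \<or> e = -1" "\<And>w. v = Some w \<Longrightarrow> u + 2 \<le> w \<and> w < u + int n"
  shows "dg n e u v \<in> diags n"
  using assms by (auto simp: dg_def diags_def nat_less_iff split: option.splits)

lemma dg_lift:
  assumes "n \<ge> 2" "\<And>w. v = Some w \<Longrightarrow> u + 2 \<le> w \<and> w < u + int n"
  shows "is_lift n (dg n e u v) u v"
proof -
  have u: "u = int (nat (u mod int n)) + (u div int n) * int n" using assms by simp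
  show ?thesis
    unfolding dg_def is_lift_def prod.case
  proof (intro conjI)
    show "\<exists>j. u = int (nat (u mod int n)) + j * int n" using u by blast
  qed (use assms in \<open>auto split: option.split\<close>)
qed

lemma dg_tag [simp]: "tag (dg n e u None) = e" "is_ray n (dg n e u None)"
  by (auto simp: dg_def)

text \<open>Only the relative position of two lifts matters, so both may be chosen freely; later
  arguments use whichever lift is at hand instead of a normalised one.\<close>

lemma crosses_iff_crs:
  assumes "c \<in> diags n" "d \<in> diags n"
  shows "crosses n c d \<longleftrightarrow>
    (\<exists>u v p q. is_lift n c u v \<and> is_lift n d p q \<and> crs u v p q) \<or>
    (is_ray n c \<and> is_ray n d \<and> fst c \<noteq> fst d \<and> tag c \<noteq> tag d)"
proof -
  obtain a k e where c: "c = (a,k,e)" by (cases c)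
  obtain b l f where d: "d = (b,l,f)" by (cases d)
  have kl: "k \<le> n" "l \<le> n" using assms c d by (auto simp: diags_def)
  let ?v = "\<lambda>u k. if k < n then Some (u + int k) else None"
  have 1: "(\<exists>u v p q. is_lift n c u v \<and> is_lift n d p q \<and> crs u v p q) \<longleftrightarrow>
    (\<exists>j. crs (int a) (?v (int a) k) (int b + j * int n) (?v (int b + j * int n) l))" (is "?L = ?R")
  proof
    assume ?L
    then obtain i j where "crs (int a + i * int n) (?v (int a + i * int n) k) (int b + j * int n) (?v (int b + j * int n) l)"
      by (auto simp: is_lift_def c d)
    then have "crs (int a + i * int n + - i * int n) (osh (- i * int n) (?v (int a + i * int n) k))
       (int b + j * int n + - i * int n) (osh (- i * int n) (?v (int b + j * int n) l))"
      by (simp only: crs_shift)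
    then have "crs (int a) (?v (int a) k) (int b + (j - i) * int n) (?v (int b + (j - i) * int n) l)"
      by (cases "k < n"; cases "l < n") (simp_all add: algebra_simps)
    then show ?R by blast
  next
    assume ?R
    then obtain j where "crs (int a) (?v (int a) k) (int b + j * int n) (?v (int b + j * int n) l)" ..
    moreover have "is_lift n c (int a) (?v (int a) k)" 
      by (auto simp: is_lift_def c intro!: exI[of _ "0::int"])
    moreover have "is_lift n d (int b + j * int n) (?v (int b + j * int n) l)" 
      by (auto simp: is_lift_def d)
    ultimately show ?L by blast
  qed
  \<comment> \<open>When the second diagonal is the ray, \<open>crosses\<close> translates the chord
    instead, which changes the sign of \<open>j\<close>.\<close>
  have 2: "(\<exists>j. int a + j * int n < int b \<and> int b < int a + j * int n + int k) \<longleftrightarrow>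
        (\<exists>j. int a < int b + j * int n \<and> int b + j * int n < int a + int k)"
    by (rule iffI; elim exE; rule_tac x = "- j" in exI) auto
  show ?thesis unfolding 1 using kl 2
    by (cases "k = n"; cases "l = n") (simp_all add: c d crs_def)
qed

lemma crosses_sym:
  assumes "c \<in> diags n" "d \<in> diags n"
  shows "crosses n c d \<longleftrightarrow> crosses n d c"
proof -
  have "(\<exists>u v p q. is_lift n c u v \<and> is_lift n d p q \<and> crs u v p q) \<longleftrightarrow>
    (\<exists>u v p q. is_lift n d u v \<and> is_lift n c p q \<and> crs u v p q)"
    by (subst crs_sym) blast
  then show ?thesis
    unfolding crosses_iff_crs[OF assms] crosses_iff_crs[OF assms(2,1)] by auto
qed

lemma crossesI_crs:
  assumes "c \<in> diags n" "d \<in> diags n" "is_lift n c u v" "is_lift n d p q" "crs u v p q"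
  shows "crosses n c d"
  using crosses_iff_crs assms by blast

lemma multiple_cases: "j * int n = 0 \<or> j * int n \<ge> int n \<or> j * int n \<le> - int n"
proof -
  have "j \<ge> 1 \<Longrightarrow> j * int n \<ge> int n" by (simp add: mult_le_cancel_right1)
  moreover have "j \<le> -1 \<Longrightarrow> j * int n \<le> - int n"
    using mult_right_mono[of j "-1" "int n"] by simp
  ultimately show ?thesis by (cases "j = 0") force+
qed

text \<open>A chord is narrower than \<open>n\<close>, hence cannot interleave with its translates
  by multiples of \<open>n\<close>.\<close>

lemma not_crosses_self: 
  assumes "d \<in> diags n"
  shows "\<not> crosses n d d"
proof
  assume "crosses n d d"
  then obtain u v p q where *: "is_lift n d u v" "is_lift n d p q" "crs u v p q"
    using assms by (auto simp: crosses_iff_crs)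
  then obtain j where j: "p = u + j * int n" "q = osh (j * int n) v"
    using is_lift_same_diag by blast
  show False
  proof (cases v)
    case None then show ?thesis using j * by simp
  next
    case (Some w)
    have w: "w < u + int n" using is_lift_bounds * assms Some by blast
    have "crs u (Some w) (u + j * int n) (Some (w + j * int n))" using * j Some by simp
    moreover have "t \<noteq> 0 \<and> \<bar>t\<bar> < w - u" if "crs u (Some w) (u + t) (Some (w + t))" for t
      using that by (auto simp: crs_def)
    ultimately have "j * int n \<noteq> 0 \<and> \<bar>j * int n\<bar> < w - u" by blast
    then show ?thesis using w multiple_cases[of j n] by linarith
  qed
qed

section \<open>Triangles of a triangulation\<close>

locale triang =
  fixes n :: nat and \<Delta> :: "diag set"
  assumes n3: "3 \<le> n" and tri: "triangulation n \<Delta>"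
begin

abbreviation side :: "int \<Rightarrow> int option \<Rightarrow> bool" where
  "side \<equiv> side_present n \<Delta>"

abbreviation lab :: "int \<Rightarrow> int option \<Rightarrow> diag set" where
  "lab \<equiv> labels n \<Delta>"

abbreviation paired :: "nat \<Rightarrow> bool" where
  "paired \<equiv> has_pair n \<Delta>"

lemma in_diags: "d \<in> \<Delta> \<Longrightarrow> d \<in> diags n"
  using tri by (auto simp: triangulation_def)

lemma no_cross: "b \<in> \<Delta> \<Longrightarrow> c \<in> \<Delta> \<Longrightarrow> \<not> crosses n b c"
  using tri by (auto simp: triangulation_def noncrossing_def)

lemma nc_crs:
  assumes "b \<in> \<Delta>" "c \<in> \<Delta>" "is_lift n b u v" "is_lift n c p q"
  shows "\<not> crs u v p q"
  using no_cross[OF assms(1,2)] crossesI_crs[OF in_diags in_diags] assms by blast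

lemma maximal:
  assumes d: "d \<in> diags n" and c: "\<And>c. c \<in> \<Delta> \<Longrightarrow> \<not> crosses n d c"
  shows "d \<in> \<Delta>"
proof -
  have "noncrossing n (insert d \<Delta>)"
    using not_crosses_self[OF d] c crosses_sym[OF d in_diags] no_cross by (auto simp: noncrossing_def)
  moreover have "insert d \<Delta> \<subseteq> diags n" using d in_diags by blast
  ultimately have "insert d \<Delta> = \<Delta>" using tri unfolding triangulation_def by blast
  then show ?thesis by blast
qed

lemma finite_Delta: "finite \<Delta>"
proof -
  have "diags n \<subseteq> {..<n} \<times> {..n} \<times> {1,-1}" by (auto simp: diags_def)
  then have "finite (diags n)" by (rule finite_subset) auto
  then show ?thesis using in_diags by (metis finite_subset subsetI)
qed

section \<open>Puncture diagonals and their tags\<close>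

lemma ray_form: "c \<in> \<Delta> \<Longrightarrow> is_ray n c \<Longrightarrow> c = (fst c, n, tag c) \<and> fst c < n \<and> (tag c = 1 \<or> tag c = -1)"
  using in_diags by (cases c) (fastforce simp: diags_def)

lemma ray_lift: "is_ray n c \<Longrightarrow> is_lift n c u v \<longleftrightarrow> v = None \<and> (\<exists>j. u = int (fst c) + j * int n)"
  by (cases c) (auto simp: is_lift_def)

text \<open>The tag of a ray differs from that of one member of the pair, so at another vertex the
  two would cross.\<close>

lemma pair_rays:
  assumes "paired a" "c \<in> \<Delta>" "is_ray n c"
  shows "fst c = a"
proof (rule ccontr)
  assume "fst c \<noteq> a"
  moreover have "(a, n, 1) \<in> \<Delta>" "(a, n, -1) \<in> \<Delta>" using assms by (auto simp: has_pair_def)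
  ultimately show False using no_cross[of c "(a,n,1)"] no_cross[of c "(a,n,-1)"] assms
    by (cases c) auto
qed

lemma lab_iff: "d \<in> lab u v \<longleftrightarrow> d \<in> \<Delta> \<and>
   (if is_ray n d \<and> paired (fst d) then (\<exists>j. u = int (fst d) + j * int n) \<and> v = Some (u + int n)
    else is_lift n d u v)"
  using in_diags[of d] by (cases d) (auto simp: labels_def is_lift_def diags_def)

text \<open>The ray at the left end of a longest chord can be added: a chord crossing it starts
  further left and, being no longer, ends inside the longest chord, so the two chords would
  cross.\<close>

lemma ex_ray: "\<exists>c\<in>\<Delta>. is_ray n c"
proof (rule ccontr)
  assume no: "\<not> (\<exists>c\<in>\<Delta>. is_ray n c)"
  have "\<Delta> \<noteq> {}"
  proof
    assume "\<Delta> = {}"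
    then have "(0,n,1) \<in> \<Delta>" using n3 by (intro maximal) (auto simp: diags_def)
    then show False using no by force
  qed
  then have "Max ((\<lambda>c. fst (snd c)) ` \<Delta>) \<in> (\<lambda>c. fst (snd c)) ` \<Delta>"
    using finite_Delta by (intro Max_in) auto
  then obtain m where m: "m \<in> \<Delta>" and mm: "fst (snd m) = Max ((\<lambda>c. fst (snd c)) ` \<Delta>)" by fastforce
  have mmax: "\<And>c. c \<in> \<Delta> \<Longrightarrow> fst (snd c) \<le> fst (snd m)"
    unfolding mm using finite_Delta by simp
  obtain a k e where mf: "m = (a,k,e)" by (cases m)
  have kn: "k < n" "a < n" using m in_diags[OF m] no mf by (auto simp: diags_def le_less)
  have dd: "(a,n,1) \<in> diags n" using kn n3 by (auto simp: diags_def)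
  have "(a,n,1) \<in> \<Delta>"
  proof (rule maximal[OF dd])
    fix c assume c: "c \<in> \<Delta>"
    then have cf: "\<not> is_ray n c" using no by blast
    show "\<not> crosses n (a,n,1) c"
    proof
      assume "crosses n (a,n,1) c"
      then obtain u v p q where l: "is_lift n (a,n,1) u v" "is_lift n c p q" "crs u v p q"
        using crosses_iff_crs[OF dd in_diags[OF c]] cf by auto
      have v: "v = None" using l(1) by (auto simp: is_lift_def)
      have um: "is_lift n m u (Some (u + int k))" using l(1) kn by (auto simp: is_lift_def mf)
      obtain b f l' where cc: "c = (b,l',f)" by (cases c)
      have q: "q = Some (p + int l')" using l(2) cf in_diags[OF c] by (auto simp: is_lift_def cc diags_def)
      have "l' \<le> k" using mmax[OF c] by (simp add: mf cc)
      then have "crs u (Some (u + int k)) p q" using l(3) v q in_diags[OF m]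
        by (auto simp: crs_def mf diags_def)
      then show False using nc_crs[OF m c um l(2)] by blast
    qed
  qed
  then show False using no by force
qed

text \<open>Different tags cross at different vertices and form a pair at the same vertex. A single
  ray is impossible, because its copy with the opposite tag could be added, again giving a
  pair.\<close>

lemma common_tag:
  assumes "\<And>a. \<not> paired a"
  obtains e c1 c2 where "e = 1 \<or> e = -1" "\<And>c. c \<in> \<Delta> \<Longrightarrow> is_ray n c \<Longrightarrow> tag c = e"
    "c1 \<in> \<Delta>" "is_ray n c1" "c2 \<in> \<Delta>" "is_ray n c2" "fst c1 \<noteq> fst c2"
proof -
  obtain c1 where c1: "c1 \<in> \<Delta>" "is_ray n c1" using ex_ray by blast
  have tg: "tag c = tag c1" if "c \<in> \<Delta>" "is_ray n c" for c
  proof (rule ccontr)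
    assume ne: "tag c \<noteq> tag c1"
    show False
    proof (cases "fst c = fst c1")
      case True
      then have "paired (fst c)" using ray_form[OF that] ray_form[OF c1] ne that(1) c1(1)
        unfolding has_pair_def by metis
      then show False using assms by blast
    next
      case False
      then show False using no_cross[OF that(1) c1(1)] crosses_iff_crs[OF in_diags[OF that(1)] in_diags[OF c1(1)]] that c1 ne
        by blast
    qed
  qed
  have "\<exists>c2\<in>\<Delta>. is_ray n c2 \<and> fst c1 \<noteq> fst c2"
  proof (rule ccontr)
    assume *: "\<not> ?thesis"
    define d where "d = (fst c1, n, - tag c1)"
    have dd: "d \<in> diags n" using ray_form[OF c1] n3 by (auto simp: d_def diags_def)
    have "d \<in> \<Delta>"
    proof (rule maximal[OF dd])
      fix c assume c: "c \<in> \<Delta>"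
      have "\<not> crs u v p q" if "is_lift n d u v" "is_lift n c p q" for u v p q
      proof -
        have "is_lift n c1 u v" using that(1) c1 by (cases c1) (auto simp: d_def is_lift_def)
        then show ?thesis using nc_crs c c1 that by blast
      qed
      moreover have "is_ray n c \<Longrightarrow> fst c = fst d" using * c by (auto simp: d_def)
      ultimately show "\<not> crosses n d c" using crosses_iff_crs[OF dd in_diags[OF c]] by auto
    qed
    then have "paired (fst c1)" using ray_form[OF c1] c1(1) by (auto simp: has_pair_def d_def)
    then show False using assms by blast
  qed
  then show thesis using that ray_form[OF c1] tg c1 by blast
qed

lemma pair_lift: "paired a \<Longrightarrow> is_lift n (a,n,e) (int a + j * int n) None"
  by (auto simp: is_lift_def)

section \<open>Sides of the lifted picture do not cross\<close>

lemma side_cases: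
  assumes "side p q"
  obtains "q = Some (p + 1)"
  | d where "d \<in> \<Delta>" "is_lift n d p q" "is_ray n d \<longrightarrow> \<not> paired (fst d)" "d \<in> lab p q"
  | a j where "paired a" "p = int a + j * int n" "q = Some (p + int n)"
  using assms unfolding side_present_def
  by (metis (no_types, lifting) ex_in_conv lab_iff)

lemma side_lift: "d \<in> \<Delta> \<Longrightarrow> is_lift n d p q \<Longrightarrow> (is_ray n d \<longrightarrow> \<not> paired (fst d)) \<Longrightarrow> side p q \<and> d \<in> lab p q"
proof -
  assume "d \<in> \<Delta>" "is_lift n d p q" "is_ray n d \<longrightarrow> \<not> paired (fst d)"
  then have "d \<in> lab p q" unfolding lab_iff by auto
  then show ?thesis by (auto simp: side_present_def)
qed

lemma side_loop: "paired a \<Longrightarrow> side (int a + j * int n) (Some (int a + j * int n + int n))"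
proof -
  assume "paired a"
  then have "(a,n,1) \<in> lab (int a + j * int n) (Some (int a + j * int n + int n))"
    by (auto simp: lab_iff has_pair_def)
  then show ?thesis by (auto simp: side_present_def)
qed

lemma lab_shift: "lab (u + j * int n) (osh (j * int n) v) = lab u v"
proof -
  have *: "lab u v \<subseteq> lab (u + j * int n) (osh (j * int n) v)" for u v j
  proof
    fix d assume d: "d \<in> lab u v"
    have "(\<exists>i. u + j * int n = int (fst d) + i * int n)" if "(\<exists>i. u = int (fst d) + i * int n)"
      using that by (metis add.assoc distrib_right)
    then show "d \<in> lab (u + j * int n) (osh (j * int n) v)" using d
      by (auto simp: lab_iff is_lift_shift split: if_splits)
  qed
  have "lab (u + j * int n) (osh (j * int n) v) \<subseteq> lab u v"
    using *[of "u + j * int n" "osh (j * int n) v" "-j"] unfolding osh_comp by (simp add: option.map_ident)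
  then show ?thesis using * by blast
qed

lemma side_shift: "side (u + j * int n) (osh (j * int n) v) = side u v"
proof -
  have "osh (j * int n) v = Some (u + j * int n + 1) \<longleftrightarrow> v = Some (u + 1)"
    by (cases v) auto
  then show ?thesis by (simp add: side_present_def lab_shift)
qed

lemma side_bound: "side p (Some q) \<Longrightarrow> p < q \<and> q \<le> p + int n"
  using n3 by (elim side_cases) (auto dest: is_lift_bounds[OF _ in_diags])

lemma side_long: "side p (Some (p + int n)) \<Longrightarrow> \<exists>a j. paired a \<and> p = int a + j * int n"
  using n3 by (elim side_cases) (auto dest: is_lift_bounds[OF _ in_diags])

text \<open>Only the loop is new. A chord crossing it passes over one of its ends and so crosses a
  ray of the pair; a ray strictly inside it would sit at a second vertex.\<close>

lemma lift_side_nc: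
  assumes d: "d \<in> \<Delta>" "is_lift n d u v" and s: "side p q"
  shows "\<not> crs u v p q"
  using s
proof (cases rule: side_cases)
  case 1 then show ?thesis by simp
next
  case (2 c) then show ?thesis using nc_crs d by blast
next
  case (3 a j)
  have r: "is_lift n (a,n,1) p None" "is_lift n (a,n,1) (p + int n) None"
    using is_lift_shift[of n "(a,n,1)" p None 1] pair_lift[OF 3(1)] 3(2) by auto
  have m: "(a,n,1) \<in> \<Delta>" using 3 by (auto simp: has_pair_def)
  show ?thesis
  proof (cases v)
    case (Some w)
    then have "w < u + int n" using is_lift_bounds d in_diags by blast
    then show ?thesis using nc_crs[OF d(1) m d(2) r(1)] nc_crs[OF d(1) m d(2) r(2)] Some 3
      by (auto simp: crs_def)
  next
    case None
    then have ry: "is_ray n d" using is_lift_None_iff in_diags d by blast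
    then have "fst d = a" using pair_rays 3 d by blast
    then obtain i' where "u = int a + i' * int n" using d(2) ray_lift[OF ry] by blast
    then have "u = p + (i' - j) * int n" using 3(2) by (simp add: left_diff_distrib)
    then obtain i where i: "u = p + i * int n" ..
    have "\<not> (p < u \<and> u < p + int n)"
    proof
      assume *: "p < u \<and> u < p + int n"
      then have "0 < i * int n" "i * int n < 1 * int n" using i by auto
      then have "0 < i" "i < 1" using n3 by (auto simp: zero_less_mult_iff mult_less_cancel_right)
      then show False by simp
    qed
    then show ?thesis using None 3 by (auto simp: crs_def)
  qed
qed

lemma side_nc:
  assumes "side u v" "side p q"
  shows "\<not> crs u v p q"
  using assms(1)
proof (cases rule: side_cases)
  case 1 then show ?thesis by simp
next
  case (2 d) then show ?thesis using lift_side_nc assms by blast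
next
  case l: (3 a j)
  show ?thesis using assms(2)
  proof (cases rule: side_cases)
    case 1 then show ?thesis by simp
  next
    case (2 d) then show ?thesis using lift_side_nc assms crs_sym by blast
  next
    \<comment> \<open>Two interleaving loops would put the ray at the start of one strictly inside
      the other.\<close>
    case (3 b i)
    have "is_lift n (a,n,1) u None" using l pair_lift by blast
    then have "\<not> crs u None p q" using lift_side_nc[OF _ _ assms(2)] l by (auto simp: has_pair_def)
    moreover have "is_lift n (b,n,1) p None" using 3 pair_lift by blast
    then have "\<not> crs p None u v" using lift_side_nc[OF _ _ assms(1)] 3 by (auto simp: has_pair_def)
    ultimately show ?thesis using l 3 by (auto simp: crs_def)
  qed
qed

section \<open>Maximality and the triangles on both sides of a side\<close>

lemma complete_fin:
  assumes uv: "u + 2 \<le> v" "v < u + int n" and nx: "\<And>p q. side p q \<Longrightarrow> \<not> crs u (Some v) p q"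
  shows "side u (Some v)"
proof -
  let ?d = "dg n 1 u (Some v)"
  have dd: "?d \<in> diags n" using uv n3 by (intro dg_diags) auto
  have l: "is_lift n ?d u (Some v)" using uv n3 by (intro dg_lift) auto
  have nr: "\<not> is_ray n ?d" using is_lift_bounds l dd by blast
  have "?d \<in> \<Delta>"
  proof (rule maximal[OF dd])
    fix c assume c: "c \<in> \<Delta>"
    show "\<not> crosses n ?d c"
    proof
      assume "crosses n ?d c"
      then obtain u' v' p q where x: "is_lift n ?d u' v'" "is_lift n c p q" "crs u' v' p q"
        using crosses_iff_crs[OF dd in_diags[OF c]] nr by auto
      obtain j where j: "u = u' + j * int n" "Some v = osh (j * int n) v'"
        using is_lift_same_diag[OF x(1) l] by blast
      define p' q' where "p' = p + j * int n" and "q' = osh (j * int n) q"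
      have cl: "is_lift n c p' q'" using is_lift_shift x(2) p'_def q'_def by blast
      have cx: "crs u (Some v) p' q'" using x(3) j by (simp add: p'_def q'_def)
      show False
      proof (cases "is_ray n c \<and> paired (fst c)")
        case False
        then show False using side_lift[OF c cl] nx cx by blast
      next
        \<comment> \<open>The ray is drawn as a loop. The chord is narrower than \<open>n\<close>,
          so if it crosses the ray at \<open>p'\<close>, it also crosses the loop from
          \<open>p'\<close> to \<open>p' + n\<close>.\<close>
        case True
        then have q: "q' = None" using cl ray_lift by blast
        obtain i where i: "p' = int (fst c) + i * int n" using cl True ray_lift by blast
        have "side p' (Some (p' + int n))" using side_loop True i by blast
        moreover have "crs u (Some v) p' (Some (p' + int n))" using cx q uv by (auto simp: crs_def)
        ultimately show False using nx by blast
      qed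
    qed
  qed
  then show ?thesis using side_lift l nr by blast
qed

text \<open>The new ray receives the common tag, which rules out crossings by tags; interleaving is
  then the only obstruction.\<close>

lemma complete_ray:
  assumes np: "\<And>a. \<not> paired a" and nx: "\<And>p q. side p q \<Longrightarrow> \<not> crs u None p q"
  shows "side u None"
proof -
  obtain e where e: "e = 1 \<or> e = -1" "\<And>c. c \<in> \<Delta> \<Longrightarrow> is_ray n c \<Longrightarrow> tag c = e"
    using common_tag[OF np] by metis
  let ?d = "dg n e u None"
  have dd: "?d \<in> diags n" using e n3 by (intro dg_diags) auto
  have l: "is_lift n ?d u None" using n3 by (intro dg_lift) auto
  have "?d \<in> \<Delta>"
  proof (rule maximal[OF dd])
    fix c assume c: "c \<in> \<Delta>"
    show "\<not> crosses n ?d c"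
    proof
      assume "crosses n ?d c"
      moreover have "is_ray n c \<Longrightarrow> tag c = tag ?d" using e c by auto
      ultimately obtain u' v' p q where x: "is_lift n ?d u' v'" "is_lift n c p q" "crs u' v' p q"
        using crosses_iff_crs[OF dd in_diags[OF c]] by auto
      obtain j where j: "u = u' + j * int n" "None = osh (j * int n) v'"
        using is_lift_same_diag[OF x(1) l] by blast
      have "crs u None (p + j * int n) (osh (j * int n) q)" using x(3) j
        by (metis crs_shift)
      then show False using nx side_lift[OF c is_lift_shift[OF x(2)]] np by blast
    qed
  qed
  then show ?thesis using side_lift l np by blast
qed

lemma border: "side u (Some (u + 1))"
  by (simp add: side_present_def)

lemma pair_no_ray: "paired a \<Longrightarrow> \<not> side u None"
  by (metis is_lift_None_iff option.distinct(1) pair_rays side_cases in_diags)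

text \<open>Take the rightmost \<open>v\<close> joined to \<open>u\<close>. A side that crosses the
  arc from \<open>v\<close> to \<open>w\<close>, but neither of the two sides at \<open>u\<close>,
  must start at \<open>u\<close> and end strictly between \<open>v\<close> and \<open>w\<close>,
  against the choice of \<open>v\<close>.\<close>

lemma inner:
  assumes "side u (Some w)" "u + 2 \<le> w"
  shows "\<exists>v. u < v \<and> v < w \<and> side u (Some v) \<and> side v (Some w)"
proof -
  define V where "V = {v. u < v \<and> v < w \<and> side u (Some v)}"
  have "V \<subseteq> {u..w}" by (auto simp: V_def)
  then have fV: "finite V" by (rule finite_subset) auto
  have "u + 1 \<in> V" using assms border by (auto simp: V_def)
  then have mV: "Max V \<in> V" using fV by (intro Max_in) auto
  define v where "v = Max V"
  have v: "u < v" "v < w" "side u (Some v)" using mV by (auto simp: V_def v_def)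
  have mx: "\<And>y. y > v \<Longrightarrow> y < w \<Longrightarrow> \<not> side u (Some y)"
    using fV v by (metis (mono_tags, lifting) Max_ge V_def mem_Collect_eq not_le order.strict_trans v_def)
  have "side v (Some w)"
  proof (cases "w = v + 1")
    case True then show ?thesis using border by simp
  next
    case False
    show ?thesis
    proof (rule complete_fin)
      \<comment> \<open>Narrower than \<open>n\<close> even if the given side is a loop, because
        \<open>u < v\<close>.\<close>
      show "v + 2 \<le> w" "w < v + int n" using False v side_bound[OF assms(1)] by auto
      fix p q assume s: "side p q"
      have 1: "\<not> crs u (Some w) p q" "\<not> crs u (Some v) p q" using side_nc assms v s by auto
      show "\<not> crs v (Some w) p q"
      proof
        assume x: "crs v (Some w) p q"
        show False
        proof (cases q)
          case None then show False using x 1 v by (auto simp: crs_def)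
        next
          case (Some z)
          have "p = u \<and> v < z \<and> z < w" using x 1 v Some by (auto simp: crs_def)
          then show False using mx s Some by blast
        qed
      qed
    qed
  qed
  then show ?thesis using v by blast
qed

text \<open>Rays at two different vertices exist, so the nearest ray on each side is closer than
  \<open>n\<close>. The arc between neighbouring rays crosses no side: a chord crossing it would
  cross one of the two rays, and a ray crossing it would lie between them.\<close>

lemma inner_None:
  assumes "side x None"
  shows "\<exists>v. x < v \<and> v < x + int n \<and> side v None \<and> side x (Some v)"
    and "\<exists>t. t < x \<and> x < t + int n \<and> side t None \<and> side t (Some x)"
proof -
  have np: "\<not> paired a" for a using pair_no_ray assms by blast
  obtain e c1 c2 where c12: "c1 \<in> \<Delta>" "is_ray n c1" "c2 \<in> \<Delta>" "is_ray n c2" "fst c1 \<noteq> fst c2"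
    using common_tag[OF np] by metis
  have "\<exists>c\<in>\<Delta>. is_ray n c \<and> fst c \<noteq> nat (x mod int n)" using c12 by metis
  then obtain c where c: "c \<in> \<Delta>" "is_ray n c" "fst c \<noteq> nat (x mod int n)" by blast
  have cn: "fst c < n" using ray_form c by blast
  have rs: "side (int (fst c) + j * int n) None" for j
    using side_lift[OF c(1)] ray_lift[OF c(2)] np by blast
  \<comment> \<open>The lift of the vertex of \<open>c\<close> in the period that starts at
    \<open>x\<close>.\<close>
  define y where "y = x + (int (fst c) - x) mod int n"
  have "y = int (fst c) + (- ((int (fst c) - x) div int n)) * int n"
    unfolding y_def by (simp add: minus_mult_div_eq_mod[symmetric] algebra_simps)
  then have sy: "side y None" using rs by metis
  have "0 \<le> (int (fst c) - x) mod int n" "(int (fst c) - x) mod int n < int n" using n3 by auto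
  moreover have "(int (fst c) - x) mod int n \<noteq> 0"
  proof
    assume "(int (fst c) - x) mod int n = 0"
    then have "int (fst c) mod int n = x mod int n" by (simp add: mod_eq_dvd_iff mod_0_imp_dvd)
    then show False using c cn by simp
  qed
  ultimately have y: "x < y" "y < x + int n" unfolding y_def by auto
  have con: "side a (Some b)" if "side a None" "side b None" "a < b" "b < a + int n"
     "\<And>z. a < z \<Longrightarrow> z < b \<Longrightarrow> \<not> side z None" for a b
  proof (cases "b = a + 1")
    case True then show ?thesis using border by simp
  next
    case False
    show ?thesis
    proof (rule complete_fin)
      show "a + 2 \<le> b" "b < a + int n" using that False by auto
      fix p q assume s: "side p q"
      then have "\<not> crs a None p q" "\<not> crs b None p q" using side_nc that by auto
      then show "\<not> crs a (Some b) p q"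
        using that(3) that(5)[of p] s by (cases q) (auto simp: crs_def)
    qed
  qed
  {
    define V where "V = {v. x < v \<and> v \<le> y \<and> side v None}"
    have "V \<subseteq> {x..y}" by (auto simp: V_def)
    then have fV: "finite V" by (rule finite_subset) auto
    have "y \<in> V" using sy y by (auto simp: V_def)
    then have mV: "Min V \<in> V" using fV by (intro Min_in) auto
    define m where "m = Min V"
    have m: "x < m" "m \<le> y" "side m None" using mV by (auto simp: V_def m_def)
    have nm: "\<not> side z None" if "x < z" "z < m" for z
    proof
      assume "side z None"
      then have "z \<in> V" using that m by (auto simp: V_def)
      then show False using Min_le[OF fV, of z] that(2) by (simp add: m_def)
    qed
    have "side x (Some m)" using con[OF assms m(3,1) _ nm] m(2) y by linarith
    then show "\<exists>v. x < v \<and> v < x + int n \<and> side v None \<and> side x (Some v)"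
      using m y by (intro exI[of _ m]) auto
  }
  {
    define V where "V = {v. y - int n \<le> v \<and> v < x \<and> side v None}"
    have "V \<subseteq> {y - int n..x}" by (auto simp: V_def)
    then have fV: "finite V" by (rule finite_subset) auto
    have "side (y - int n) None" using side_shift[of y "-1" None] sy by simp
    then have "y - int n \<in> V" using y by (auto simp: V_def)
    then have mV: "Max V \<in> V" using fV by (intro Max_in) auto
    define m where "m = Max V"
    have m: "m < x" "y - int n \<le> m" "side m None" using mV by (auto simp: V_def m_def)
    have nm: "\<not> side z None" if "m < z" "z < x" for z
    proof
      assume "side z None"
      then have "z \<in> V" using that m by (auto simp: V_def)
      then show False using Max_ge[OF fV, of z] that(1) by (simp add: m_def)
    qed
    have "side m (Some x)" using con[OF m(3) assms m(1) _ nm] m(2) y by linarith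
    then show "\<exists>t. t < x \<and> x < t + int n \<and> side t None \<and> side t (Some x)"
      using m y by (intro exI[of _ m]) auto
  }
qed

text \<open>Among the sides lying over the given one take a narrowest. The third corner of the
  triangle below it cannot lie strictly between \<open>u\<close> and \<open>w\<close>, and
  minimality makes the given side an edge of this triangle. If no side lies over it, then there is
  no pair either, since some loop would, and the rays at both ends can be added.\<close>

lemma outer:
  assumes s: "side u (Some w)" "w < u + int n" and uw: "u < w"
  shows "(\<exists>t<u. side t (Some u) \<and> side t (Some w)) \<or> (\<exists>t. olt (Some w) t \<and> side u t \<and> side w t)"
proof (cases "\<exists>x y. side x (Some y) \<and> x \<le> u \<and> w \<le> y \<and> (x,y) \<noteq> (u,w)")
  case True
  define L where "L = {nat (y - x) |x y. side x (Some y) \<and> x \<le> u \<and> w \<le> y \<and> (x,y) \<noteq> (u,w)}"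
  have "L \<noteq> {}" using True by (auto simp: L_def)
  then have "(LEAST l. l \<in> L) \<in> L" by (meson LeastI ex_in_conv)
  then obtain x y where xy: "nat (y - x) = (LEAST l. l \<in> L)" "side x (Some y)" "x \<le> u" "w \<le> y" "(x,y) \<noteq> (u,w)"
    by (auto simp: L_def)
  have mn: "(x',y') = (u,w)" if "side x' (Some y')" "x' \<le> u" "w \<le> y'" "y' - x' < y - x" for x' y'
  proof (rule ccontr)
    assume "(x',y') \<noteq> (u,w)"
    then have "nat (y' - x') \<in> L" using that by (auto simp: L_def)
    then have "nat (y - x) \<le> nat (y' - x')" using xy(1) by (simp add: Least_le)
    then show False using that uw by linarith
  qed
  have "x + 2 \<le> y" using xy uw by auto
  then obtain v where v: "x < v" "v < y" "side x (Some v)" "side v (Some y)" using inner xy by blast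
  have "\<not> crs u (Some w) x (Some v)" "\<not> crs u (Some w) v (Some y)" using side_nc s v by auto
  then have "v \<le> u \<or> w \<le> v" using xy v uw by (auto simp: crs_def)
  then show ?thesis
  proof
    assume "v \<le> u"
    then have "(v,y) = (u,w)" using mn[of v y] v xy by auto
    then show ?thesis using v xy by auto
  next
    assume "w \<le> v"
    then have "(x,v) = (u,w)" using mn[of x v] v xy by auto
    then show ?thesis using v xy by (intro disjI2 exI[of _ "Some y"]) auto
  qed
next
  case False
  then have no: "\<And>x y. side x (Some y) \<Longrightarrow> x \<le> u \<Longrightarrow> w \<le> y \<Longrightarrow> x = u \<and> y = w" by blast
  have np: "\<not> paired a" for a
  proof
    assume a: "paired a"
    define x where "x = int a + ((u - int a) div int n) * int n"
    have "x = u - (u - int a) mod int n" 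
      unfolding x_def by (simp add: minus_mult_div_eq_mod[symmetric] algebra_simps)
    moreover have "0 \<le> (u - int a) mod int n" "(u - int a) mod int n < int n" using n3 by auto
    ultimately have xb: "x \<le> u" "u < x + int n" by auto
    have sx: "side x (Some (x + int n))" using side_loop[OF a] x_def by blast
    have "w \<le> x + int n \<or> x = u"
      using side_nc[OF s(1) sx] xb uw by (auto simp: crs_def)
    then show False using no[OF sx] xb s(2) by auto
  qed
  have "side u None"
  proof (rule complete_ray[OF np])
    fix p q assume pq: "side p q"
    show "\<not> crs u None p q"
      using side_nc[OF s(1) pq] no[of p "the q"] pq uw
      by (cases q) (auto simp: crs_def)
  qed
  moreover have "side w None"
  proof (rule complete_ray[OF np])
    fix p q assume pq: "side p q"
    show "\<not> crs w None p q"
      using side_nc[OF s(1) pq] no[of p "the q"] pq uw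
      by (cases q) (auto simp: crs_def)
  qed
  ultimately show ?thesis by (intro disjI2 exI[of _ None]) auto
qed

end

section \<open>Flips\<close>

text \<open>Uniqueness of the exchanged diagonal is part of the relation: it makes a flip
  recoverable from the common diagonals, on which the rigidity argument rests.\<close>

definition flips :: "nat \<Rightarrow> diag set \<Rightarrow> diag \<Rightarrow> diag \<Rightarrow> bool" where
  "flips n \<Delta> d d' \<longleftrightarrow> d \<in> \<Delta> \<and> d' \<notin> \<Delta> \<and> triangulation n (insert d' (\<Delta> - {d})) \<and>
     (\<forall>c. c \<noteq> d \<and> triangulation n (insert c (\<Delta> - {d})) \<longrightarrow> c = d')"

text \<open>Pure order: an arc that crosses one diagonal of a quadrilateral and none of its sides
  must join the two other corners. Together with \<open>quad_cross2\<close> this yields both that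
  the new diagonal crosses only the old one and that no other diagonal fits.\<close>

lemma quad_cross1:
  assumes "x < y" "y < z" "olt (Some z) w" "vlt u v" "crs u v x (Some z)"
    "\<not> crs u v x (Some y)" "\<not> crs u v y (Some z)" "\<not> crs u v z w" "\<not> crs u v x w"
  shows "u = y \<and> v = w"
  using assms by (cases v; cases w; simp add: crs_def; smt)

lemma quad_cross2:
  assumes "x < y" "y < z" "olt (Some z) w" "vlt u v" "crs u v y w"
    "\<not> crs u v x (Some y)" "\<not> crs u v y (Some z)" "\<not> crs u v z w" "\<not> crs u v x w"
  shows "u = x \<and> v = Some z"
  using assms by (cases v; cases w; simp add: crs_def; smt)

lemma between_multiples:
  fixes i j N :: int
  assumes "a + i * N < a + j * N" "a + j * N < a + i * N + N" 
  shows False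
proof -
  have "i * N < j * N" "j * N < (i + 1) * N" using assms by (auto simp: algebra_simps)
  moreover have "N > 0" using assms by linarith
  ultimately have "i < j" "j < i + 1" by (auto simp: mult_less_cancel_right)
  then show False by simp
qed

lemma lift_vertex_neq:
  assumes "is_lift n b p q" "is_lift n c u v" "p < u" "u < p + int n"
  shows "fst b \<noteq> fst c"
proof
  assume *: "fst b = fst c"
  obtain i where "p = int (fst b) + i * int n" using assms(1) by (cases b) (auto simp: is_lift_def)
  moreover obtain j where "u = int (fst b) + j * int n" using assms(2) * by (cases c) (auto simp: is_lift_def)
  ultimately show False using between_multiples assms(3,4) by simp
qed

context triang
begin

text \<open>A diagonal compatible with the exchanged set either crosses \<open>d\<close>, and then
  is \<open>d'\<close> by \<open>uq\<close>, or is compatible with the whole triangulation and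
  belongs to it by maximality.\<close>

lemma flipsI:
  assumes d: "d \<in> \<Delta>" and d': "d' \<in> diags n" and x: "crosses n d' d"
    and cp: "\<And>b. b \<in> \<Delta> - {d} \<Longrightarrow> \<not> crosses n d' b"
    and uq: "\<And>c. c \<in> diags n \<Longrightarrow> crosses n c d \<Longrightarrow> (\<And>b. b \<in> \<Delta> - {d} \<Longrightarrow> \<not> crosses n c b) \<Longrightarrow> c = d'"
  shows "flips n \<Delta> d d'"
  unfolding flips_def
proof (intro conjI allI impI)
  show "d \<in> \<Delta>" by fact
  show nin: "d' \<notin> \<Delta>" using no_cross x d by blast
  let ?D = "insert d' (\<Delta> - {d})"
  have sub': "?D \<subseteq> diags n" using d' in_diags by blast
  show "triangulation n ?D"
    unfolding triangulation_def
  proof (intro conjI allI impI)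
    show "?D \<subseteq> diags n" by fact
    show "noncrossing n ?D" unfolding noncrossing_def
      using cp no_cross not_crosses_self[OF d'] crosses_sym[OF d' in_diags] by blast
    fix D assume D: "?D \<subseteq> D \<and> D \<subseteq> diags n \<and> noncrossing n D"
    have "c \<in> ?D" if c: "c \<in> D" for c
    proof (cases "crosses n c d")
      case True
      then have "c = d'" using uq[of c] c D by (auto simp: noncrossing_def)
      then show ?thesis by simp
    next
      case False
      have "c \<in> \<Delta>"
      proof (rule maximal)
        show "c \<in> diags n" using c D by blast
        fix b assume "b \<in> \<Delta>"
        then show "\<not> crosses n c b" using False c D by (cases "b = d") (auto simp: noncrossing_def)
      qed
      moreover have "\<not> crosses n d' c" using c D by (auto simp: noncrossing_def)
      ultimately show ?thesis using x by blast
    qed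
    then show "D = ?D" using D by blast
  qed
  fix c assume c: "c \<noteq> d \<and> triangulation n (insert c (\<Delta> - {d}))"
  then have cd: "c \<in> diags n" "\<And>b. b \<in> \<Delta> - {d} \<Longrightarrow> \<not> crosses n c b"
    by (auto simp: triangulation_def noncrossing_def)
  \<comment> \<open>Otherwise \<Delta> - {d} itself would be maximal, although \<open>d\<close> can
    be added to it.\<close>
  have "c \<notin> \<Delta>"
  proof
    assume "c \<in> \<Delta>"
    then have "insert c (\<Delta> - {d}) = \<Delta> - {d}" using c by blast
    then have "triangulation n (\<Delta> - {d})" using c by simp
    moreover have "\<Delta> \<subseteq> diags n" "noncrossing n \<Delta>" using tri by (auto simp: triangulation_def)
    ultimately have "\<Delta> = \<Delta> - {d}" unfolding triangulation_def by blast
    then show False using d by blast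
  qed
  then have "crosses n c d" using maximal[OF cd(1)] cd(2) by blast
  then show "c = d'" using uq cd by blast
qed

lemma ray_at: "side p None \<Longrightarrow> \<exists>c\<in>\<Delta>. is_ray n c \<and> is_lift n c p None \<and> c \<in> lab p None"
  by (elim side_cases) (use is_lift_None_iff in_diags in blast)+

lemma np_if_ray: "side p None \<Longrightarrow> \<not> paired a"
  using pair_no_ray by blast

lemma same_tag:
  assumes "\<And>a. \<not> paired a" "b \<in> \<Delta>" "is_ray n b" "c \<in> \<Delta>" "is_ray n c"
  shows "tag b = tag c"
  using common_tag[OF assms(1)] assms by metis

text \<open>Only a pair puts two diagonals on one arc: chords are determined by their arcs, and
  without a pair all rays share one tag.\<close>

lemma single_lab:
  assumes "d \<in> lab p q" "is_ray n d \<longrightarrow> \<not> paired (fst d)"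
  shows "lab p q = {d}"
proof -
  have d: "d \<in> \<Delta>" "is_lift n d p q" using assms by (auto simp: lab_iff)
  have "c = d" if c: "c \<in> lab p q" for c
  proof (cases "is_ray n c \<and> paired (fst c)")
    case True
    then obtain "c \<in> \<Delta>" "q = Some (p + int n)" using c by (auto simp: lab_iff)
    then show ?thesis using is_lift_bounds[of n d p "p + int n"] in_diags d by auto
  next
    case False
    then have c': "c \<in> \<Delta>" "is_lift n c p q" using c by (auto simp: lab_iff)
    have "q \<noteq> None \<or> tag d = tag c"
    proof (cases q)
      case None
      then have "is_ray n d" "is_ray n c" using is_lift_None_iff d c' in_diags by blast+
      moreover have "\<not> paired a" for a using np_if_ray side_lift c' False None by blast
      ultimately show ?thesis using same_tag d c' by blast
    qed simp
    then show ?thesis using is_lift_inj[of n d p q c] d c' in_diags by blast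
  qed
  then show ?thesis using assms(1) by blast
qed

text \<open>The candidate \<open>c\<close> may cross \<open>d\<close>, so it need not belong to the
  triangulation and \<open>lift_side_nc\<close> does not apply to it. By \<open>dp\<close> both
  members of any pair are still present; a ray strictly inside their loop would differ in tag from
  one of them.\<close>

lemma compat_side:
  assumes c: "c \<in> diags n" "\<And>b. b \<in> \<Delta> - {d} \<Longrightarrow> \<not> crosses n c b"
    and s: "side p q" "d \<notin> lab p q" and dp: "\<not> (is_ray n d \<and> paired (fst d))"
    and l: "is_lift n c u v"
  shows "\<not> crs u v p q"
  using s(1)
proof (cases rule: side_cases)
  case 1 then show ?thesis by simp
next
  case (2 b)
  then have "b \<noteq> d" using s by blast
  then show ?thesis using crossesI_crs[OF c(1) in_diags l 2(2)] c(2) 2 by blast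
next
  case (3 a j)
  have m: "(a,n,1) \<in> \<Delta> - {d}" "(a,n,-1) \<in> \<Delta> - {d}" using 3 dp by (auto simp: has_pair_def)
  have l3: "is_lift n (a,n,1) p None" using 3 pair_lift by blast
  have l4: "is_lift n (a,n,1) (p + int n) None" using is_lift_shift[OF l3, of 1] by simp
  show ?thesis
  proof (cases v)
    case (Some w)
    then have "w < u + int n" using is_lift_bounds c l by blast
    moreover have "\<not> crs u v p None" "\<not> crs u v (p + int n) None"
      using crossesI_crs[OF c(1) _ l] l3 l4 c(2)[OF m(1)] in_diags m by blast+
    ultimately show ?thesis using Some 3 by (auto simp: crs_def)
  next
    case None
    have "\<not> (p < u \<and> u < p + int n)"
    proof
      assume "p < u \<and> u < p + int n"
      then have "a \<noteq> fst c" using lift_vertex_neq l3 l by fastforce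
      moreover have "is_ray n c" using None l c(1) is_lift_None_iff by blast
      moreover have "tag c \<noteq> 1 \<or> tag c \<noteq> -1" by auto
      ultimately have "crosses n c (a,n,1) \<or> crosses n c (a,n,-1)" by (cases c) auto
      then show False using c(2) m by blast
    qed
    then show ?thesis using None 3 by (auto simp: crs_def)
  qed
qed

text \<open>If the fourth corner is the puncture, \<open>z = x + n\<close> must be excluded: the
  rays at \<open>x\<close> and \<open>z\<close> would be lifts of the same diagonal and the region a
  digon around the puncture. For a finite corner the bound follows from
  \<open>side_bound\<close>.\<close>

definition quad :: "int \<Rightarrow> int \<Rightarrow> int \<Rightarrow> int option \<Rightarrow> bool" where
  "quad x y z w \<longleftrightarrow> x < y \<and> y < z \<and> olt (Some z) w \<and> side x (Some y) \<and> side y (Some z) \<and>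
     side z w \<and> side x w \<and> (w = None \<longrightarrow> z < x + int n)"

lemma quad_width:
  assumes "quad x y z w"
  shows "z < x + int n" "w = Some w' \<Longrightarrow> w' \<le> x + int n"
  using assms side_bound[of x "the w"] by (cases w; auto simp: quad_def)+

lemma lab_common:
  assumes "d \<in> lab p q" "d \<in> lab p' q'"
  shows "\<exists>j. p' = p + j * int n \<and> q' = osh (j * int n) q"
proof (cases "is_ray n d \<and> paired (fst d)")
  case True
  then obtain i j where ij: "p = int (fst d) + i * int n" "q = Some (p + int n)"
    "p' = int (fst d) + j * int n" "q' = Some (p' + int n)" using assms by (auto simp: lab_iff)
  have "p' = p + (j - i) * int n" unfolding ij by (simp add: algebra_simps)
  then show ?thesis using ij(2,4) by (intro exI[of _ "j - i"]) auto
next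
  case False
  then have "is_lift n d p q" "is_lift n d p' q'" using assms by (auto simp: lab_iff)
  then show ?thesis by (rule is_lift_same_diag)
qed

lemma lab_same_start: "s \<noteq> s' \<Longrightarrow> lab r s \<inter> lab r s' = {}"
proof -
  assume "s \<noteq> s'"
  have "s = s'" if "d \<in> lab r s" "d \<in> lab r s'" for d
    using that by (cases d) (auto simp: lab_iff is_lift_def split: if_splits)
  then show ?thesis using \<open>s \<noteq> s'\<close> by blast
qed

lemma lab_near_start: "r < r' \<Longrightarrow> r' < r + int n \<Longrightarrow> lab r s \<inter> lab r' s' = {}"
proof -
  assume r: "r < r'" "r' < r + int n"
  have False if d: "d \<in> lab r s" "d \<in> lab r' s'" for d
  proof -
    obtain j where "r' = r + j * int n" using lab_common[OF d] by blast
    then show False using r multiple_cases[of j n] by linarith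
  qed
  then show ?thesis by blast
qed

text \<open>The corners \<open>x\<close>, \<open>y\<close>, \<open>z\<close> lie within less than
  one period, so arcs starting at different corners come from different diagonals. The first four
  pairs are those whose arrows at a diagonal of the quadrilateral have opposite directions; their
  disjointness excludes cancellation.\<close>

lemma quad_disjoint:
  assumes Q: "quad x y z w"
  shows "lab x (Some y) \<inter> lab y (Some z) = {}" "lab x (Some y) \<inter> lab x w = {}"
    "lab z w \<inter> lab y (Some z) = {}" "lab z w \<inter> lab x w = {}"
    "lab x (Some z) \<inter> (lab x (Some y) \<union> lab y (Some z) \<union> lab z w \<union> lab x w) = {}"
    "lab y w \<inter> (lab x (Some y) \<union> lab y (Some z) \<union> lab z w \<union> lab x w) = {}"
proof -
  note q = Q[unfolded quad_def]
  have "z < x + int n" using quad_width Q by blast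
  then have n: "lab x s \<inter> lab y s' = {}" "lab y s \<inter> lab z s' = {}" "lab x s \<inter> lab z s' = {}" for s s'
    using lab_near_start q by auto
  have m: "lab x (Some y) \<inter> lab x w = {}" "lab x (Some z) \<inter> lab x (Some y) = {}"
    "lab x (Some z) \<inter> lab x w = {}" "lab y w \<inter> lab y (Some z) = {}"
    by (rule lab_same_start; use q in auto)+
  show "lab x (Some y) \<inter> lab y (Some z) = {}" "lab x (Some y) \<inter> lab x w = {}"
    "lab z w \<inter> lab y (Some z) = {}" "lab z w \<inter> lab x w = {}"
    "lab x (Some z) \<inter> (lab x (Some y) \<union> lab y (Some z) \<union> lab z w \<union> lab x w) = {}"
    "lab y w \<inter> (lab x (Some y) \<union> lab y (Some z) \<union> lab z w \<union> lab x w) = {}"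
    using n m by blast+
qed

text \<open>The hypothesis \<open>pq\<close> treats both diagonals of the quadrilateral at once. If
  either of them is a ray, then the fourth corner is the puncture, and the rays at \<open>x\<close>
  and \<open>z\<close> are sides that survive the flip and determine the tag.\<close>

lemma quad_flips:
  assumes Q: "quad x y z w" and d: "d \<in> \<Delta>" "is_lift n d p q" "\<not> (is_ray n d \<and> paired (fst d))"
    and pq: "(p = x \<and> q = Some z \<and> p' = y \<and> q' = w) \<or> (p = y \<and> q = w \<and> p' = x \<and> q' = Some z)"
  shows "\<exists>d'. flips n \<Delta> d d' \<and> d' \<in> diags n \<and> is_lift n d' p' q' \<and> 
     (is_ray n d' \<longrightarrow> (\<forall>c\<in>\<Delta>. is_ray n c \<longrightarrow> tag c = tag d'))"
proof -
  note q = Q[unfolded quad_def]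
  have wd: "z < x + int n" "\<And>w'. w = Some w' \<Longrightarrow> w' \<le> x + int n" using quad_width Q by blast+
  have H1: "u = p' \<and> v = q'" if "vlt u v" "crs u v p q" 
    "\<not> crs u v x (Some y)" "\<not> crs u v y (Some z)" "\<not> crs u v z w" "\<not> crs u v x w" for u v
    using pq
  proof (elim disjE conjE)
    assume "p = x" "q = Some z" "p' = y" "q' = w"
    then show ?thesis using quad_cross1[of x y z w u v, OF _ _ _ that(1) _ that(3-6)] that(2) q by simp
  next
    assume "p = y" "q = w" "p' = x" "q' = Some z"
    then show ?thesis using quad_cross2[of x y z w u v, OF _ _ _ that(1) _ that(3-6)] that(2) q by simp
  qed
  have H2: "u = p \<and> v = q" if "vlt u v" "crs u v p' q'" 
    "\<not> crs u v x (Some y)" "\<not> crs u v y (Some z)" "\<not> crs u v z w" "\<not> crs u v x w" for u v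
    using pq
  proof (elim disjE conjE)
    assume "p = x" "q = Some z" "p' = y" "q' = w"
    then show ?thesis using quad_cross2[of x y z w u v, OF _ _ _ that(1) _ that(3-6)] that(2) q by simp
  next
    assume "p = y" "q = w" "p' = x" "q' = Some z"
    then show ?thesis using quad_cross1[of x y z w u v, OF _ _ _ that(1) _ that(3-6)] that(2) q by simp
  qed
  have X: "crs p' q' p q" using q pq by (cases w) (auto simp: crs_def)
  have rays: "q' = None \<or> q = None \<Longrightarrow> side x None \<and> side z None" using q pq by auto
  obtain e where e: "e = 1 \<or> e = -1" "q' = None \<longrightarrow> (\<forall>c\<in>\<Delta>. is_ray n c \<longrightarrow> tag c = e)"
  proof (cases "q' = None")
    case True
    then have "\<not> paired a" for a using np_if_ray rays by blast
    then show ?thesis using common_tag that by metis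
  qed (use that in blast)
  let ?d = "dg n e p' q'"
  have bd: "p' + 2 \<le> v \<and> v < p' + int n" if "q' = Some v" for v
    using that pq q wd(1) wd(2)[of v] by auto
  have d': "?d \<in> diags n" using n3 e(1) bd by (intro dg_diags) auto
  have l': "is_lift n ?d p' q'" using n3 bd by (intro dg_lift) auto
  have tg: "is_ray n ?d \<Longrightarrow> q' = None \<and> tag ?d = e" using l' d' is_lift_None_iff[OF d' l'] by auto
  have nl: "d \<notin> lab x (Some y)" "d \<notin> lab y (Some z)" "d \<notin> lab z w" "d \<notin> lab x w"
  proof -
    have "d \<in> lab p q" using side_lift d by blast
    then show "d \<notin> lab x (Some y)" "d \<notin> lab y (Some z)" "d \<notin> lab z w" "d \<notin> lab x w"
      using quad_disjoint(5,6)[OF Q] pq by blast+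
  qed
  have "flips n \<Delta> d ?d"
  proof (rule flipsI[OF d(1) d'])
    show "crosses n ?d d" using crossesI_crs[OF d' in_diags l' d(2) X] d by blast
  next
    fix b assume b: "b \<in> \<Delta> - {d}"
    show "\<not> crosses n ?d b"
    proof
      assume "crosses n ?d b"
      then have "\<exists>u v. is_lift n b u v \<and> crs u v p' q'"
      proof -
        have "\<not> (is_ray n ?d \<and> is_ray n b \<and> tag ?d \<noteq> tag b)" using tg e b by auto
        then obtain u' v' u v where *: "is_lift n ?d u' v'" "is_lift n b u v" "crs u' v' u v"
          using \<open>crosses n ?d b\<close> crosses_iff_crs[OF d' in_diags] b by blast
        obtain j where j: "p' = u' + j * int n" "q' = osh (j * int n) v'"
          using is_lift_same_diag[OF *(1) l'] by blast
        have "crs (u + j * int n) (osh (j * int n) v) p' q'" using *(3) j crs_shift crs_sym by metis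
        then show ?thesis using is_lift_shift[OF *(2)] by blast
      qed
      then obtain u v where uv: "is_lift n b u v" "crs u v p' q'" by blast
      have "vlt u v" using is_lift_vlt in_diags uv b by blast
      then have pq': "u = p \<and> v = q" using H2 uv lift_side_nc[OF _ uv(1)] b q by blast
      then have lb: "is_lift n b p q" using uv by simp
      have "q \<noteq> None \<or> tag d = tag b"
      proof (cases "q = None")
        case True
        then have "is_ray n b" "is_ray n d" using is_lift_None_iff lb d in_diags b by blast+
        moreover have "\<not> paired a" for a using True rays np_if_ray by blast
        ultimately show ?thesis using same_tag d b by blast
      qed simp
      then have "d = b" using is_lift_inj[OF d(2) lb] in_diags d b by blast
      then show False using b by blast
    qed
  next
    fix c assume c: "c \<in> diags n" "crosses n c d" "\<And>b. b \<in> \<Delta> - {d} \<Longrightarrow> \<not> crosses n c b"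
    have rneq: "\<exists>cx\<in>\<Delta>-{d}. \<exists>cz\<in>\<Delta>-{d}. is_lift n cx x None \<and> is_lift n cz z None \<and> is_ray n cx \<and> is_ray n cz"
      if "q' = None \<or> q = None"
    proof -
      have "side x None" "side z None" using rays that by auto
      then obtain cx cz where "cx \<in> \<Delta>" "cz \<in> \<Delta>" "is_lift n cx x None" "is_lift n cz z None" "is_ray n cx" "is_ray n cz"
        "cx \<in> lab x None" "cz \<in> lab z None"
        using ray_at by meson
      moreover have "w = None" using that pq by auto
      ultimately show ?thesis using nl by blast
    qed
    show "c = ?d"
    proof (cases "\<exists>u v p q. is_lift n c u v \<and> is_lift n d p q \<and> crs u v p q")
      case True
      then obtain u' v' u v where *: "is_lift n d u' v'" "is_lift n c u v" "crs u v u' v'"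
        by blast
      obtain j where j: "p = u' + j * int n" "q = osh (j * int n) v'"
        using is_lift_same_diag[OF *(1) d(2)] by blast
      have x: "crs (u + j * int n) (osh (j * int n) v) p q" using *(3) j crs_shift by metis
      have lc: "is_lift n c (u + j * int n) (osh (j * int n) v)" using is_lift_shift[OF *(2)] by blast
      have "u + j * int n = p' \<and> osh (j * int n) v = q'"
        using H1 x is_lift_vlt[OF c(1) lc] compat_side[OF c(1,3) _ _ d(3) lc] q nl by blast
      then have lc': "is_lift n c p' q'" using lc by simp
      have "q' \<noteq> None \<or> tag c = e"
      proof (cases "q' = None")
        case True
        then obtain cx where cx: "cx \<in> \<Delta> - {d}" "is_lift n cx x None" "is_ray n cx" using rneq by blast
        have "p' = y" using True pq by auto
        then have "fst cx \<noteq> fst c" using lift_vertex_neq[OF cx(2) lc'] q wd by auto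
        moreover have "is_ray n c" using lc' True is_lift_None_iff c by blast
        moreover have "\<not> crosses n c cx" using c cx by blast
        ultimately have "tag c = tag cx" using crosses_iff_crs[OF c(1) in_diags[of cx]] cx by auto
        then show ?thesis using e True cx by auto
      qed simp
      then show ?thesis using is_lift_inj[OF lc' l' c(1) d'] dg_tag by (cases q') auto
    next
      \<comment> \<open>Here \<open>c\<close> and \<open>d\<close> cross by tags alone. To avoid the
        rays at \<open>x\<close> and \<open>z\<close>, which carry the tag of \<open>d\<close>, the
        ray \<open>c\<close> would have to sit at both of their vertices.\<close>
      case False
      then have f: "is_ray n c" "is_ray n d" "fst c \<noteq> fst d" "tag c \<noteq> tag d"
        using c(2) crosses_iff_crs[OF c(1) in_diags[OF d(1)]] by auto
      then have qn: "q = None" using is_lift_None_iff d in_diags by blast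
      then have np: "\<not> paired a" for a using rays np_if_ray by blast
      obtain cx cz where r: "cx \<in> \<Delta> - {d}" "cz \<in> \<Delta> - {d}" "is_lift n cx x None" "is_lift n cz z None" "is_ray n cx" "is_ray n cz"
        using rneq qn by blast
      have "fst cx \<noteq> fst cz" using lift_vertex_neq[OF r(3,4)] q wd by auto
      moreover have "tag cx = tag d" "tag cz = tag d"
        using same_tag[OF np _ _ d(1) f(2)] r by blast+
      moreover have "\<not> crosses n c cx" "\<not> crosses n c cz" using c r by blast+
      moreover have "fst c = fst b" if "b \<in> \<Delta>" "is_ray n b" "tag b = tag d" "\<not> crosses n c b" for b
        using crosses_iff_crs[OF c(1) in_diags[OF that(1)]] that f by metis
      ultimately show ?thesis using r by (metis DiffD1)
    qed
  qed
  then show ?thesis using d' l' tg e by (intro exI[of _ ?d]) auto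
qed

text \<open>The following two flips, inverse to each other, are the only ones that change \<^const>\<open>has_pair\<close>;
they do not take place in a quadrilateral.\<close>

lemma pair_flips:
  assumes pa: "paired a" and e: "e = 1 \<or> e = -1" 
    and v: "int a < v" "v < int a + int n" "side (int a) (Some v)" "side v (Some (int a + int n))"
  shows "flips n \<Delta> (a, n, -e) (dg n e v None)"
proof -
  let ?d = "(a,n,-e)" and ?p = "(a,n,e)" and ?q = "dg n e v None"
  have m: "?d \<in> \<Delta>" "?p \<in> \<Delta>" using pa e by (auto simp: has_pair_def)
  have pd: "?p \<noteq> ?d" using e by auto
  have q: "?q \<in> diags n" "is_lift n ?q v None" using e n3 by (auto intro!: dg_diags dg_lift)
  have la: "is_lift n (a,n,f) (int a) None" for f using pair_lift[OF pa, of f 0] by simp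
  have "fst ?q \<noteq> a" using lift_vertex_neq[OF la q(2)] v by auto
  show ?thesis
  proof (rule flipsI[OF m(1) q(1)])
    show "crosses n ?q ?d" unfolding crosses_iff_crs[OF q(1) in_diags[OF m(1)]] using \<open>fst ?q \<noteq> a\<close> e by auto
  next
    fix b assume b: "b \<in> \<Delta> - {?d}"
    show "\<not> crosses n ?q b"
    proof
      assume x: "crosses n ?q b"
      have "\<not> (is_ray n b \<and> tag b \<noteq> e)"
      proof
        assume *: "is_ray n b \<and> tag b \<noteq> e"
        then have "b = ?d" using pair_rays[OF pa] ray_form[of b] b e by auto
        then show False using b by blast
      qed
      then obtain u' v' s t where *: "is_lift n ?q u' v'" "is_lift n b s t" "crs u' v' s t"
        using x crosses_iff_crs[OF q(1) in_diags] b by (metis DiffD1 dg_tag(1))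
      obtain j where j: "v = u' + j * int n" "None = osh (j * int n) v'"
          using is_lift_same_diag[OF *(1) q(2)] by blast
      define s' t' where "s' = s + j * int n" and "t' = osh (j * int n) t"
      have x': "crs v None s' t'" using *(3) j crs_shift unfolding s'_def t'_def by metis
      have lb: "is_lift n b s' t'" using is_lift_shift[OF *(2)] s'_def t'_def by blast
      have "\<not> crs s' t' (int a) (Some v)" "\<not> crs s' t' v (Some (int a + int n))"
        "\<not> crs s' t' (int a) (Some (int a + int n))"
        using lift_side_nc[OF _ lb] b v side_loop[OF pa, of 0] by auto
      moreover have "\<And>r. t' = Some r \<Longrightarrow> r < s' + int n" using is_lift_bounds lb in_diags b by blast
      ultimately show False using x' v by (cases t') (auto simp: crs_def)
    qed
  next
    fix c assume c: "c \<in> diags n" "crosses n c ?d" "\<And>b. b \<in> \<Delta> - {?d} \<Longrightarrow> \<not> crosses n c b"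
    have "\<not> crosses n c ?p" using c m pd by blast
    moreover have "is_lift n ?d u w \<Longrightarrow> is_lift n ?p u w" for u w by (auto simp: is_lift_def)
    ultimately have ns: "\<not> (\<exists>u v p q. is_lift n c u v \<and> is_lift n ?d p q \<and> crs u v p q)"
      using crosses_iff_crs[OF c(1) in_diags[OF m(2)]] by blast
    then have f: "is_ray n c" "fst c \<noteq> a" "tag c \<noteq> - e"
      using c(2) crosses_iff_crs[OF c(1) in_diags[OF m(1)]] by auto
    have cf: "c = (fst c, n, e)" "fst c < n" using f c(1) e by (cases c; auto simp: diags_def)+
    \<comment> \<open>The lift of the vertex of \<open>c\<close> between \<open>a\<close> and
      \<open>a + n\<close>. Since it avoids both sides that meet at \<open>v\<close>, it can only be
      \<open>v\<close>.\<close>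
    define u where "u = int (fst c) + (if fst c < a then 1 else 0) * int n"
    have lc: "is_lift n c u None" using ray_lift[OF f(1)] u_def by blast
    have an: "a < n" using ray_form[OF m(1)] by auto
    have ub: "int a < u" "u < int a + int n" using f an cf(2) unfolding u_def by (auto split: if_splits)
    have "\<not> crs u None (int a) (Some v)" "\<not> crs u None v (Some (int a + int n))"
    proof -
      have *: "\<not> crs u None r (Some s)" if "side r (Some s)" "s < r + int n" for r s
        using that(1)
      proof (cases rule: side_cases)
        case 1 then show ?thesis using crs_border(1)[of u None r] by simp
      next
        case (2 b)
        then have "b \<noteq> ?d" using pa by auto
        then show ?thesis using crossesI_crs[OF c(1) in_diags lc 2(2)] c(3) 2 by blast
      qed (use that in auto)
      show "\<not> crs u None (int a) (Some v)" "\<not> crs u None v (Some (int a + int n))"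
        using * v by auto
    qed
    then have "u = v" using ub v by (auto simp: crs_def)
    then have "is_lift n c v None" using lc by simp
    then show "c = ?q" using is_lift_inj[OF _ q(2) c(1) q(1)] cf by (metis dg_tag(1) snd_conv)
  qed
qed

lemma digon_flips:
  assumes d: "d \<in> \<Delta>" "is_ray n d" "is_lift n d x None" and p: "p \<in> \<Delta>" "is_ray n p" "is_lift n p z None"
    and s: "side x None" and o: "z - int n < x" "x < z" "side (z - int n) (Some x)" "side x (Some z)"
  shows "flips n \<Delta> d (fst p, n, - tag p)"
proof -
  let ?q = "(fst p, n, - tag p)"
  have np: "\<not> paired a" for a using s np_if_ray by blast
  have pf: "p = (fst p, n, tag p)" "fst p < n" "tag p = 1 \<or> tag p = -1" using ray_form p by auto
  have tg: "tag d = tag p" using same_tag[OF np] d p by blast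
  have q: "?q \<in> diags n" using pf n3 by (auto simp: diags_def)
  have lq: "is_lift n ?q u v \<longleftrightarrow> is_lift n p u v" for u v 
    using ray_lift[of ?q u v] ray_lift[OF p(2), of u v] by simp
  have lz: "is_lift n p (z - int n) None" using is_lift_shift[OF p(3), of "-1"] by simp
  have ne: "fst p \<noteq> fst d" using lift_vertex_neq[OF lz d(3)] o by simp
  have pd: "p \<noteq> d" using ne by auto
  show ?thesis
  proof (rule flipsI[OF d(1) q])
    show "crosses n ?q d" unfolding crosses_iff_crs[OF q in_diags[OF d(1)]]
      using ne d tg pf by auto
  next
    have only: "fst b = fst p \<or> b = d" if b: "b \<in> \<Delta>" "is_ray n b" for b
    proof -
      \<comment> \<open>The lift of the vertex of \<open>b\<close> in the period starting at
        \<open>z - n\<close>; the two sides of the digon leave only \<open>z - n\<close> and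
        \<open>x\<close>.\<close>
      define u where "u = z - int n + (int (fst b) - z) mod int n"
      have ub: "z - int n \<le> u" "u < z" using n3 unfolding u_def by auto
      have "u = int (fst b) + (- ((int (fst b) - z) div int n) - 1) * int n"
        unfolding u_def by (simp add: minus_mult_div_eq_mod[symmetric] algebra_simps)
      then have lb: "is_lift n b u None" using ray_lift[OF b(2)] by blast
      have "\<not> crs u None (z - int n) (Some x)" "\<not> crs u None x (Some z)"
        using lift_side_nc[OF b(1) lb] o by auto
      then have "u = z - int n \<or> u = x" using ub by (auto simp: crs_def)
      then show ?thesis
      proof
        assume "u = z - int n"
        then have "is_lift n b (z - int n) None" using lb by simp
        then have "fst b = fst p" using is_lift_same_arc lz in_diags b p by blast
        then show ?thesis ..
      next
        assume "u = x"
        then have "is_lift n b x None" using lb by simp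
        moreover have "tag b = tag d" using same_tag[OF np] b d by blast
        ultimately have "b = d" using is_lift_inj d(3) in_diags b d by blast
        then show ?thesis ..
      qed
    qed
    fix b assume b: "b \<in> \<Delta> - {d}"
    have "\<not> (\<exists>u v p q. is_lift n ?q u v \<and> is_lift n b p q \<and> crs u v p q)"
      unfolding lq using nc_crs[OF p(1)] b by blast
    moreover have "is_ray n b \<Longrightarrow> fst b = fst p" using only b by blast
    ultimately show "\<not> crosses n ?q b" using crosses_iff_crs[OF q in_diags] b by auto
  next
    fix c assume c: "c \<in> diags n" "crosses n c d" "\<And>b. b \<in> \<Delta> - {d} \<Longrightarrow> \<not> crosses n c b"
    have ncp: "\<not> crosses n c p" using c p pd by blast
    have nl: "d \<notin> lab r (Some s)" for r s using np d is_lift_None_iff[of d n r "Some s"] in_diags by (auto simp: lab_iff)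
    have "\<not> (\<exists>u v p q. is_lift n c u v \<and> is_lift n d p q \<and> crs u v p q)"
    proof
      assume "\<exists>u v p q. is_lift n c u v \<and> is_lift n d p q \<and> crs u v p q"
      then obtain u' v' u v where *: "is_lift n d u' v'" "is_lift n c u v" "crs u v u' v'"
        by blast
      obtain j where j: "x = u' + j * int n" "None = osh (j * int n) v'"
        using is_lift_same_diag[OF *(1) d(3)] by blast
      define s t where "s = u + j * int n" and "t = osh (j * int n) v"
      have x: "crs s t x None" using *(3) j crs_shift s_def t_def by metis
      have lc: "is_lift n c s t" using is_lift_shift[OF *(2)] s_def t_def by blast
      have "\<not> crs s t (z - int n) (Some x)" "\<not> crs s t x (Some z)" 
        using compat_side[OF c(1,3) _ nl _ lc] o np by auto
      moreover have "\<not> crs s t (z - int n) None" "\<not> crs s t z None"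
        using crossesI_crs[OF c(1) in_diags lc] p lz ncp by blast+
      moreover have "\<And>r. t = Some r \<Longrightarrow> r < s + int n" using is_lift_bounds lc c by blast
      ultimately show False using x o by (cases t) (auto simp: crs_def)
    qed
    then have f: "is_ray n c" "fst c \<noteq> fst d" "tag c \<noteq> tag d"
      using c(2) crosses_iff_crs[OF c(1) in_diags[OF d(1)]] by auto
    then have "fst c = fst p" using ncp tg crosses_iff_crs[OF c(1) in_diags[OF p(1)]] p by auto
    moreover have "tag c = - tag p" using f tg c(1) pf by (cases c) (auto simp: diags_def)
    ultimately show "c = ?q" using f by (cases c) auto
  qed
qed

end

section \<open>Mutation of the quiver under a flip\<close>

definition ind :: "'a set \<Rightarrow> 'a \<Rightarrow> int" where
  "ind S x = (if x \<in> S then 1 else 0)"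

definition wedge :: "'a set \<Rightarrow> 'a set \<Rightarrow> 'a \<Rightarrow> 'a \<Rightarrow> int" where
  "wedge S T x y = ind S x * ind T y - ind S y * ind T x"

text \<open>The contribution of one triangle to the exchange matrix.  Written as an alternating form in the
label sets of the sides, the effect of a flip becomes a bilinear identity.\<close>

definition tri_form :: "nat \<Rightarrow> diag set \<Rightarrow> int \<times> int \<times> int option \<Rightarrow> diag \<Rightarrow> diag \<Rightarrow> int" where
  "tri_form n \<Delta> t \<beta> \<gamma> = (case t of (u, v, w) \<Rightarrow>
     wedge (labels n \<Delta> u (Some v)) (labels n \<Delta> u w) \<beta> \<gamma>
   + wedge (labels n \<Delta> u w) (labels n \<Delta> v w) \<beta> \<gamma>
   + wedge (labels n \<Delta> v w) (labels n \<Delta> u (Some v)) \<beta> \<gamma>)"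

definition touch :: "nat \<Rightarrow> diag set \<Rightarrow> diag set \<Rightarrow> int \<times> int \<times> int option \<Rightarrow> bool" where
  "touch n \<Delta> D t = (case t of (u, v, w) \<Rightarrow>
     D \<inter> (labels n \<Delta> u (Some v) \<union> labels n \<Delta> u w \<union> labels n \<Delta> v w) \<noteq> {})"

definition tsh :: "int \<Rightarrow> int \<times> int \<times> int option \<Rightarrow> int \<times> int \<times> int option" where
  "tsh c t = (case t of (u, v, w) \<Rightarrow> (u + c, v + c, osh c w))"

definition normt :: "nat \<Rightarrow> int \<times> int \<times> int option \<Rightarrow> int \<times> int \<times> int option" where
  "normt n t = tsh (- (fst t div int n) * int n) t"

definition gmut :: "'a \<Rightarrow> ('a \<Rightarrow> 'a \<Rightarrow> int) \<Rightarrow> 'a \<Rightarrow> 'a \<Rightarrow> int" where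
  "gmut k B i j = B i j + sgn (B i k) * max (B i k * B k j) 0"

text \<open>The two quivers have different vertex sets, with \<open>d'\<close> in the place of
  \<open>d\<close>. The column of \<open>d'\<close> follows from its row by skew-symmetry.\<close>

definition mutrel :: "nat \<Rightarrow> diag set \<Rightarrow> diag \<Rightarrow> diag set \<Rightarrow> diag \<Rightarrow> bool" where
  "mutrel n \<Delta> d \<Delta>' d' \<longleftrightarrow> d \<in> \<Delta> \<and> d' \<in> \<Delta>' \<and> d \<notin> \<Delta>' \<and> d' \<notin> \<Delta> \<and> \<Delta> - {d} = \<Delta>' - {d'} \<and>
     (\<forall>\<beta>\<in>\<Delta> - {d}. \<forall>\<gamma>\<in>\<Delta> - {d}. quiver_of n \<Delta>' \<beta> \<gamma> = gmut d (quiver_of n \<Delta>) \<beta> \<gamma>) \<and>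
     (\<forall>\<gamma>\<in>\<Delta> - {d}. quiver_of n \<Delta>' d' \<gamma> = - quiver_of n \<Delta> d \<gamma>)"

lemma quiver_skew: "quiver_of n \<Delta> \<beta> \<gamma> = - quiver_of n \<Delta> \<gamma> \<beta>"
  by (simp add: quiver_of_def)

text \<open>Mutation is an involution: the entries at \<open>d\<close> change sign, which keeps
  their products and reverses the sign of the correction term.\<close>

lemma mutrel_sym:
  assumes "mutrel n \<Delta> d \<Delta>' d'"
  shows "mutrel n \<Delta>' d' \<Delta> d"
proof -
  let ?Q = "quiver_of n \<Delta>" and ?Q' = "quiver_of n \<Delta>'"
  have K: "\<Delta> - {d} = \<Delta>' - {d'}" using assms by (simp add: mutrel_def)
  have row: "?Q' d' \<gamma> = - ?Q d \<gamma>" if "\<gamma> \<in> \<Delta> - {d}" for \<gamma> using assms that by (simp add: mutrel_def)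
  have col: "?Q' \<gamma> d' = - ?Q \<gamma> d" if "\<gamma> \<in> \<Delta> - {d}" for \<gamma>
    using row[OF that] quiver_skew[of n \<Delta>' \<gamma> d'] quiver_skew[of n \<Delta> \<gamma> d] by simp
  have "?Q \<beta> \<gamma> = gmut d' ?Q' \<beta> \<gamma>" if "\<beta> \<in> \<Delta> - {d}" "\<gamma> \<in> \<Delta> - {d}" for \<beta> \<gamma>
  proof -
    have "?Q' \<beta> \<gamma> = gmut d ?Q \<beta> \<gamma>" using assms that by (simp add: mutrel_def)
    moreover have "?Q' \<beta> d' = - ?Q \<beta> d" "?Q' d' \<gamma> = - ?Q d \<gamma>" using row col that by auto
    ultimately show ?thesis by (simp add: gmut_def sgn_minus)
  qed
  then show ?thesis using assms row unfolding mutrel_def K[symmetric] by auto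
qed

text \<open>In the application \<open>p\<close> and \<open>q\<close> count the arrows i -> k and k
  -> i, and \<open>p'\<close> and \<open>q'\<close> the arrows j -> k and k -> j. As there are no
  2-cycles, the mutation term counts paths i -> k -> j minus paths j -> k -> i. This bilinear form
  can be compared with sums of \<open>wedge\<close>.\<close>

lemma mutation_identity:
  fixes p q p' q' :: int
  assumes "p \<ge> 0" "q \<ge> 0" "p' \<ge> 0" "q' \<ge> 0" "p = 0 \<or> q = 0" "p' = 0 \<or> q' = 0"
  shows "sgn (p - q) * max ((p - q) * (q' - p')) 0 = p * q' - q * p'"
  using assms(5,6)
proof (elim disjE)
  assume "p = 0" "p' = 0"
  moreover have "- (q * q') \<le> 0" using assms by simp
  ultimately show ?thesis by (simp add: max_def)
next
  assume "p = 0" "q' = 0"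
  moreover have "0 \<le> q * p'" using assms by simp
  ultimately show ?thesis using assms by (cases "q = 0") (simp_all add: max_absorb1 sgn_if)
next
  assume "q = 0" "p' = 0"
  moreover have "0 \<le> p * q'" using assms by simp
  ultimately show ?thesis using assms by (cases "p = 0") (simp_all add: max_absorb1 sgn_if)
next
  assume "q = 0" "q' = 0"
  moreover have "0 \<le> p * p'" using assms by simp
  ultimately show ?thesis by (simp add: max_def)
qed

lemma ind_nonneg [simp]: "ind S x \<ge> 0"
  by (simp add: ind_def)

lemma tsh_0 [simp]: "tsh 0 t = t"
  by (cases t) (simp add: tsh_def option.map_ident)

lemma tsh_tsh [simp]: "tsh c (tsh d t) = tsh (d + c) t"
  by (cases t) (simp add: tsh_def)

lemma fst_tsh [simp]: "fst (tsh c t) = fst t + c"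
  by (cases t) (simp add: tsh_def)

lemma normt_eqD: "normt n s = normt n t \<Longrightarrow> \<exists>j. t = tsh (j * int n) s"
proof -
  assume "normt n s = normt n t"
  then have "tsh ((fst t div int n) * int n) (normt n s) = tsh ((fst t div int n) * int n) (normt n t)" by simp
  then have "t = tsh (- (fst s div int n) * int n + (fst t div int n) * int n) s"
    by (simp add: normt_def)
  then have "t = tsh ((- (fst s div int n) + (fst t div int n)) * int n) s"
    by (simp only: distrib_right)
  then show ?thesis by blast
qed

section \<open>Triangles up to translation\<close>

context triang
begin

definition LT :: "(int \<times> int \<times> int option) set" where
  "LT = {(u, v, w). u < v \<and> vlt v w \<and> side u (Some v) \<and> side u w \<and> side v w}"

lemma LT_shift: "tsh (j * int n) t \<in> LT \<longleftrightarrow> t \<in> LT"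
proof (cases t)
  case (fields u v w)
  have "side (u + j * int n) (Some (v + j * int n)) = side u (Some v)"
    using side_shift[of u j "Some v"] by simp
  then show ?thesis by (simp add: fields tsh_def LT_def side_shift)
qed

lemma tri_form_shift: "tri_form n \<Delta> (tsh (j * int n) t) = tri_form n \<Delta> t"
proof (cases t)
  case (fields u v w)
  have "lab (u + j * int n) (Some (v + j * int n)) = lab u (Some v)"
    using lab_shift[of u j "Some v"] by simp
  then show ?thesis by (intro ext) (simp add: fields tsh_def tri_form_def lab_shift)
qed

lemma touch_shift: "touch n \<Delta> D (tsh (j * int n) t) = touch n \<Delta> D t"
proof (cases t)
  case (fields u v w)
  have "lab (u + j * int n) (Some (v + j * int n)) = lab u (Some v)"
    using lab_shift[of u j "Some v"] by simp
  then show ?thesis by (simp add: fields tsh_def touch_def lab_shift)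
qed

lemma triangles_LT: "triangles n \<Delta> = {t \<in> LT. 0 \<le> fst t \<and> fst t < int n}"
  by (auto simp: triangles_def LT_def)

lemma normt_triangles: "t \<in> LT \<Longrightarrow> normt n t \<in> triangles n \<Delta>"
proof -
  assume t: "t \<in> LT"
  have "fst (normt n t) = fst t mod int n"
    by (simp add: normt_def minus_mult_div_eq_mod[symmetric] algebra_simps)
  then show ?thesis using n3 t LT_shift[of "- (fst t div int n)" t] by (simp add: triangles_LT normt_def)
qed

lemma normt_id: "t \<in> triangles n \<Delta> \<Longrightarrow> normt n t = t"
  by (simp add: triangles_LT normt_def)

lemma normt_tsh: "normt n (tsh (j * int n) t) = normt n t"
proof -
  have "(fst t + j * int n) div int n = fst t div int n + j" using n3 by simp
  then show ?thesis by (simp add: normt_def algebra_simps)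
qed

lemma finite_triangles: "finite (triangles n \<Delta>)"
proof -
  have "triangles n \<Delta> \<subseteq> {0..<int n} \<times> {0..2 * int n} \<times> insert None (Some ` {0..3 * int n})"
  proof
    fix t assume t: "t \<in> triangles n \<Delta>"
    obtain u v w where [simp]: "t = (u,v,w)" by (cases t)
    have *: "0 \<le> u" "u < int n" "u < v" "side u (Some v)" "side v w" "vlt v w"
      using t by (auto simp: triangles_def)
    have "v \<le> u + int n" using side_bound *(4) by blast
    moreover have "w' \<le> v + int n" if "w = Some w'" for w' using side_bound *(5) that by blast
    ultimately show "t \<in> {0..<int n} \<times> {0..2 * int n} \<times> insert None (Some ` {0..3 * int n})"
      using * by (cases w) auto
  qed
  then show ?thesis by (rule finite_subset) auto
qed

lemma quiver_sum: "quiver_of n \<Delta> \<beta> \<gamma> = (\<Sum>t\<in>triangles n \<Delta>. tri_form n \<Delta> t \<beta> \<gamma>)"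
proof -
  have c: "int (card {(u,v,w) \<in> triangles n \<Delta>. x \<in> f u v w \<and> y \<in> g u v w})
     = (\<Sum>t\<in>triangles n \<Delta>. case t of (u,v,w) \<Rightarrow> ind (f u v w) x * ind (g u v w) y)" 
     for x y :: diag and f g :: "int \<Rightarrow> int \<Rightarrow> int option \<Rightarrow> diag set"
  proof -
    have "(\<Sum>t\<in>triangles n \<Delta>. case t of (u,v,w) \<Rightarrow> ind (f u v w) x * ind (g u v w) y)
      = (\<Sum>t\<in>triangles n \<Delta>. if (case t of (u,v,w) \<Rightarrow> x \<in> f u v w \<and> y \<in> g u v w) then 1 else 0)"
      by (rule sum.cong) (auto simp: ind_def split: if_splits)
    also have "\<dots> = (\<Sum>t\<in>{t \<in> triangles n \<Delta>. (case t of (u,v,w) \<Rightarrow> x \<in> f u v w \<and> y \<in> g u v w)}. 1)"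
      by (subst sum.inter_filter) (simp_all add: finite_triangles)
    also have "\<dots> = int (card {(u,v,w) \<in> triangles n \<Delta>. x \<in> f u v w \<and> y \<in> g u v w})"
    proof -
      have "{t \<in> triangles n \<Delta>. (case t of (u,v,w) \<Rightarrow> x \<in> f u v w \<and> y \<in> g u v w)}
        = {(u,v,w) \<in> triangles n \<Delta>. x \<in> f u v w \<and> y \<in> g u v w}" by auto
      then show ?thesis by simp
    qed
    finally show ?thesis by simp
  qed
  show ?thesis
    unfolding quiver_of_def arrow_count_def of_nat_add c sum.distrib[symmetric] sum_subtractf[symmetric]
    by (rule sum.cong) (auto simp: tri_form_def wedge_def)
qed

text \<open>\<open>triangles\<close> fixes one representative of each orbit, rarely the one in view.
  Here \<open>X\<close> may consist of arbitrary representatives, because \<open>F\<close> does not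
  depend on the choice.\<close>

lemma sum_touch:
  fixes F :: "int \<times> int \<times> int option \<Rightarrow> int"
  assumes F: "\<And>j t. F (tsh (j * int n) t) = F t"
    and X: "X \<subseteq> LT" "\<And>t. t \<in> X \<Longrightarrow> touch n \<Delta> D t" "inj_on (normt n) X" 
    and c: "\<And>t. t \<in> LT \<Longrightarrow> touch n \<Delta> D t \<Longrightarrow> \<exists>x\<in>X. \<exists>j. t = tsh (j * int n) x"
  shows "sum F (triangles n \<Delta>) = sum F {t \<in> triangles n \<Delta>. \<not> touch n \<Delta> D t} + sum F X"
proof -
  have FN: "F (normt n t) = F t" for t unfolding normt_def by (rule F)
  have "{t \<in> triangles n \<Delta>. touch n \<Delta> D t} = normt n ` X"
  proof (intro equalityI subsetI)
    fix t assume t: "t \<in> {t \<in> triangles n \<Delta>. touch n \<Delta> D t}"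
    then obtain x j where x: "x \<in> X" "t = tsh (j * int n) x" using c triangles_LT by blast
    have "t = normt n t" using t normt_id by simp
    also have "\<dots> = normt n x" using x normt_tsh by simp
    finally show "t \<in> normt n ` X" using x by blast
  next
    fix t assume "t \<in> normt n ` X"
    then obtain x where x: "x \<in> X" "t = normt n x" by blast
    then have "t \<in> triangles n \<Delta>" using normt_triangles X(1) by blast
    moreover have "touch n \<Delta> D t" using X(2)[OF x(1)] touch_shift[of D "- (fst x div int n)" x] unfolding x(2) normt_def by blast
    ultimately show "t \<in> {t \<in> triangles n \<Delta>. touch n \<Delta> D t}" by blast
  qed
  then have "sum F {t \<in> triangles n \<Delta>. touch n \<Delta> D t} = sum F X"
    using sum.reindex[OF X(3), of F] by (simp add: FN)
  moreover have "sum F (triangles n \<Delta>) = sum F {t \<in> triangles n \<Delta>. \<not> touch n \<Delta> D t} + sum F {t \<in> triangles n \<Delta>. touch n \<Delta> D t}"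
    using finite_triangles by (subst sum.union_disjoint[symmetric]) (auto intro: arg_cong[of _ _ "sum F"])
  ultimately show ?thesis by simp
qed

lemma untouched_zero:
  assumes "d \<in> D"
  shows "(\<Sum>t\<in>{t \<in> triangles n \<Delta>. \<not> touch n \<Delta> D t}. tri_form n \<Delta> t d \<gamma>) = 0"
    "(\<Sum>t\<in>{t \<in> triangles n \<Delta>. \<not> touch n \<Delta> D t}. tri_form n \<Delta> t \<gamma> d) = 0"
proof -
  have "tri_form n \<Delta> t d \<gamma> = 0 \<and> tri_form n \<Delta> t \<gamma> d = 0" if "\<not> touch n \<Delta> D t" for t
  proof (cases t)
    case (fields u v w)
    then have "ind (lab u (Some v)) d = 0" "ind (lab u w) d = 0" "ind (lab v w) d = 0"
      using that assms by (auto simp: touch_def ind_def)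
    then show ?thesis by (simp add: fields tri_form_def wedge_def)
  qed
  then show "(\<Sum>t\<in>{t \<in> triangles n \<Delta>. \<not> touch n \<Delta> D t}. tri_form n \<Delta> t d \<gamma>) = 0"
    "(\<Sum>t\<in>{t \<in> triangles n \<Delta>. \<not> touch n \<Delta> D t}. tri_form n \<Delta> t \<gamma> d) = 0"
    by (auto intro: sum.neutral)
qed

section \<open>The triangles at a given diagonal\<close>

lemma below_unique:
  assumes "(p, v, q) \<in> LT" "(p, v', q) \<in> LT"
  shows "v = v'"
proof (rule ccontr)
  assume "v \<noteq> v'"
  moreover have "\<not> crs p (Some v') v q" "\<not> crs p (Some v) v' q" using side_nc assms by (auto simp: LT_def)
  ultimately show False using assms by (auto simp: crs_def LT_def)
qed

lemma above_right_unique: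
  assumes "(p, q, w) \<in> LT" "(p, q, w') \<in> LT"
  shows "w = w'"
proof (rule ccontr)
  assume "w \<noteq> w'"
  moreover have "\<not> crs q w' p w" "\<not> crs q w p w'" using side_nc assms by (auto simp: LT_def)
  ultimately show False using assms by (cases w; cases w') (auto simp: crs_def LT_def)
qed

lemma above_left_unique:
  assumes "(t, p, q) \<in> LT" "(t', p, q) \<in> LT"
  shows "t = t'"
proof (rule ccontr)
  assume "t \<noteq> t'"
  moreover have "\<not> crs t (Some p) t' q" "\<not> crs t' (Some p) t q" using side_nc assms by (auto simp: LT_def)
  ultimately show False using assms by (auto simp: crs_def LT_def)
qed

lemma above_left_right:
  assumes "(p, q, w) \<in> LT" "(t, p, Some q) \<in> LT"
  shows False
proof -
  have "\<not> crs p w t (Some q)" using side_nc assms by (auto simp: LT_def)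
  then show False using assms by (cases w) (auto simp: crs_def LT_def)
qed

text \<open>The third corner lies below the arc, beyond its right end, or beyond its left end. With
  the preceding uniqueness lemmas this lists the triangles at a diagonal up to translation.\<close>

lemma touch_arc:
  assumes t: "t \<in> LT" "d \<in> lab p q" "touch n \<Delta> {d} t"
  shows "\<exists>j. (\<exists>v. t = tsh (j * int n) (p, v, q) \<and> (p, v, q) \<in> LT) \<or>
    (\<exists>w q'. q = Some q' \<and> t = tsh (j * int n) (p, q', w) \<and> (p, q', w) \<in> LT) \<or>
    (\<exists>u. t = tsh (j * int n) (u, p, q) \<and> (u, p, q) \<in> LT)"
proof -
  obtain u v w where tf: "t = (u,v,w)" by (cases t)
  have "\<exists>p' q'. d \<in> lab p' q' \<and> (p' = u \<and> q' = Some v \<or> p' = u \<and> q' = w \<or> p' = v \<and> q' = w)"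
    using t(3) by (auto simp: touch_def tf)
  then obtain p' q' where *: "d \<in> lab p' q'" "p' = u \<and> q' = Some v \<or> p' = u \<and> q' = w \<or> p' = v \<and> q' = w"
    by blast
  obtain j where j: "p' = p + j * int n" "q' = osh (j * int n) q" using lab_common t(2) *(1) by blast
  define s where "s = tsh (- j * int n) t"
  have ts: "t = tsh (j * int n) s" by (simp add: s_def)
  have sL: "s \<in> LT" unfolding s_def using t(1) LT_shift[of "-j" t] by simp
  have sf: "s = (u - j * int n, v - j * int n, osh (- j * int n) w)" by (simp add: s_def tsh_def tf)
  have qq: "osh (- j * int n) q' = q" unfolding j(2) osh_comp by (simp add: option.map_ident)
  from *(2) show ?thesis
  proof (elim disjE conjE)
    assume "p' = u" "q' = Some v"
    then have "s = (p, v - j * int n, osh (- j * int n) w)" "q = Some (v - j * int n)" using sf j qq by auto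
    then show ?thesis using ts sL by (intro exI[of _ j]) auto
  next
    assume "p' = u" "q' = w"
    then have "s = (p, v - j * int n, q)" using sf j qq by auto
    then show ?thesis using ts sL by (intro exI[of _ j]) auto
  next
    assume "p' = v" "q' = w"
    then have "s = (u - j * int n, p, q)" using sf j qq by auto
    then show ?thesis using ts sL by (intro exI[of _ j]) auto
  qed
qed

lemma sum_xz:
  assumes Q: "quad x y z w" and l: "lab x (Some z) = {d}"
    and F: "\<And>j t. F (tsh (j * int n) t) = (F t :: int)"
  shows "sum F (triangles n \<Delta>) = sum F {t \<in> triangles n \<Delta>. \<not> touch n \<Delta> {d} t} + (F (x, y, Some z) + F (x, z, w))"
proof -
  note q = Q[unfolded quad_def]
  have s: "side x (Some z)" using l by (auto simp: side_present_def)
  have T: "(x, y, Some z) \<in> LT" "(x, z, w) \<in> LT" using q s by (cases w; auto simp: LT_def)+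
  have "inj_on (normt n) {(x, y, Some z), (x, z, w)}"
    using q n3 by (auto simp: inj_on_def tsh_def dest!: normt_eqD)
  then have "sum F (triangles n \<Delta>) = sum F {t \<in> triangles n \<Delta>. \<not> touch n \<Delta> {d} t} + sum F {(x, y, Some z), (x, z, w)}"
  proof (rule sum_touch[OF F, rotated 2])
    show "{(x, y, Some z), (x, z, w)} \<subseteq> LT" using T by simp
    show "touch n \<Delta> {d} t" if "t \<in> {(x, y, Some z), (x, z, w)}" for t
      using that l by (auto simp: touch_def)
    fix t assume t: "t \<in> LT" "touch n \<Delta> {d} t"
    have d: "d \<in> lab x (Some z)" using l by simp
    show "\<exists>x\<in>{(x, y, Some z), (x, z, w)}. \<exists>j. t = tsh (j * int n) x"
      using touch_arc[OF t(1) d t(2)] below_unique[OF T(1)] above_right_unique[OF T(2)] above_left_right[OF T(2)]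
      by blast
  qed
  then show ?thesis using q by simp
qed

lemma sum_yw:
  assumes Q: "quad x y z w" and l: "lab y w = {d}"
    and F: "\<And>j t. F (tsh (j * int n) t) = (F t :: int)"
  shows "sum F (triangles n \<Delta>) = sum F {t \<in> triangles n \<Delta>. \<not> touch n \<Delta> {d} t} + (F (y, z, w) + F (x, y, w))"
proof -
  note q = Q[unfolded quad_def]
  have s: "side y w" using l by (auto simp: side_present_def)
  have T: "(y, z, w) \<in> LT" "(x, y, w) \<in> LT" using q s by (cases w; auto simp: LT_def)+
  have xyz: "x < y" "y < z" "z < x + int n" using q quad_width(1)[OF Q] by auto
  have nn: False if "y = x + j * int n" for j
    using multiple_cases[of j n] that xyz by linarith
  have nn': False if "x = y + j * int n" for j
    using multiple_cases[of j n] that xyz by linarith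
  have "inj_on (normt n) {(y, z, w), (x, y, w)}"
    using q n3 nn nn' by (auto simp: inj_on_def tsh_def dest!: normt_eqD)
  then have "sum F (triangles n \<Delta>) = sum F {t \<in> triangles n \<Delta>. \<not> touch n \<Delta> {d} t} + sum F {(y, z, w), (x, y, w)}"
  proof (rule sum_touch[OF F, rotated 2])
    show "{(y, z, w), (x, y, w)} \<subseteq> LT" using T by simp
    show "touch n \<Delta> {d} t" if "t \<in> {(y, z, w), (x, y, w)}" for t
      using that l by (auto simp: touch_def)
    fix t assume t: "t \<in> LT" "touch n \<Delta> {d} t"
    have d: "d \<in> lab y w" using l by simp
    show "\<exists>x\<in>{(y, z, w), (x, y, w)}. \<exists>j. t = tsh (j * int n) x"
      using touch_arc[OF t(1) d t(2)] below_unique[OF T(1)] above_left_unique[OF T(2)] above_left_right T(2)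
      by blast
  qed
  then show ?thesis using q by simp
qed

lemma row_xz:
  assumes Q: "quad x y z w" and l: "lab x (Some z) = {d}" and g: "\<gamma> \<noteq> d"
  shows "quiver_of n \<Delta> d \<gamma> = ind (lab y (Some z)) \<gamma> + ind (lab x w) \<gamma> - ind (lab x (Some y)) \<gamma> - ind (lab z w) \<gamma>"
proof -
  have "quiver_of n \<Delta> d \<gamma> = tri_form n \<Delta> (x, y, Some z) d \<gamma> + tri_form n \<Delta> (x, z, w) d \<gamma>"
    unfolding quiver_sum by (subst sum_xz[OF Q l]) (simp_all add: tri_form_shift untouched_zero)
  then show ?thesis using quad_disjoint(5)[OF Q] g
    by (auto simp: tri_form_def wedge_def l ind_def)
qed

lemma row_yw:
  assumes Q: "quad x y z w" and l: "lab y w = {d}" and g: "\<gamma> \<noteq> d"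
  shows "quiver_of n \<Delta> d \<gamma> = ind (lab x (Some y)) \<gamma> + ind (lab z w) \<gamma> - ind (lab y (Some z)) \<gamma> - ind (lab x w) \<gamma>"
proof -
  have "quiver_of n \<Delta> d \<gamma> = tri_form n \<Delta> (y, z, w) d \<gamma> + tri_form n \<Delta> (x, y, w) d \<gamma>"
    unfolding quiver_sum by (subst sum_yw[OF Q l]) (simp_all add: tri_form_shift untouched_zero)
  then show ?thesis using quad_disjoint(6)[OF Q] g
    by (auto simp: tri_form_def wedge_def l ind_def)
qed

end

section \<open>Comparison of two triangulations related by a flip\<close>

lemma untouched_transfer:
  assumes ag: "\<And>u v. labels n \<Delta> u v - D = labels n \<Delta>' u v - D'"
    and x: "\<And>u v. labels n \<Delta>' u v \<inter> D' \<noteq> {} \<Longrightarrow> \<not> side_present n \<Delta> u v"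
  shows side_transfer: "side_present n \<Delta> p q \<Longrightarrow> labels n \<Delta> p q \<inter> D = {} \<Longrightarrow>
      labels n \<Delta>' p q = labels n \<Delta> p q \<and> labels n \<Delta>' p q \<inter> D' = {} \<and> side_present n \<Delta>' p q"
    and "t \<in> triangles n \<Delta> \<Longrightarrow> \<not> touch n \<Delta> D t \<Longrightarrow>
      t \<in> triangles n \<Delta>' \<and> \<not> touch n \<Delta>' D' t \<and> tri_form n \<Delta>' t = tri_form n \<Delta> t"
proof -
  show *: "labels n \<Delta>' p q = labels n \<Delta> p q \<and> labels n \<Delta>' p q \<inter> D' = {} \<and> side_present n \<Delta>' p q"
    if "side_present n \<Delta> p q" "labels n \<Delta> p q \<inter> D = {}" for p q
  proof -
    have 1: "labels n \<Delta>' p q \<inter> D' = {}" using x that by blast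
    then have "labels n \<Delta>' p q = labels n \<Delta> p q" using ag[of p q] that(2) by blast
    then show ?thesis using 1 that by (simp add: side_present_def)
  qed
  assume t: "t \<in> triangles n \<Delta>" "\<not> touch n \<Delta> D t"
  obtain u v w where f: "t = (u,v,w)" by (cases t)
  have s: "side_present n \<Delta> u (Some v)" "side_present n \<Delta> u w" "side_present n \<Delta> v w"
    and l: "labels n \<Delta> u (Some v) \<inter> D = {}" "labels n \<Delta> u w \<inter> D = {}" "labels n \<Delta> v w \<inter> D = {}"
    using t by (auto simp: triangles_def touch_def f)
  show "t \<in> triangles n \<Delta>' \<and> \<not> touch n \<Delta>' D' t \<and> tri_form n \<Delta>' t = tri_form n \<Delta> t"
    using t(1) *[OF s(1) l(1)] *[OF s(2) l(2)] *[OF s(3) l(3)]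
    by (intro conjI ext) (auto simp: triangles_def touch_def f tri_form_def)
qed

text \<open>The affected diagonals form sets \<open>D\<close> and \<open>D'\<close>, because the
  flip of a pair also affects the puncture diagonal that stays: it is drawn as a loop before the
  flip and as a ray after it.\<close>

lemma untouched_sum_eq:
  assumes ag: "\<And>u v. labels n \<Delta> u v - D = labels n \<Delta>' u v - D'"
    and x: "\<And>u v. labels n \<Delta>' u v \<inter> D' \<noteq> {} \<Longrightarrow> \<not> side_present n \<Delta> u v"
    and x': "\<And>u v. labels n \<Delta> u v \<inter> D \<noteq> {} \<Longrightarrow> \<not> side_present n \<Delta>' u v"
  shows "(\<Sum>t\<in>{t \<in> triangles n \<Delta>'. \<not> touch n \<Delta>' D' t}. tri_form n \<Delta>' t \<beta> \<gamma>) =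
     (\<Sum>t\<in>{t \<in> triangles n \<Delta>. \<not> touch n \<Delta> D t}. tri_form n \<Delta> t \<beta> \<gamma>)"
proof (rule sum.cong)
  show "{t \<in> triangles n \<Delta>'. \<not> touch n \<Delta>' D' t} = {t \<in> triangles n \<Delta>. \<not> touch n \<Delta> D t}"
    using untouched_transfer(2)[of n \<Delta> D \<Delta>' D', OF ag x] untouched_transfer(2)[of n \<Delta>' D' \<Delta> D, OF ag[symmetric] x']
    by blast
  show "tri_form n \<Delta>' t \<beta> \<gamma> = tri_form n \<Delta> t \<beta> \<gamma>" if "t \<in> {t \<in> triangles n \<Delta>. \<not> touch n \<Delta> D t}" for t
    using untouched_transfer(2)[of n \<Delta> D \<Delta>' D' t, OF ag x] that by auto
qed

lemma touch_single: "touch n \<Delta> D t \<Longrightarrow> \<exists>d\<in>D. touch n \<Delta> {d} t"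
  by (cases t) (auto simp: touch_def)

lemma ind_eq_0: "z \<in> T \<Longrightarrow> S \<inter> T = {} \<or> T \<inter> S = {} \<Longrightarrow> ind S z = 0"
  by (auto simp: ind_def)

lemma ind_eq_1: "z \<in> S \<Longrightarrow> ind S z = 1"
  by (simp add: ind_def)

lemma ind_single: "ind {d} x = (if x = d then 1 else 0)"
  by (simp add: ind_def)

lemma ind_disjoint: "S \<inter> T = {} \<Longrightarrow> ind S x = 0 \<or> ind T x = 0"
  by (auto simp: ind_def)

text \<open>Let A, B, C, D be the label sets of the sides xy, yz, zw, xw. Away from the exchanged
  diagonal, the two triangles contribute \<open>wedge B A + wedge D C\<close> before the flip and
  \<open>wedge C B + wedge A D\<close> after it. The difference is the wedge of A + C with B + D.
  Arrows enter \<open>d\<close> from A and C and leave it to B and D, so this is exactly the count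
  of paths through \<open>d\<close>.\<close>

lemma quad_mutation:
  assumes T: "triang n \<Delta>" and T': "triang n \<Delta>'" and Q: "triang.quad n \<Delta> x y z w"
    and l: "labels n \<Delta> x (Some z) = {d}" and l': "labels n \<Delta>' y w = {d'}"
    and K: "\<Delta> - {d} = \<Delta>' - {d'}" and nin: "d \<notin> \<Delta>'" "d' \<notin> \<Delta>" and din: "d \<in> \<Delta>" "d' \<in> \<Delta>'"
    and hp: "\<And>a. has_pair n \<Delta> a = has_pair n \<Delta>' a"
  shows "mutrel n \<Delta> d \<Delta>' d'"
proof -
  interpret A: triang n \<Delta> by fact
  interpret B: triang n \<Delta>' by fact
  note q = Q[unfolded A.quad_def]
  have ag: "labels n \<Delta> u v - {d} = labels n \<Delta>' u v - {d'}" for u v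
  proof (rule set_eqI)
    fix c
    have "c \<in> \<Delta> - {d} \<longleftrightarrow> c \<in> \<Delta>' - {d'}" using K by simp
    then show "c \<in> labels n \<Delta> u v - {d} \<longleftrightarrow> c \<in> labels n \<Delta>' u v - {d'}"
      unfolding Diff_iff A.lab_iff B.lab_iff hp by blast
  qed
  have sxz: "A.side x (Some z)" using l by (simp add: side_present_def)
  have syw: "B.side y w" using l' by (simp add: side_present_def)
  have cr: "crs y w x (Some z)" using q by (cases w) (auto simp: crs_def)
  have nyw: "\<not> A.side y w" using cr A.side_nc sxz by blast
  have X: "\<not> A.side u v" if "labels n \<Delta>' u v \<inter> {d'} \<noteq> {}" for u v
  proof -
    have "d' \<in> labels n \<Delta>' y w" "d' \<in> labels n \<Delta>' u v" using that l' by auto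
    then obtain j where "u = y + j * int n" "v = osh (j * int n) w"
      using B.lab_common by blast
    then show ?thesis using nyw A.side_shift by simp
  qed
  have dj: "labels n \<Delta> x (Some y) \<inter> {d} = {}" "labels n \<Delta> y (Some z) \<inter> {d} = {}" 
    "labels n \<Delta> z w \<inter> {d} = {}" "labels n \<Delta> x w \<inter> {d} = {}"
    using A.quad_disjoint(5)[OF Q] l by auto
  have tr: "labels n \<Delta>' p r = labels n \<Delta> p r \<and> labels n \<Delta>' p r \<inter> {d'} = {} \<and> side_present n \<Delta>' p r"
    if "A.side p r" "labels n \<Delta> p r \<inter> {d} = {}" for p r
    using side_transfer[of n \<Delta> "{d}" \<Delta>' "{d'}" p r, OF ag X] that by blast
  note t4 = tr[OF _ dj(1)] tr[OF _ dj(2)] tr[OF _ dj(3)] tr[OF _ dj(4)]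
  have Q': "B.quad x y z w" using q t4 unfolding B.quad_def by blast
  have nxz: "\<not> B.side x (Some z)" using cr B.side_nc syw by blast
  have X': "\<not> B.side u v" if "labels n \<Delta> u v \<inter> {d} \<noteq> {}" for u v
  proof -
    have "d \<in> labels n \<Delta> x (Some z)" "d \<in> labels n \<Delta> u v" using that l by auto
    then obtain j where "u = x + j * int n" "v = osh (j * int n) (Some z)"
      using A.lab_common by blast
    then show ?thesis using nxz B.side_shift[of x j "Some z"] by simp
  qed
  let ?A = "labels n \<Delta> x (Some y)" and ?B = "labels n \<Delta> y (Some z)" and ?C = "labels n \<Delta> z w" and ?D = "labels n \<Delta> x w"
  have lab': "labels n \<Delta>' x (Some y) = ?A" "labels n \<Delta>' y (Some z) = ?B" "labels n \<Delta>' z w = ?C" "labels n \<Delta>' x w = ?D"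
    using t4 q by blast+
  define R where "R \<beta> \<gamma> = (\<Sum>t\<in>{t \<in> triangles n \<Delta>. \<not> touch n \<Delta> {d} t}. tri_form n \<Delta> t \<beta> \<gamma>)" for \<beta> \<gamma>
  have R': "(\<Sum>t\<in>{t \<in> triangles n \<Delta>'. \<not> touch n \<Delta>' {d'} t}. tri_form n \<Delta>' t \<beta> \<gamma>) = R \<beta> \<gamma>" for \<beta> \<gamma>
    unfolding R_def by (rule untouched_sum_eq[OF ag X X'])
  have q1: "quiver_of n \<Delta> \<beta> \<gamma> = R \<beta> \<gamma> + (tri_form n \<Delta> (x, y, Some z) \<beta> \<gamma> + tri_form n \<Delta> (x, z, w) \<beta> \<gamma>)" for \<beta> \<gamma>
    unfolding A.quiver_sum R_def by (rule A.sum_xz[OF Q l]) (simp add: A.tri_form_shift)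
  have q2: "quiver_of n \<Delta>' \<beta> \<gamma> = R \<beta> \<gamma> + (tri_form n \<Delta>' (y, z, w) \<beta> \<gamma> + tri_form n \<Delta>' (x, y, w) \<beta> \<gamma>)" for \<beta> \<gamma>
    unfolding B.quiver_sum R'[symmetric] by (rule B.sum_yw[OF Q' l']) (simp add: B.tri_form_shift)
  have row: "quiver_of n \<Delta> d \<gamma> = (ind ?B \<gamma> + ind ?D \<gamma>) - (ind ?A \<gamma> + ind ?C \<gamma>)" if "\<gamma> \<noteq> d" for \<gamma>
    using A.row_xz[OF Q l that] by simp
  have row': "quiver_of n \<Delta>' d' \<gamma> = (ind ?A \<gamma> + ind ?C \<gamma>) - (ind ?B \<gamma> + ind ?D \<gamma>)" if "\<gamma> \<noteq> d'" for \<gamma>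
    using B.row_yw[OF Q' l' that] lab' by simp
  have z: "ind ?A \<gamma> + ind ?C \<gamma> = 0 \<or> ind ?B \<gamma> + ind ?D \<gamma> = 0" for \<gamma>
    using A.quad_disjoint(1-4)[OF Q, THEN ind_disjoint, of \<gamma>] by (auto simp: ind_def split: if_splits)
  have "quiver_of n \<Delta>' \<beta> \<gamma> = gmut d (quiver_of n \<Delta>) \<beta> \<gamma>" if "\<beta> \<in> \<Delta> - {d}" "\<gamma> \<in> \<Delta> - {d}" for \<beta> \<gamma>
  proof -
    have ne: "\<beta> \<noteq> d" "\<gamma> \<noteq> d" "\<beta> \<noteq> d'" "\<gamma> \<noteq> d'" using that nin by auto
    let ?p = "ind ?A \<beta> + ind ?C \<beta>" and ?q = "ind ?B \<beta> + ind ?D \<beta>" 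
      and ?p' = "ind ?A \<gamma> + ind ?C \<gamma>" and ?q' = "ind ?B \<gamma> + ind ?D \<gamma>"
    have "quiver_of n \<Delta> \<beta> d = ?p - ?q" using quiver_skew[of n \<Delta> \<beta> d] row[OF ne(1)] by simp
    then have "gmut d (quiver_of n \<Delta>) \<beta> \<gamma> = quiver_of n \<Delta> \<beta> \<gamma> + (?p * ?q' - ?q * ?p')"
      using row[OF ne(2)] mutation_identity[of ?p ?q ?p' ?q'] z by (simp add: gmut_def)
    then show ?thesis
      unfolding q1 q2 tri_form_def wedge_def l l' lab' prod.case ind_single using ne
      by (simp add: algebra_simps)
  qed
  moreover have "quiver_of n \<Delta>' d' \<gamma> = - quiver_of n \<Delta> d \<gamma>" if "\<gamma> \<in> \<Delta> - {d}" for \<gamma>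
    using row[of \<gamma>] row'[of \<gamma>] that nin by auto
  ultimately show ?thesis using nin din K unfolding mutrel_def by blast
qed

text \<open>Let L and R be the label sets of the sides from \<open>a\<close> to \<open>v\<close> and
  from \<open>v\<close> to \<open>a + n\<close>. Both members of the pair label the loop, so its
  single triangle gives arrows from L to each member, from each member to R, and from R to L. After
  the flip, the two triangles at the puncture give opposite arrows between the remaining member and
  the new ray, which cancel, and no arrows between R and L. The change \<open>wedge L R\<close> is
  the count of paths through the removed member.\<close>

lemma pair_mutation:
  assumes T: "triang n \<Delta>" and T': "triang n \<Delta>'" and e: "e = 1 \<or> e = -1"
    and p: "(a, n, e) \<in> \<Delta>" "(a, n, -e) \<in> \<Delta>" and q: "dg n e v None \<in> \<Delta>'" 
    and K: "\<Delta> - {(a, n, -e)} = \<Delta>' - {dg n e v None}" and nin: "(a, n, -e) \<notin> \<Delta>'" "dg n e v None \<notin> \<Delta>"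
    and v: "int a < v" "v < int a + int n" "side_present n \<Delta> (int a) (Some v)" "side_present n \<Delta> v (Some (int a + int n))"
  shows "mutrel n \<Delta> (a, n, -e) \<Delta>' (dg n e v None)"
proof -
  interpret A: triang n \<Delta> by fact
  interpret B: triang n \<Delta>' by fact
  let ?a = "int a" and ?p = "(a, n, e)" and ?p' = "(a, n, -e)" and ?q = "dg n e v None"
  let ?D = "{?p, ?p'}" and ?D' = "{?p, ?q}"
  have pa: "A.paired a" using p e by (auto simp: has_pair_def)
  have "?p \<in> \<Delta> - {?p'}" using p e by auto
  then have p1: "?p \<in> \<Delta>'" unfolding K by blast
  have ry: "is_ray n c \<Longrightarrow> c \<in> \<Delta> \<Longrightarrow> c \<in> ?D" for c
  proof -
    assume c: "is_ray n c" "c \<in> \<Delta>"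
    then have "c = (a, n, tag c)" "tag c = e \<or> tag c = -e"
      using A.pair_rays[OF pa c(2,1)] A.ray_form[OF c(2,1)] e by auto
    then show "c \<in> ?D" by (metis insertCI)
  qed
  have K2: "\<Delta> - ?D = \<Delta>' - ?D'" using K by blast
  have ry': "is_ray n c \<Longrightarrow> c \<in> \<Delta>' \<Longrightarrow> c \<in> ?D'" for c using ry K2 by blast
  have qf: "?q = (fst ?q, n, e)" "is_ray n ?q" by (simp_all add: dg_def)
  have la: "is_lift n (a,n,f) (?a + j * int n) None" for f j using A.pair_lift[OF pa] .
  have la0: "is_lift n (a,n,f) ?a None" for f using la[of f 0] by simp
  have lq: "is_lift n ?q v None" using A.n3 by (intro dg_lift) auto
  have "a \<noteq> fst ?q" using lift_vertex_neq[OF la0 lq] v by auto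
  have tg: "c \<in> ?D' \<Longrightarrow> tag c = e" for c using qf by auto
  have np: "\<not> B.paired b" for b
  proof
    assume "B.paired b"
    then have *: "(b,n,1) \<in> \<Delta>'" "(b,n,-1) \<in> \<Delta>'" by (auto simp: has_pair_def)
    have "(b,n,1) \<in> ?D'" by (rule ry'[OF _ *(1)]) simp
    moreover have "(b,n,-1) \<in> ?D'" by (rule ry'[OF _ *(2)]) simp
    ultimately show False using tg[of "(b,n,1)"] tg[of "(b,n,-1)"] unfolding snd_conv by linarith
  qed
  have ag: "labels n \<Delta> r s - ?D = labels n \<Delta>' r s - ?D'" for r s
  proof -
    have 1: "labels n \<Delta> r s - ?D = {c \<in> \<Delta> - ?D. is_lift n c r s}"
      using ry by (auto simp only: A.lab_iff set_eq_iff Diff_iff mem_Collect_eq split: if_splits)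
    have 2: "labels n \<Delta>' r s - ?D' = {c \<in> \<Delta>' - ?D'. is_lift n c r s}"
      using np by (auto simp only: B.lab_iff set_eq_iff Diff_iff mem_Collect_eq split: if_splits)
    show ?thesis unfolding 1 2 K2 by simp
  qed
  have X: "\<not> A.side r s" if "labels n \<Delta>' r s \<inter> ?D' \<noteq> {}" for r s
  proof -
    from that have "\<exists>c. c \<in> labels n \<Delta>' r s \<inter> ?D'" unfolding ex_in_conv .
    then obtain c where "c \<in> labels n \<Delta>' r s \<inter> ?D'" ..
    then have c: "c \<in> ?D'" "c \<in> labels n \<Delta>' r s" by simp_all
    have "is_ray n (a, n, e)" by simp
    then have "is_ray n c" using c(1) qf(2) by blast
    moreover have "is_lift n c r s" using c(2) np unfolding B.lab_iff by presburger
    ultimately have "s = None" using A.ray_lift by blast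
    then show ?thesis using A.pair_no_ray[OF pa] by blast
  qed
  have X': "\<not> B.side r s" if "labels n \<Delta> r s \<inter> ?D \<noteq> {}" for r s
  proof -
    have "s = Some (r + int n)" using that pa by (auto simp: A.lab_iff)
    then show ?thesis using B.side_long np by blast
  qed
  have chord: "labels n \<Delta> r (Some s) \<inter> ?D = {}" if "s < r + int n" for r s
    using that pa by (auto simp: A.lab_iff)
  have tr: "labels n \<Delta>' r s = labels n \<Delta> r s \<and> labels n \<Delta>' r s \<inter> ?D' = {} \<and> side_present n \<Delta>' r s"
    if "A.side r s" "labels n \<Delta> r s \<inter> ?D = {}" for r s
    using side_transfer[of n \<Delta> ?D \<Delta>' ?D' r s, OF ag X] that by blast
  let ?L = "labels n \<Delta> ?a (Some v)" and ?R = "labels n \<Delta> v (Some (?a + int n))"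
  have L: "labels n \<Delta>' ?a (Some v) = ?L" "?L \<inter> ?D = {}" "?L \<inter> ?D' = {}" "B.side ?a (Some v)"
    and R: "labels n \<Delta>' v (Some (?a + int n)) = ?R" "?R \<inter> ?D = {}" "?R \<inter> ?D' = {}" "B.side v (Some (?a + int n))"
    using tr[OF v(3) chord] tr[OF v(4) chord] v chord[of v ?a] chord[of "?a + int n" v] by auto
  have loop: "labels n \<Delta> ?a (Some (?a + int n)) = ?D"
  proof -
    have "\<exists>j. ?a = ?a + j * int n" by (intro exI[of _ 0]) simp
    then have "?D \<subseteq> labels n \<Delta> ?a (Some (?a + int n))" using p pa by (auto simp: A.lab_iff)
    moreover have "c \<in> ?D" if "c \<in> labels n \<Delta> ?a (Some (?a + int n))" for c
    proof (rule ccontr)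
      assume *: "c \<notin> ?D"
      then have "is_lift n c ?a (Some (?a + int n))" "c \<in> \<Delta>" using that ry by (auto simp only: A.lab_iff split: if_splits)
      then show False using is_lift_bounds[of n c ?a "?a + int n"] A.in_diags by auto
    qed
    ultimately show ?thesis by blast
  qed
  have rays: "labels n \<Delta>' ?a None = {?p}" "labels n \<Delta>' (?a + int n) None = {?p}" "labels n \<Delta>' v None = {?q}"
  proof -
    have "?p \<in> labels n \<Delta>' ?a None" using p1 np la0 by (auto simp: B.lab_iff)
    then show 1: "labels n \<Delta>' ?a None = {?p}" using B.single_lab np by blast
    then show "labels n \<Delta>' (?a + int n) None = {?p}" using B.lab_shift[of ?a 1 None] by simp
    have "?q \<in> labels n \<Delta>' v None" using q np lq by (simp add: B.lab_iff)
    then show "labels n \<Delta>' v None = {?q}" using B.single_lab np by blast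
  qed
  have sl: "A.side ?a (Some (?a + int n))" using A.side_loop[OF pa, of 0] by simp
  have sr: "B.side ?a None" "B.side (?a + int n) None" "B.side v None" using rays by (auto simp: side_present_def)
  have TA: "(?a, v, Some (?a + int n)) \<in> A.LT" using v sl by (auto simp: A.LT_def)
  have TB: "(?a, v, None) \<in> B.LT" "(v, ?a + int n, None) \<in> B.LT" using v L R sr by (auto simp: B.LT_def)
  have sumA: "sum F (triangles n \<Delta>) = sum F {t \<in> triangles n \<Delta>. \<not> touch n \<Delta> ?D t} + F (?a, v, Some (?a + int n))"
    if F: "\<And>j t. F (tsh (j * int n) t) = F t" for F :: "_ \<Rightarrow> int"
  proof -
    have "sum F (triangles n \<Delta>) = sum F {t \<in> triangles n \<Delta>. \<not> touch n \<Delta> ?D t} + sum F {(?a, v, Some (?a + int n))}"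
    proof (rule A.sum_touch[OF F])
      show "{(?a, v, Some (?a + int n))} \<subseteq> A.LT" using TA by simp
      show "touch n \<Delta> ?D t" if "t \<in> {(?a, v, Some (?a + int n))}" for t
        using that loop by (auto simp: touch_def)
      show "inj_on (normt n) {(?a, v, Some (?a + int n))}" by simp
      fix t assume t: "t \<in> A.LT" "touch n \<Delta> ?D t"
      then obtain d where d: "d \<in> ?D" "touch n \<Delta> {d} t" using touch_single by blast
      \<comment> \<open>No triangle lies above the loop: it would have a side wider than
        \<open>n\<close>, or a ray, which a pair excludes.\<close>
      have n1: "(?a, ?a + int n, w) \<notin> A.LT" for w
      proof
        assume "(?a, ?a + int n, w) \<in> A.LT"
        then have "A.side ?a w" "vlt (?a + int n) w" by (auto simp: A.LT_def)
        then show False using A.side_bound[of ?a "the w"] A.pair_no_ray[OF pa] by (cases w) auto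
      qed
      have n2: "(u, ?a, Some (?a + int n)) \<notin> A.LT" for u
        using A.side_bound[of u "?a + int n"] by (auto simp: A.LT_def)
      have "d \<in> labels n \<Delta> ?a (Some (?a + int n))" using d loop by simp
      from A.touch_arc[OF t(1) this d(2)]
      show "\<exists>x\<in>{(?a, v, Some (?a + int n))}. \<exists>j. t = tsh (j * int n) x"
        using n1 n2 A.below_unique[OF TA] by blast
    qed
    then show ?thesis by simp
  qed
  have sumB: "sum F (triangles n \<Delta>') = sum F {t \<in> triangles n \<Delta>'. \<not> touch n \<Delta>' ?D' t} + (F (?a, v, None) + F (v, ?a + int n, None))"
    if F: "\<And>j t. F (tsh (j * int n) t) = F t" for F :: "_ \<Rightarrow> int"
  proof -
    have nn: "v \<noteq> ?a + j * int n" "?a \<noteq> v + j * int n" for j using v multiple_cases[of j n] by linarith+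
    have "sum F (triangles n \<Delta>') = sum F {t \<in> triangles n \<Delta>'. \<not> touch n \<Delta>' ?D' t} + sum F {(?a, v, None), (v, ?a + int n, None)}"
    proof (rule B.sum_touch[OF F])
      show "{(?a, v, None), (v, ?a + int n, None)} \<subseteq> B.LT" using TB by simp
      show "touch n \<Delta>' ?D' t" if "t \<in> {(?a, v, None), (v, ?a + int n, None)}" for t
        using that rays by (auto simp: touch_def)
      show "inj_on (normt n) {(?a, v, None), (v, ?a + int n, None)}"
        using nn by (auto simp: inj_on_def tsh_def dest!: normt_eqD)
      fix t assume t: "t \<in> B.LT" "touch n \<Delta>' ?D' t"
      then obtain d where d: "d \<in> ?D'" "touch n \<Delta>' {d} t" using touch_single by blast
      \<comment> \<open>The triangle to the left of the ray at \<open>a\<close> is a translate of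
        the triangle to the left of its lift at \<open>a + n\<close>.\<close>
      have l1: "(u, ?a, None) \<in> B.LT \<Longrightarrow> u = v - int n" for u
        using B.above_left_unique[of u ?a None "v - int n"] TB(2) B.LT_shift[of "-1" "(v, ?a + int n, None)"]
        by (simp add: tsh_def)
      have s1: "(v - int n, ?a, None) = tsh (-1 * int n) (v, ?a + int n, None)" by (simp add: tsh_def)
      consider "d = ?p" | "d = ?q" using d by blast
      then show "\<exists>x\<in>{(?a, v, None), (v, ?a + int n, None)}. \<exists>j. t = tsh (j * int n) x"
      proof cases
        case 1
        then have "d \<in> labels n \<Delta>' ?a None" using rays by simp
        from B.touch_arc[OF t(1) this d(2)] obtain j where 
          "t = tsh (j * int n) (?a, v, None) \<or> t = tsh (j * int n) (v - int n, ?a, None)"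
          using B.below_unique[OF TB(1)] l1 by blast
        moreover have "tsh (j * int n) (v - int n, ?a, None) = tsh ((-1 + j) * int n) (v, ?a + int n, None)"
          unfolding s1 tsh_tsh distrib_right ..
        ultimately show ?thesis by blast
      next
        case 2
        then have "d \<in> labels n \<Delta>' v None" using rays by simp
        from B.touch_arc[OF t(1) this d(2)] show ?thesis
          using B.below_unique[OF TB(2)] B.above_left_unique[OF TB(1)] by blast
      qed
    qed
    moreover have "(?a, v, None) \<noteq> (v, ?a + int n, None)" using v by auto
    ultimately show ?thesis by simp
  qed
  define S where "S \<beta> \<gamma> = (\<Sum>t\<in>{t \<in> triangles n \<Delta>. \<not> touch n \<Delta> ?D t}. tri_form n \<Delta> t \<beta> \<gamma>)" for \<beta> \<gamma>
  have S': "(\<Sum>t\<in>{t \<in> triangles n \<Delta>'. \<not> touch n \<Delta>' ?D' t}. tri_form n \<Delta>' t \<beta> \<gamma>) = S \<beta> \<gamma>" for \<beta> \<gamma>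
    unfolding S_def by (rule untouched_sum_eq[OF ag X X'])
  have q1: "quiver_of n \<Delta> \<beta> \<gamma> = S \<beta> \<gamma> + tri_form n \<Delta> (?a, v, Some (?a + int n)) \<beta> \<gamma>" for \<beta> \<gamma>
    unfolding A.quiver_sum S_def by (rule sumA) (simp add: A.tri_form_shift)
  have q2: "quiver_of n \<Delta>' \<beta> \<gamma> = S \<beta> \<gamma> + (tri_form n \<Delta>' (?a, v, None) \<beta> \<gamma> + tri_form n \<Delta>' (v, ?a + int n, None) \<beta> \<gamma>)" for \<beta> \<gamma>
    unfolding B.quiver_sum S'[symmetric] by (rule sumB) (simp add: B.tri_form_shift)
  have z0: "S ?p' \<gamma> = 0" for \<gamma> unfolding S_def using A.untouched_zero[of ?p' ?D \<gamma>] by simp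
  have z1: "S ?q \<gamma> = 0" for \<gamma> unfolding S'[symmetric] using B.untouched_zero[of ?q ?D' \<gamma>] by simp
  have iD: "ind ?D \<gamma> = ind {?p} \<gamma>" if "\<gamma> \<noteq> ?p'" for \<gamma> using that by (auto simp: ind_def)
  have ids: "ind ?D ?p' = 1" "ind ?L ?p' = 0" "ind ?R ?p' = 0" "ind ?L ?q = 0" "ind ?R ?q = 0" 
    using L R by (auto simp: ind_def)
  have pq: "?p \<noteq> ?q" "?p \<noteq> ?p'"
  proof -
    show "?p \<noteq> ?q" using \<open>a \<noteq> fst ?q\<close> by (metis fst_conv)
  qed (use e in auto)
  have row: "quiver_of n \<Delta> ?p' \<gamma> = ind ?R \<gamma> - ind ?L \<gamma>" for \<gamma>
    unfolding q1 z0 tri_form_def wedge_def prod.case loop ids by simp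
  have row': "quiver_of n \<Delta>' ?q \<gamma> = ind ?L \<gamma> - ind ?R \<gamma>" if "\<gamma> \<noteq> ?q" for \<gamma>
    unfolding q2 z1 tri_form_def wedge_def prod.case rays L(1) R(1) ids ind_single using pq that by simp
  have z: "ind ?L \<gamma> = 0 \<or> ind ?R \<gamma> = 0" for \<gamma>
    using ind_disjoint[OF A.lab_near_start] v by blast
  have "quiver_of n \<Delta>' \<beta> \<gamma> = gmut ?p' (quiver_of n \<Delta>) \<beta> \<gamma>" if "\<beta> \<in> \<Delta> - {?p'}" "\<gamma> \<in> \<Delta> - {?p'}" for \<beta> \<gamma>
  proof -
    have ne: "\<beta> \<noteq> ?p'" "\<gamma> \<noteq> ?p'" "\<beta> \<noteq> ?q" "\<gamma> \<noteq> ?q" using that nin by auto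
    have "quiver_of n \<Delta> \<beta> ?p' = ind ?L \<beta> - ind ?R \<beta>" using quiver_skew[of n \<Delta> \<beta> ?p'] row by simp
    then have "gmut ?p' (quiver_of n \<Delta>) \<beta> \<gamma> = quiver_of n \<Delta> \<beta> \<gamma> + (ind ?L \<beta> * ind ?R \<gamma> - ind ?R \<beta> * ind ?L \<gamma>)"
      using row[of \<gamma>] mutation_identity[of "ind ?L \<beta>" "ind ?R \<beta>" "ind ?L \<gamma>" "ind ?R \<gamma>"] z
      by (simp add: gmut_def)
    moreover have "ind {?q} \<beta> = 0" "ind {?q} \<gamma> = 0" using ne by (auto simp: ind_def)
    ultimately show ?thesis
      unfolding q1 q2 tri_form_def wedge_def L(1) R(1) rays loop prod.case iD[OF ne(1)] iD[OF ne(2)]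
      by (simp add: algebra_simps)
  qed
  moreover have "quiver_of n \<Delta>' ?q \<gamma> = - quiver_of n \<Delta> ?p' \<gamma>" if "\<gamma> \<in> \<Delta> - {?p'}" for \<gamma>
    using row[of \<gamma>] row'[of \<gamma>] that nin by auto
  ultimately show ?thesis using nin p q K unfolding mutrel_def by blast
qed

section \<open>Every diagonal can be flipped\<close>

context triang
begin

text \<open>A new ray has the tag of all present rays, so no pair arises; and if there is a pair,
  then \<open>d\<close> is a chord. Hence \<open>has_pair\<close> does not change, as
  \<open>quad_mutation\<close> requires. The last conclusion locates the new diagonal for
  \<open>more_rays\<close>.\<close>

lemma quad_flip:
  assumes Q: "quad x y z w" and d: "d \<in> \<Delta>" "is_lift n d p q" "\<not> (is_ray n d \<and> paired (fst d))"
    and pq: "(p = x \<and> q = Some z) \<or> (p = y \<and> q = w)"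
  shows "\<exists>d'. flips n \<Delta> d d' \<and> mutrel n \<Delta> d (insert d' (\<Delta> - {d})) d' \<and>
    (p = x \<longrightarrow> is_lift n d' y w)"
proof -
  obtain p' q' where pq': "(p = x \<and> q = Some z \<and> p' = y \<and> q' = w) \<or> (p = y \<and> q = w \<and> p' = x \<and> q' = Some z)"
    using pq by blast
  obtain d' where d': "flips n \<Delta> d d'" "d' \<in> diags n" "is_lift n d' p' q'"
    "is_ray n d' \<longrightarrow> (\<forall>c\<in>\<Delta>. is_ray n c \<longrightarrow> tag c = tag d')"
    using quad_flips[OF Q d pq'] by blast
  define \<Delta>' where "\<Delta>' = insert d' (\<Delta> - {d})"
  have T': "triang n \<Delta>'" using d'(1) n3 by (simp add: triang_def flips_def \<Delta>'_def)
  interpret B: triang n \<Delta>' by fact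
  have T: "triang n \<Delta>" by unfold_locales
  have nin: "d' \<notin> \<Delta>" "d \<notin> \<Delta>'" using d'(1) d(1) by (auto simp: flips_def \<Delta>'_def)
  have K: "\<Delta> - {d} = \<Delta>' - {d'}" using nin by (auto simp: \<Delta>'_def)
  have hp: "has_pair n \<Delta> a = has_pair n \<Delta>' a" for a
  proof
    assume a: "has_pair n \<Delta> a"
    then have "\<not> is_ray n d" using d pair_rays[OF a] by blast
    then show "has_pair n \<Delta>' a" using a by (auto simp: has_pair_def \<Delta>'_def)
  next
    assume a: "has_pair n \<Delta>' a"
    show "has_pair n \<Delta> a"
    proof (rule ccontr)
      assume na: "\<not> has_pair n \<Delta> a"
      then obtain e where e: "d' = (a, n, e)" "(a, n, -e) \<in> \<Delta>" "e = 1 \<or> e = -1"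
        using a by (auto simp: has_pair_def \<Delta>'_def)
      then have "-e = e" using d'(4) by fastforce
      then show False using e by auto
    qed
  qed
  have l: "lab p q = {d}" using single_lab[of d p q] side_lift[OF d(1,2)] d(3) by blast
  have "is_ray n d' \<longrightarrow> \<not> B.paired (fst d')"
  proof (intro impI notI)
    assume "is_ray n d'" "B.paired (fst d')"
    then have "(fst d', n, 1) \<in> \<Delta>" "(fst d', n, -1) \<in> \<Delta>" using hp by (auto simp: has_pair_def)
    then show False using \<open>is_ray n d'\<close>
      d'(4)[rule_format, of "(fst d', n, 1)"] d'(4)[rule_format, of "(fst d', n, -1)"] by simp
  qed
  then have l': "B.lab p' q' = {d'}" using B.single_lab[of d' p' q'] B.side_lift[of d' p' q'] d'(3) by (auto simp: \<Delta>'_def)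
  have sd: "B.side r s" if rs: "side r s" "lab r s \<inter> {d} = {}" for r s
  proof (cases "s = Some (r + 1)")
    case False
    then have "lab r s \<noteq> {}" using rs(1) unfolding side_present_def by blast
    then obtain c where c: "c \<in> lab r s" by blast
    then have "c \<in> \<Delta>'" using rs by (auto simp: \<Delta>'_def lab_iff)
    then have "c \<in> B.lab r s" using c hp by (simp add: lab_iff B.lab_iff)
    then show ?thesis by (auto simp: side_present_def)
  qed (use B.border in auto)
  have dj: "lab x (Some y) \<inter> {d} = {}" "lab y (Some z) \<inter> {d} = {}" "lab z w \<inter> {d} = {}" "lab x w \<inter> {d} = {}"
    using quad_disjoint(5,6)[OF Q] l pq by blast+
  have Q': "B.quad x y z w" 
    using Q sd[OF _ dj(1)] sd[OF _ dj(2)] sd[OF _ dj(3)] sd[OF _ dj(4)] unfolding quad_def B.quad_def by blast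
  have "mutrel n \<Delta> d \<Delta>' d'"
    using pq'
  proof (elim disjE conjE)
    assume "p = x" "q = Some z" "p' = y" "q' = w"
    then show ?thesis using quad_mutation[OF T T' Q _ _ K nin(2,1) d(1) _ hp] l l' by (simp add: \<Delta>'_def)
  next
    assume "p = y" "q = w" "p' = x" "q' = Some z"
    then have "mutrel n \<Delta>' d' \<Delta> d" 
      using quad_mutation[OF T' T Q' _ _ K[symmetric] nin _ d(1) hp[symmetric]] l l' by (simp add: \<Delta>'_def)
    then show ?thesis by (rule mutrel_sym)
  qed
  moreover have "p = x \<longrightarrow> is_lift n d' y w" using d'(3) pq' Q by (auto simp: quad_def)
  ultimately show ?thesis using d'(1) \<Delta>'_def by blast
qed

text \<open>The triangles below and above the chord form the quadrilateral; the side on which the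
  upper corner lies decides which of its two diagonals the chord is.\<close>

lemma flip_chord:
  assumes d: "d \<in> \<Delta>" "\<not> is_ray n d"
  shows "\<exists>d'. flips n \<Delta> d d' \<and> mutrel n \<Delta> d (insert d' (\<Delta> - {d})) d'"
proof -
  obtain x q where l0: "is_lift n d x q" using is_lift_ex by blast
  then obtain z where q: "q = Some z" using is_lift_None_iff[OF in_diags[OF d(1)] l0] d(2) by (cases q) auto
  have l: "is_lift n d x (Some z)" using l0 q by simp
  have b: "x + 2 \<le> z" "z < x + int n" using is_lift_bounds l in_diags d by blast+
  have s: "side x (Some z)" using side_lift l d by blast
  obtain y where y: "x < y" "y < z" "side x (Some y)" "side y (Some z)" using inner[OF s b(1)] by blast
  from outer[OF s b(2)] b consider t where "t < x" "side t (Some x)" "side t (Some z)"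
    | t where "olt (Some z) t" "side x t" "side z t" by auto
  then show ?thesis
  proof cases
    case 1
    then have "quad t x y (Some z)" using y by (simp add: quad_def)
    then show ?thesis using quad_flip l d by blast
  next
    case 2
    then have "quad x y z t" using y b by (simp add: quad_def)
    then show ?thesis using quad_flip l d by blast
  qed
qed

lemma chord_side_mono:
  assumes "triang n \<Delta>'" "\<And>c. c \<in> \<Delta> \<Longrightarrow> \<not> is_ray n c \<Longrightarrow> c \<in> \<Delta>'" "side r (Some s)" "s < r + int n"
  shows "side_present n \<Delta>' r (Some s)"
proof -
  interpret B: triang n \<Delta>' by fact
  show ?thesis using assms(3)
  proof (cases rule: side_cases)
    case 1 then show ?thesis using B.border by simp
  next
    case (2 c)
    then have "\<not> is_ray n c" using is_lift_bounds in_diags by blast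
    then show ?thesis using B.side_lift 2 assms(2) by blast
  qed (use assms in auto)
qed

text \<open>The neighbouring rays on both sides span a quadrilateral, unless they are lifts of one
  diagonal. In that case the flip creates a pair and is the reverse of a flip of a pair.\<close>

lemma flip_ray:
  assumes d: "d \<in> \<Delta>" "is_ray n d" and np: "\<And>a. \<not> paired a"
  shows "\<exists>d'. flips n \<Delta> d d' \<and> mutrel n \<Delta> d (insert d' (\<Delta> - {d})) d'"
proof -
  define x where "x = int (fst d)"
  have l: "is_lift n d x None" using ray_lift[OF d(2), of x None] by (auto simp: x_def intro: exI[of _ 0])
  have s: "side x None" using side_lift l d np by blast
  obtain v where v: "x < v" "v < x + int n" "side v None" "side x (Some v)" using inner_None(1)[OF s] by blast
  obtain t where t: "t < x" "x < t + int n" "side t None" "side t (Some x)" using inner_None(2)[OF s] by blast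
  show ?thesis
  proof (cases "v < t + int n")
    case True
    then have "quad t x v None" using v t by (simp add: quad_def)
    then show ?thesis using quad_flip l d np by blast
  next
    case False
    have "side (t + int n) None" using side_shift[of t 1 None] t by simp
    then have "\<not> crs (t + int n) None x (Some v)" using side_nc v by blast
    then have vt: "v = t + int n" using t False by (auto simp: crs_def)
    obtain p where p: "p \<in> \<Delta>" "is_ray n p" "is_lift n p v None" using ray_at v by blast
    let ?d = "(fst p, n, - tag p)"
    have fl: "flips n \<Delta> d ?d" using digon_flips[OF d l p s] vt t v by simp
    define \<Delta>' where "\<Delta>' = insert ?d (\<Delta> - {d})"
    have T': "triang n \<Delta>'" using fl n3 by (simp add: triang_def flips_def \<Delta>'_def)
    have T: "triang n \<Delta>" by unfold_locales
    have nin: "?d \<notin> \<Delta>" "d \<notin> \<Delta>'" using fl d by (auto simp: flips_def \<Delta>'_def)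
    have pf: "p = (fst p, n, tag p)" "tag p = 1 \<or> tag p = -1" using ray_form p by auto
    obtain j where j: "v = int (fst p) + j * int n" using ray_lift[OF p(2)] p(3) by blast
    \<comment> \<open>Translation by \<open>(1 - j) * n\<close> moves the digon so that it starts at
      \<open>int (fst p)\<close>, the position that \<open>pair_mutation\<close> expects.\<close>
    define v' where "v' = x + (1 - j) * int n"
    have a1: "t + (1 - j) * int n = int (fst p)" using vt j by (simp add: algebra_simps)
    have a2: "v + (1 - j) * int n = int (fst p) + int n" using vt j by (simp add: algebra_simps)
    have ld: "is_lift n d v' None" using is_lift_shift[OF l, of "1 - j"] by (simp add: v'_def)
    have dd: "dg n (tag p) v' None = d"
    proof -
      have "tag d = tag p" using same_tag[OF np] d p by blast
      moreover have "dg n (tag p) v' None \<in> diags n" "is_lift n (dg n (tag p) v' None) v' None"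
        using n3 pf by (auto intro!: dg_diags dg_lift)
      ultimately show ?thesis using is_lift_inj[OF _ ld] in_diags d by (metis dg_tag(1))
    qed
    have vb: "int (fst p) < v'" "v' < int (fst p) + int n" using a1 t v'_def by linarith+
    have s1: "side (int (fst p)) (Some v')" using side_shift[of t "1 - j" "Some x"] t a1 v'_def by simp
    have s2: "side v' (Some (int (fst p) + int n))" using side_shift[of x "1 - j" "Some v"] v a2 v'_def by simp
    have cm: "c \<in> \<Delta>'" if "c \<in> \<Delta>" "\<not> is_ray n c" for c using that d by (auto simp: \<Delta>'_def)
    have "p \<noteq> d" using nin(1) lift_vertex_neq[OF l p(3)] v by auto
    then have "p \<in> \<Delta>'" using p by (simp add: \<Delta>'_def)
    have "mutrel n \<Delta>' ?d \<Delta> (dg n (tag p) v' None)"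
    proof (rule pair_mutation[OF T' T pf(2)])
      show "(fst p, n, tag p) \<in> \<Delta>'" using \<open>p \<in> \<Delta>'\<close> pf(1) by simp
      show "?d \<in> \<Delta>'" by (simp add: \<Delta>'_def)
      show "\<Delta>' - {?d} = \<Delta> - {dg n (tag p) v' None}" unfolding dd using nin by (auto simp: \<Delta>'_def)
      show "side_present n \<Delta>' (int (fst p)) (Some v')" using chord_side_mono[OF T' cm s1] vb by simp
      show "side_present n \<Delta>' v' (Some (int (fst p) + int n))" using chord_side_mono[OF T' cm s2] vb by simp
    qed (use dd d nin vb in auto)
    then have "mutrel n \<Delta> d \<Delta>' ?d" unfolding dd by (rule mutrel_sym)
    then show ?thesis using fl \<Delta>'_def by blast
  qed
qed

lemma flip_pair:
  assumes pa: "paired a" and e: "e = 1 \<or> e = -1"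
  shows "\<exists>v. flips n \<Delta> (a, n, -e) (dg n e v None) \<and> mutrel n \<Delta> (a, n, -e) (insert (dg n e v None) (\<Delta> - {(a, n, -e)})) (dg n e v None)
    \<and> fst (dg n e v None) \<noteq> a"
proof -
  have s: "side (int a) (Some (int a + int n))" using side_loop[OF pa, of 0] by simp
  have T: "triang n \<Delta>" by unfold_locales
  obtain v where v: "int a < v" "v < int a + int n" "side (int a) (Some v)" "side v (Some (int a + int n))"
    using inner[OF s] n3 by auto
  have fl: "flips n \<Delta> (a, n, -e) (dg n e v None)" using pair_flips[OF pa e v] .
  define \<Delta>' where "\<Delta>' = insert (dg n e v None) (\<Delta> - {(a, n, -e)})"
  have T': "triang n \<Delta>'" using fl n3 by (simp add: triang_def flips_def \<Delta>'_def)
  have nin: "dg n e v None \<notin> \<Delta>" "(a,n,-e) \<notin> \<Delta>'"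
  proof -
    show 1: "dg n e v None \<notin> \<Delta>" using fl unfolding flips_def by blast
    have "(a,n,-e) \<in> \<Delta>" using fl unfolding flips_def by blast
    then have "(a,n,-e) \<noteq> dg n e v None" using 1 by metis
    then show "(a,n,-e) \<notin> \<Delta>'" unfolding \<Delta>'_def by simp
  qed
  have "mutrel n \<Delta> (a, n, -e) \<Delta>' (dg n e v None)"
  proof (rule pair_mutation[OF T T' e])
    show "(a, n, e) \<in> \<Delta>" "(a, n, -e) \<in> \<Delta>" using pa e by (auto simp: has_pair_def)
    show "\<Delta> - {(a, n, - e)} = \<Delta>' - {dg n e v None}" using nin unfolding \<Delta>'_def by blast
    show "dg n e v None \<in> \<Delta>'" by (simp add: \<Delta>'_def)
  qed (use nin v in auto)
  moreover have "is_lift n (a,n,e) (int a) None" using pair_lift[OF pa, of e 0] by simp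
  moreover have "is_lift n (dg n e v None) v None" using n3 by (intro dg_lift) auto
  ultimately show ?thesis using fl \<Delta>'_def lift_vertex_neq[of n "(a,n,e)" "int a" None "dg n e v None" v None] v by auto
qed

theorem flip_exists:
  assumes d: "d \<in> \<Delta>"
  shows "\<exists>d'. flips n \<Delta> d d' \<and> mutrel n \<Delta> d (insert d' (\<Delta> - {d})) d'"
proof (cases "is_ray n d")
  case False
  then show ?thesis using flip_chord d by blast
next
  case True
  show ?thesis
  proof (cases "\<exists>a. paired a")
    case a: True
    then obtain a where a: "paired a" by blast
    have "d = (a, n, - (- tag d))" "- tag d = 1 \<or> - tag d = -1"
      using ray_form[OF d True] pair_rays[OF a d True] by auto
    then show ?thesis using flip_pair[OF a, of "- tag d"] by metis
  next
    case False
    then show ?thesis using flip_ray d True by blast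
  qed
qed

end

section \<open>Connectedness of the flip graph\<close>

definition star :: "nat \<Rightarrow> int \<Rightarrow> diag set" where
  "star n e = (\<lambda>a. (a, n, e)) ` {..<n}"

definition ray_vertices :: "nat \<Rightarrow> diag set \<Rightarrow> nat set" where
  "ray_vertices n \<Delta> = {a. \<exists>e. (a, n, e) \<in> \<Delta>}"

lemma chord_crosses_star:
  assumes "c \<in> diags n" "\<not> is_ray n c" "3 \<le> n" "e = 1 \<or> e = -1"
  shows "\<exists>b\<in>star n e. crosses n c b"
proof -
  obtain x q where l0: "is_lift n c x q" using is_lift_ex by blast
  then obtain z where q: "q = Some z" using is_lift_None_iff[OF assms(1) l0] assms(2) by (cases q) auto
  have b: "x + 2 \<le> z" using is_lift_bounds l0 q assms by blast
  \<comment> \<open>A chord has width at least two, so this ray starts strictly inside it.\<close>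
  let ?b = "dg n e (x + 1) None"
  have "?b \<in> diags n" "is_lift n ?b (x + 1) None" using assms by (auto intro!: dg_diags dg_lift)
  moreover have "crs x q (x + 1) None" using b q by (auto simp: crs_def)
  moreover have "?b \<in> star n e" using assms by (auto simp: star_def dg_def nat_less_iff)
  ultimately show ?thesis using crossesI_crs[OF assms(1) _ l0] by blast
qed

lemma star_triangulation:
  assumes "3 \<le> n" "e = 1 \<or> e = -1"
  shows "triangulation n (star n e)"
  unfolding triangulation_def
proof (intro conjI allI impI)
  show "star n e \<subseteq> diags n" using assms by (auto simp: star_def diags_def)
  show "noncrossing n (star n e)" by (auto simp: noncrossing_def star_def)
  fix D assume D: "star n e \<subseteq> D \<and> D \<subseteq> diags n \<and> noncrossing n D"
  have "c \<in> star n e" if c: "c \<in> D" for c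
  proof -
    have cd: "c \<in> diags n" using c D by blast
    have nx: "\<not> crosses n c b" if "b \<in> star n e" for b using D c that by (auto simp: noncrossing_def)
    then have r: "is_ray n c" using chord_crosses_star cd assms by blast
    obtain a f where cf: "c = (a, n, f)" using r by (cases c) auto
    have a: "a < n" "f = 1 \<or> f = -1" using cd cf by (auto simp: diags_def)
    \<comment> \<open>Any vertex other than \<open>a\<close> will do: a ray there crosses
      \<open>c\<close> exactly if the tags differ.\<close>
    define b where "b = (if a = 0 then 1 else 0 :: nat)"
    have "(b, n, e) \<in> star n e" using assms by (auto simp: star_def b_def)
    then have "\<not> crosses n c (b, n, e)" by (rule nx)
    then have "f = e" by (auto simp: cf b_def split: if_splits)
    then show ?thesis using cf a by (auto simp: star_def)
  qed
  then show "D = star n e" using D by blast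
qed

context triang
begin

lemma ray_vertices_sub: "ray_vertices n \<Delta> \<subseteq> {..<n}"
  using in_diags by (auto simp: ray_vertices_def diags_def)

lemma ray_vertex_side:
  assumes "\<And>a. \<not> paired a"
  shows "nat (x mod int n) \<in> ray_vertices n \<Delta> \<longleftrightarrow> side x None"
proof
  assume "nat (x mod int n) \<in> ray_vertices n \<Delta>"
  then obtain e where e: "(nat (x mod int n), n, e) \<in> \<Delta>" by (auto simp: ray_vertices_def)
  have "x = int (nat (x mod int n)) + (x div int n) * int n" using n3 by simp
  then have "is_lift n (nat (x mod int n), n, e) x None" unfolding is_lift_def prod.case
    by (intro conjI exI[of _ "x div int n"]) simp_all
  then show "side x None" using side_lift[OF e] assms by blast
next
  assume "side x None"
  then obtain c where c: "c \<in> \<Delta>" "is_ray n c" "is_lift n c x None" using ray_at by blast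
  obtain j where j: "x = int (fst c) + j * int n" using ray_lift[OF c(2)] c(3) by blast
  have "fst c < n" using ray_form c by blast
  then have "nat (x mod int n) = fst c" by (simp add: j)
  then show "nat (x mod int n) \<in> ray_vertices n \<Delta>" using ray_form[OF c(1,2)] c(1)
    unfolding ray_vertices_def by (metis (mono_tags, lifting) mem_Collect_eq)
qed

lemma star_if_all_rays:
  assumes "\<And>a. \<not> paired a" "ray_vertices n \<Delta> = {..<n}"
  shows "\<exists>e. (e = 1 \<or> e = -1) \<and> \<Delta> = star n e"
proof -
  obtain e where e: "e = 1 \<or> e = -1" "\<And>c. c \<in> \<Delta> \<Longrightarrow> is_ray n c \<Longrightarrow> tag c = e"
    using common_tag[OF assms(1)] by metis
  have s: "star n e \<subseteq> \<Delta>"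
  proof
    fix c assume "c \<in> star n e"
    then obtain a where a: "c = (a, n, e)" "a < n" by (auto simp: star_def)
    then obtain f where "(a, n, f) \<in> \<Delta>" using assms(2) by (auto simp: ray_vertices_def)
    then show "c \<in> \<Delta>" using e(2)[of "(a, n, f)"] a by simp
  qed
  have "\<Delta> \<subseteq> diags n" "noncrossing n \<Delta>" using tri by (auto simp: triangulation_def)
  then have "\<Delta> = star n e" using star_triangulation[OF n3 e(1)] s unfolding triangulation_def by blast
  then show ?thesis using e by blast
qed

text \<open>If each ray had its next neighbour at distance one, rays would propagate step by step to
  all vertices.\<close>

lemma ray_gap:
  assumes np: "\<And>a. \<not> paired a" and ne: "ray_vertices n \<Delta> \<noteq> {..<n}"
  shows "\<exists>x v. side x None \<and> side v None \<and> side x (Some v) \<and> x + 2 \<le> v \<and> v < x + int n"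
proof (rule ccontr)
  assume no: "\<not> ?thesis"
  obtain x0 where x0: "side x0 None"
  proof -
    obtain c where "c \<in> \<Delta>" "is_ray n c" using ex_ray by blast
    then show ?thesis using that side_lift[of c "int (fst c)" None] ray_lift[of c "int (fst c)" None] np
      by (auto intro: exI[of _ 0])
  qed
  have all: "side (x0 + int k) None" for k
  proof (induction k)
    case 0 then show ?case using x0 by simp
  next
    case (Suc k)
    obtain v where v: "x0 + int k < v" "v < x0 + int k + int n" "side v None" "side (x0 + int k) (Some v)"
      using inner_None(1)[OF Suc] by blast
    moreover have "\<not> x0 + int k + 2 \<le> v" using no v Suc by blast
    ultimately have "v = x0 + int k + 1" by linarith
    then show ?case using v(3) by (simp add: algebra_simps)
  qed
  obtain b where b: "b < n" "b \<notin> ray_vertices n \<Delta>" using ne ray_vertices_sub by blast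
  define k where "k = nat ((int b - x0) mod int n)"
  have "(x0 + int k) mod int n = (x0 + (int b - x0)) mod int n"
    unfolding k_def using n3 by (simp add: mod_add_right_eq)
  then have "nat ((x0 + int k) mod int n) = b" using b by simp
  then show False using ray_vertex_side[OF np, of "x0 + int k"] all b by simp
qed

text \<open>Flipping one member of a pair produces a second puncture vertex. Without a pair, the
  chord over a gap between neighbouring rays flips into a ray at a new vertex, and all old rays
  remain.\<close>

lemma more_rays:
  assumes "\<And>e. e = 1 \<or> e = -1 \<Longrightarrow> \<Delta> \<noteq> star n e"
  shows "\<exists>d \<Delta>' d'. triangulation n \<Delta>' \<and> mutrel n \<Delta> d \<Delta>' d' \<and>
    card (ray_vertices n \<Delta>) < card (ray_vertices n \<Delta>')"
proof (cases "\<exists>a. paired a")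
  case True
  then obtain a where a: "paired a" by blast
  obtain v where v: "flips n \<Delta> (a, n, -1) (dg n 1 v None)" 
    "mutrel n \<Delta> (a, n, -1) (insert (dg n 1 v None) (\<Delta> - {(a, n, -1)})) (dg n 1 v None)"
    "fst (dg n 1 v None) \<noteq> a" using flip_pair[OF a, of 1] by auto
  let ?D = "insert (dg n 1 v None) (\<Delta> - {(a, n, -1)})"
  have T: "triangulation n ?D" using v(1) by (simp add: flips_def)
  interpret B: triang n ?D using T n3 by unfold_locales
  have "ray_vertices n \<Delta> \<subseteq> {a}" using pair_rays[OF a] by (fastforce simp: ray_vertices_def)
  then have "card (ray_vertices n \<Delta>) \<le> 1" using card_mono[of "{a}"] by fastforce
  moreover have "{a, fst (dg n 1 v None)} \<subseteq> ray_vertices n ?D"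
    using a by (auto simp: ray_vertices_def has_pair_def dg_def)
  then have "2 \<le> card (ray_vertices n ?D)" using v(3) card_mono[of "ray_vertices n ?D"] B.ray_vertices_sub
    by (metis card_2_iff finite_lessThan finite_subset)
  ultimately have "card (ray_vertices n \<Delta>) < card (ray_vertices n ?D)" by linarith
  then show ?thesis using T v(2) by blast
next
  case False
  then have np: "\<not> paired a" for a by blast
  then have "ray_vertices n \<Delta> \<noteq> {..<n}" using star_if_all_rays assms by blast
  then obtain x v where xv: "side x None" "side v None" "side x (Some v)" "x + 2 \<le> v" "v < x + int n"
    using ray_gap[OF np] by blast
  obtain y where y: "x < y" "y < v" "side x (Some y)" "side y (Some v)" using inner xv by blast
  have Q: "quad x y v None" using xv y by (simp add: quad_def)
  obtain c where c: "c \<in> \<Delta>" "is_lift n c x (Some v)" using xv(3)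
    by (cases rule: side_cases) (use xv np in auto)
  have nr: "\<not> is_ray n c" using is_lift_bounds c in_diags by blast
  obtain d' where d': "flips n \<Delta> c d'" "mutrel n \<Delta> c (insert d' (\<Delta> - {c})) d'" "is_lift n d' y None"
    using quad_flip[OF Q c, of] nr by auto
  let ?D = "insert d' (\<Delta> - {c})"
  have T: "triangulation n ?D" using d'(1) by (simp add: flips_def)
  interpret B: triang n ?D using T n3 by unfold_locales
  have ry: "is_ray n d'" using d'(3) is_lift_None_iff B.in_diags by blast
  have nin: "fst d' \<notin> ray_vertices n \<Delta>"
  proof
    assume "fst d' \<in> ray_vertices n \<Delta>"
    then obtain e where e: "(fst d', n, e) \<in> \<Delta>" by (auto simp: ray_vertices_def)
    have "is_lift n (fst d', n, e) y None" using d'(3) ray_lift[OF ry, of y] by (simp add: is_lift_def)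
    then have "side y None" using side_lift[OF e] np by blast
    then show False using side_nc[OF _ xv(3)] y by (fastforce simp: crs_def)
  qed
  have "insert (fst d') (ray_vertices n \<Delta>) \<subseteq> ray_vertices n ?D"
  proof -
    have "d' = (fst d', n, tag d')" using ry by (cases d') auto
    then have "fst d' \<in> ray_vertices n ?D" unfolding ray_vertices_def by (metis insertI1 mem_Collect_eq)
    moreover have "ray_vertices n \<Delta> \<subseteq> ray_vertices n ?D" using nr by (auto simp: ray_vertices_def)
    ultimately show ?thesis by blast
  qed
  moreover have "finite (ray_vertices n \<Delta>)" "finite (ray_vertices n ?D)"
    using ray_vertices_sub B.ray_vertices_sub finite_subset by blast+
  ultimately have "card (ray_vertices n \<Delta>) < card (ray_vertices n ?D)"
    using nin card_mono[of "ray_vertices n ?D" "insert (fst d') (ray_vertices n \<Delta>)"] by simp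
  then show ?thesis using T d'(2) by blast
qed

lemma lab_border: "lab u (Some (u + 1)) = {}"
proof -
  have "\<not> is_lift n c u (Some (u + 1))" if "c \<in> \<Delta>" for c
    using is_lift_bounds(1) in_diags[OF that] by fastforce
  then show ?thesis using n3 by (auto simp: lab_iff split: if_splits)
qed

end

text \<open>The measure is the number of vertices not joined to the puncture.
  \<open>more_rays\<close> leads towards a star, and the induction step travels back along the same
  flip, which \<open>mutrel_sym\<close> permits.\<close>

lemma triangulation_induct [consumes 2, case_names star step]:
  assumes n: "3 \<le> n" and t: "triangulation n \<Delta>"
    and star: "\<And>e. e = 1 \<or> e = -1 \<Longrightarrow> P (star n e)"
    and step: "\<And>\<Delta> d \<Delta>' d'. triangulation n \<Delta> \<Longrightarrow> triangulation n \<Delta>' \<Longrightarrow> mutrel n \<Delta> d \<Delta>' d' \<Longrightarrow> P \<Delta> \<Longrightarrow> P \<Delta>'"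
  shows "P \<Delta>"
  using t
proof (induction "n - card (ray_vertices n \<Delta>)" arbitrary: \<Delta> rule: less_induct)
  case less
  interpret triang n \<Delta> using less.prems n by unfold_locales
  show ?case
  proof (cases "\<exists>e. (e = 1 \<or> e = -1) \<and> \<Delta> = star n e")
    case True
    then show ?thesis using star by blast
  next
    case False
    then obtain d \<Delta>' d' where *: "triangulation n \<Delta>'" "mutrel n \<Delta> d \<Delta>' d'"
      "card (ray_vertices n \<Delta>) < card (ray_vertices n \<Delta>')" using more_rays by blast
    interpret B: triang n \<Delta>' using *(1) n by unfold_locales
    have "card (ray_vertices n \<Delta>') \<le> n"
      using card_mono[OF _ B.ray_vertices_sub] by simp
    then have "n - card (ray_vertices n \<Delta>') < n - card (ray_vertices n \<Delta>)" using *(3) by linarith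
    then have "P \<Delta>'" using less.hyps *(1) by blast
    then show ?thesis using step[OF *(1) less.prems mutrel_sym[OF *(2)]] by blast
  qed
qed

lemma star_quiver:
  assumes n: "3 \<le> n" and e: "e = 1 \<or> e = -1" and ab: "a < n" "b < n"
  shows "quiver_of n (star n e) (a, n, e) (b, n, e) = of_bool (b = (a + 1) mod n) - of_bool (a = (b + 1) mod n)"
proof (cases "a = b")
  case True
  then show ?thesis by (simp add: quiver_of_def)
next
  case False
  interpret triang n "star n e" using star_triangulation[OF n e] n by unfold_locales
  have np: "\<not> paired c" for c using e by (auto simp: has_pair_def star_def)
  have lb: "lab u None = {(nat (u mod int n), n, e)}" for u
  proof -
    have "dg n e u None \<in> star n e" using n by (auto simp: star_def dg_def nat_less_iff)
    moreover have "is_lift n (dg n e u None) u None" using n by (intro dg_lift) auto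
    ultimately have "lab u None = {dg n e u None}" using single_lab side_lift np by metis
    then show ?thesis by (simp add: dg_def)
  qed
  have sd: "side u None" for u using lb by (simp add: side_present_def)
  \<comment> \<open>Two sides of this quadrilateral are border edges, which carry no label; the
    other two are the neighbouring rays.\<close>
  have Q: "quad (int a - 1) (int a) (int a + 1) None"
    using n sd border[of "int a - 1"] border[of "int a"] by (simp add: quad_def)
  have l: "lab (int a) None = {(a, n, e)}" using lb[of "int a"] ab by simp
  have "quiver_of n (star n e) (a, n, e) (b, n, e) = ind {(nat ((int a + 1) mod int n), n, e)} (b, n, e)
    - ind {(nat ((int a - 1) mod int n), n, e)} (b, n, e)"
    using row_yw[OF Q l, of "(b,n,e)"] False lab_border[of "int a"] lab_border[of "int a - 1"] lb
    by (simp add: ind_def)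
  moreover have "nat ((int a + 1) mod int n) = (a + 1) mod n" by (metis nat_int of_nat_1 of_nat_add zmod_int)
  moreover have "nat ((int a - 1) mod int n) = b \<longleftrightarrow> a = (b + 1) mod n"
  proof
    assume "nat ((int a - 1) mod int n) = b"
    then have "int b = (int a - 1) mod int n" using n by auto
    then have "(int b + 1) mod int n = int a mod int n" by (simp add: mod_add_left_eq)
    then have "int ((b + 1) mod n) = int a" using ab by (simp add: zmod_int add.commute)
    then show "a = (b + 1) mod n" by simp
  next
    assume "a = (b + 1) mod n"
    then have "(int a - 1) mod int n = (int b + 1 - 1) mod int n"
      by (metis mod_diff_left_eq of_nat_1 of_nat_add zmod_int)
    then show "nat ((int a - 1) mod int n) = b" using ab by simp
  qed
  ultimately show ?thesis by (auto simp: ind_def)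
qed

section \<open>Rotations and inversion of tags\<close>

text \<open>Names the isomorphism, since rigidity is a statement about each of them.\<close>

definition giso :: "('a \<Rightarrow> 'b) \<Rightarrow> 'a set \<Rightarrow> ('a \<Rightarrow> 'a \<Rightarrow> int) \<Rightarrow> 'b set \<Rightarrow> ('b \<Rightarrow> 'b \<Rightarrow> int) \<Rightarrow> bool" where
  "giso f V B W C \<longleftrightarrow> bij_betw f V W \<and> (\<forall>x\<in>V. \<forall>y\<in>V. C (f x) (f y) = B x y)"

lemma quiver_iso_giso: "quiver_iso V B W C \<longleftrightarrow> (\<exists>f. giso f V B W C)"
  by (simp add: quiver_iso_def giso_def)

lemma quiver_iso_sym: "quiver_iso V B W C \<Longrightarrow> quiver_iso W C V B"
proof -
  assume "quiver_iso V B W C"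
  then obtain f where f: "bij_betw f V W" "\<forall>x\<in>V. \<forall>y\<in>V. C (f x) (f y) = B x y" by (auto simp: quiver_iso_def)
  have i: "inv_into V f x \<in> V" "f (inv_into V f x) = x" if "x \<in> W" for x
    using f(1) that by (auto simp: bij_betw_def inv_into_into f_inv_into_f)
  have "B (inv_into V f x) (inv_into V f y) = C x y" if "x \<in> W" "y \<in> W" for x y
    using f(2)[rule_format, OF i(1)[OF that(1)] i(1)[OF that(2)]] i(2) that by simp
  then show ?thesis using bij_betw_inv_into[OF f(1)] by (auto simp: quiver_iso_def)
qed

lemma quiver_iso_trans: "quiver_iso V B W C \<Longrightarrow> quiver_iso W C X D \<Longrightarrow> quiver_iso V B X D"
proof -
  assume "quiver_iso V B W C" "quiver_iso W C X D"
  then obtain f g where f: "bij_betw f V W" "\<forall>x\<in>V. \<forall>y\<in>V. C (f x) (f y) = B x y"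
    and g: "bij_betw g W X" "\<forall>x\<in>W. \<forall>y\<in>W. D (g x) (g y) = C x y" by (auto simp: quiver_iso_def)
  have "f x \<in> W" if "x \<in> V" for x using f(1) that by (rule bij_betwE[rule_format])
  then show ?thesis using bij_betw_trans[OF f(1) g(1)] f(2) g(2)
    unfolding quiver_iso_def by (intro exI[of _ "g \<circ> f"]) simp
qed

lemma quiver_iso_refl: "quiver_iso V B V B"
  unfolding quiver_iso_def by (intro exI[of _ id]) auto

text \<open>Common form of \<open>mutrel\<close> on diagonals and \<open>mutate\<close> on numbered
  vertices, so that one transport lemma serves both. Rows and columns are listed because the
  matrices are not assumed to be skew-symmetric.\<close>

definition grel :: "'a set \<Rightarrow> ('a \<Rightarrow> 'a \<Rightarrow> int) \<Rightarrow> 'a \<Rightarrow> 'a set \<Rightarrow> ('a \<Rightarrow> 'a \<Rightarrow> int) \<Rightarrow> 'a \<Rightarrow> bool" where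
  "grel V Q d V' Q' d' \<longleftrightarrow> d \<in> V \<and> d' \<in> V' \<and> V - {d} = V' - {d'} \<and> Q d d = 0 \<and> Q' d' d' = 0 \<and>
     (\<forall>x\<in>V - {d}. \<forall>y\<in>V - {d}. Q' x y = gmut d Q x y) \<and>
     (\<forall>y\<in>V - {d}. Q' d' y = - Q d y \<and> Q' y d' = - Q y d)"

lemma quiver_diag [simp]: "quiver_of n \<Delta> d d = 0"
  by (simp add: quiver_of_def)

lemma mutrel_grel:
  assumes "mutrel n \<Delta> d \<Delta>' d'"
  shows "grel \<Delta> (quiver_of n \<Delta>) d \<Delta>' (quiver_of n \<Delta>') d'"
  using assms quiver_skew[of n \<Delta>' _ d'] quiver_skew[of n \<Delta> _ d] unfolding mutrel_def grel_def by simp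

text \<open>Mutation depends on the matrix alone, so an isomorphism survives mutation at
  corresponding vertices once the new vertices are matched.\<close>

lemma giso_flip:
  assumes f: "giso f V Q W B" and v: "grel V Q d V' Q' d'" and w: "grel W B (f d) W' B' k'"
  shows "giso (f(d' := k')) V' Q' W' B'"
proof -
  let ?f = "f(d' := k')"
  have b: "bij_betw f V W" and p: "\<And>x y. x \<in> V \<Longrightarrow> y \<in> V \<Longrightarrow> B (f x) (f y) = Q x y"
    using f by (auto simp: giso_def)
  have V': "V' = insert d' (V - {d})" and K: "\<And>x. x \<in> V - {d} \<Longrightarrow> x \<noteq> d'" and d: "d \<in> V" using v by (auto simp: grel_def)
  have W': "W' = insert k' (W - {f d})" and k: "k' \<notin> W - {f d}" using w by (auto simp: grel_def)
  have fK: "f x \<in> W - {f d}" if "x \<in> V - {d}" for x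
    using b d that unfolding bij_betw_def inj_on_def by blast
  have fx: "?f x = f x" if "x \<in> V - {d}" for x using K that by auto
  have "bij_betw f (V - {d}) (W - {f d})"
    using bij_betw_subset[OF b, of "V - {d}"] b d by (auto simp: bij_betw_def inj_on_def)
  then have "bij_betw ?f (V - {d}) (W - {f d})" using bij_betw_cong[of "V - {d}" f ?f] fx by auto
  then have "bij_betw ?f (insert d' (V - {d})) (insert k' (W - {f d}))"
    using notIn_Un_bij_betw[of d' "V - {d}" ?f "W - {f d}"] K k by auto
  then have bb: "bij_betw ?f V' W'" unfolding V' W' .
  have "B' (?f x) (?f y) = Q' x y" if xy: "x \<in> V'" "y \<in> V'" for x y
  proof -
    have c: "x = d' \<or> x \<in> V - {d}" "y = d' \<or> y \<in> V - {d}" using xy V' by auto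
    have 1: "Q' x y = gmut d Q x y" if "x \<in> V - {d}" "y \<in> V - {d}" using v that by (simp add: grel_def)
    have 2: "B' (f x) (f y) = gmut (f d) B (f x) (f y)" if "x \<in> V - {d}" "y \<in> V - {d}" using w fK that by (simp add: grel_def)
    have 3: "Q' d' d' = 0" "B' k' k' = 0" using v w by (auto simp: grel_def)
    have 4: "Q' d' y = - Q d y" "Q' y d' = - Q y d" if "y \<in> V - {d}" for y using v that by (auto simp: grel_def)
    have 5: "B' k' (f y) = - B (f d) (f y)" "B' (f y) k' = - B (f y) (f d)" if "y \<in> V - {d}" for y
      using w fK[OF that] by (auto simp: grel_def)
    show ?thesis
    proof (cases "x = d'")
      case True
      then show ?thesis using 3 4 5 p d c(2) fx by (cases "y = d'") auto
    next
      case x: False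
      then have xK: "x \<in> V - {d}" using c by blast
      show ?thesis
      proof (cases "y = d'")
        case True
        then show ?thesis using 4 5 p d xK fx by auto
      next
        case False
        then have yK: "y \<in> V - {d}" using c by blast
        have "B' (f x) (f y) = gmut d Q x y" using 2[OF xK yK] p xK yK d by (simp add: gmut_def)
        then show ?thesis using 1[OF xK yK] fx xK yK by simp
      qed
    qed
  qed
  then show ?thesis using bb by (auto simp: giso_def)
qed

section \<open>Rotations combined with inversion of tags\<close>

definition act :: "nat \<Rightarrow> nat \<Rightarrow> int \<Rightarrow> diag \<Rightarrow> diag" where
  "act n c s d = (case d of (a, k, e) \<Rightarrow> ((a + c) mod n, k, if k = n then s * e else e))"

lemma act_diags: "n > 0 \<Longrightarrow> s = 1 \<or> s = -1 \<Longrightarrow> d \<in> diags n \<Longrightarrow> act n c s d \<in> diags n"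
  by (auto simp: act_def diags_def)

lemma mod_shift_back:
  fixes a n c :: nat
  assumes "a < n"
  shows "((a + c) mod n + (n - c mod n)) mod n = a" "((a + (n - c mod n)) mod n + c) mod n = a"
proof -
  have c: "c mod n < n" using assms by simp
  have "((a + c) mod n + (n - c mod n)) mod n = ((a + c mod n) + (n - c mod n)) mod n"
    by (metis mod_add_left_eq mod_add_right_eq)
  also have "(a + c mod n) + (n - c mod n) = a + n" using c by simp
  finally show "((a + c) mod n + (n - c mod n)) mod n = a" using assms by simp
  have "((a + (n - c mod n)) mod n + c) mod n = ((a + (n - c mod n)) + c mod n) mod n"
    by (metis mod_add_left_eq mod_add_right_eq)
  also have "(a + (n - c mod n)) + c mod n = a + n" using c by simp
  finally show "((a + (n - c mod n)) mod n + c) mod n = a" using assms by simp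
qed

lemma act_inverse:
  assumes "n > 0" "s = 1 \<or> s = -1" "d \<in> diags n"
  shows "act n (n - c mod n) s (act n c s d) = d" "act n c s (act n (n - c mod n) s d) = d"
proof -
  obtain a k e where d: "d = (a,k,e)" by (cases d)
  have a: "a < n" using assms d by (auto simp: diags_def)
  note 1 = mod_shift_back(1)[OF a, of c] and 2 = mod_shift_back(2)[OF a, of c]
  have 3: "s * (s * e) = e" using assms(2) by auto
  show "act n (n - c mod n) s (act n c s d) = d" "act n c s (act n (n - c mod n) s d) = d"
    using 1 2 3 by (auto simp: act_def d)
qed

lemma act_lift:
  assumes "is_lift n d u v"
  shows "is_lift n (act n c s d) (u + int c) (osh (int c) v)"
proof -
  obtain a k e where d: "d = (a,k,e)" by (cases d)
  obtain j where j: "u = int a + j * int n" using assms by (auto simp: is_lift_def d)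
  have "u + int c = int ((a + c) mod n) + (int ((a + c) div n) + j) * int n"
  proof -
    have "int a + int c = int ((a + c) mod n) + int ((a + c) div n) * int n"
      by (metis mod_div_mult_eq of_nat_add of_nat_mult)
    then show ?thesis using j by (simp add: distrib_right)
  qed
  then show ?thesis using assms by (auto simp: is_lift_def act_def d)
qed

lemma act_crosses:
  assumes n: "n > 0" and s: "s = 1 \<or> s = -1" and d: "d \<in> diags n" "b \<in> diags n" and x: "crosses n d b"
  shows "crosses n (act n c s d) (act n c s b)"
proof -
  note D = act_diags[OF n s d(1), of c] act_diags[OF n s d(2), of c]
  from x[unfolded crosses_iff_crs[OF d]] show ?thesis
  proof
    assume "\<exists>u v p q. is_lift n d u v \<and> is_lift n b p q \<and> crs u v p q"
    then obtain u v p q where *: "is_lift n d u v" "is_lift n b p q" "crs u v p q" by blast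
    show ?thesis using crossesI_crs[OF D act_lift[OF *(1)] act_lift[OF *(2)]] *(3) by simp
  next
    assume r: "is_ray n d \<and> is_ray n b \<and> fst d \<noteq> fst b \<and> tag d \<noteq> tag b"
    have "fst (act n c s d) \<noteq> fst (act n c s b)"
    proof
      assume e: "fst (act n c s d) = fst (act n c s b)"
      have "fst (act n (n - c mod n) s (act n c s d)) = fst (act n (n - c mod n) s (act n c s b))"
        using e by (simp add: act_def[of n "n - c mod n"] case_prod_beta)
      then show False using r act_inverse(1)[OF n s] d by simp
    qed
    moreover have "tag (act n c s d) = s * tag d" "tag (act n c s b) = s * tag b"
      "is_ray n (act n c s d)" "is_ray n (act n c s b)"
      using r by (auto simp: act_def case_prod_beta)
    ultimately have "is_ray n (act n c s d) \<and> is_ray n (act n c s b) \<and>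
       fst (act n c s d) \<noteq> fst (act n c s b) \<and> tag (act n c s d) \<noteq> tag (act n c s b)"
      using r s by auto
    then show ?thesis using crosses_iff_crs[OF D] by blast
  qed
qed

lemma act_image_inverse:
  assumes "n > 0" "s = 1 \<or> s = -1" "S \<subseteq> diags n"
  shows "act n (n - c mod n) s ` act n c s ` S = S" "act n c s ` act n (n - c mod n) s ` S = S"
proof -
  have "(\<lambda>x. act n (n - c mod n) s (act n c s x)) ` S = (\<lambda>x. x) ` S"
    using act_inverse(1)[OF assms(1,2)] assms(3) by (intro image_cong) auto
  then show "act n (n - c mod n) s ` act n c s ` S = S" by (simp add: image_image)
  have "(\<lambda>x. act n c s (act n (n - c mod n) s x)) ` S = (\<lambda>x. x) ` S"
    using act_inverse(2)[OF assms(1,2)] assms(3) by (intro image_cong) auto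
  then show "act n c s ` act n (n - c mod n) s ` S = S" by (simp add: image_image)
qed

lemma act_noncrossing:
  assumes n: "n > 0" "s = 1 \<or> s = -1" and S: "S \<subseteq> diags n" "noncrossing n S"
  shows "noncrossing n (act n c s ` S)"
  unfolding noncrossing_def
proof (intro ballI notI)
  fix x y assume xy: "x \<in> act n c s ` S" "y \<in> act n c s ` S" and cr: "crosses n x y"
  obtain d b where db: "d \<in> S" "b \<in> S" "x = act n c s d" "y = act n c s b" using xy by blast
  have "crosses n (act n (n - c mod n) s x) (act n (n - c mod n) s y)"
    using act_crosses[OF n _ _ cr] act_diags[OF n] db S(1) by blast
  then have "crosses n d b" using act_inverse(1)[OF n] db S(1) by (metis subsetD)
  then show False using S db by (auto simp: noncrossing_def)
qed

lemma act_triangulation: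
  assumes n: "n > 0" "s = 1 \<or> s = -1" and t: "triangulation n \<Delta>"
  shows "triangulation n (act n c s ` \<Delta>)"
  unfolding triangulation_def
proof (intro conjI allI impI)
  have D: "\<Delta> \<subseteq> diags n" "noncrossing n \<Delta>" using t by (auto simp: triangulation_def)
  show "act n c s ` \<Delta> \<subseteq> diags n" using act_diags[OF n] D by blast
  show "noncrossing n (act n c s ` \<Delta>)" using act_noncrossing[OF n D] .
  fix E assume E: "act n c s ` \<Delta> \<subseteq> E \<and> E \<subseteq> diags n \<and> noncrossing n E"
  let ?E = "act n (n - c mod n) s ` E"
  have "\<Delta> \<subseteq> ?E" using act_image_inverse(1)[OF n D(1), of c] E by (metis image_mono)
  moreover have "?E \<subseteq> diags n" using act_diags[OF n] E by blast
  moreover have "noncrossing n ?E" using act_noncrossing[OF n] E by blast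
  ultimately have "?E = \<Delta>" using t by (auto simp: triangulation_def)
  then show "E = act n c s ` \<Delta>" using act_image_inverse(2)[OF n, of E c] E by metis
qed

lemma act_inj:
  assumes n: "n > 0" "s = 1 \<or> s = -1" and "S \<subseteq> diags n"
  shows "inj_on (act n c s) S"
  using act_inverse(1)[OF n] assms(3) by (intro inj_on_inverseI[of _ "act n (n - c mod n) s"]) blast

text \<open>Two triangulations that differ in one diagonal are already related by the flip, whatever
  its shape. Symmetries therefore map flips to flips as soon as they preserve
  triangulations.\<close>

lemma flip_unique:
  assumes n: "3 \<le> n" and t: "triangulation n \<Delta>" and d: "d \<in> \<Delta>" and 
    x: "x \<noteq> d" "triangulation n (insert x (\<Delta> - {d}))"
  shows "mutrel n \<Delta> d (insert x (\<Delta> - {d})) x"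
    and "y \<noteq> d \<Longrightarrow> triangulation n (insert y (\<Delta> - {d})) \<Longrightarrow> y = x"
proof -
  interpret triang n \<Delta> using n t by unfold_locales
  obtain d' where d': "flips n \<Delta> d d'" "mutrel n \<Delta> d (insert d' (\<Delta> - {d})) d'" using flip_exists[OF d] by blast
  then have "x = d'" using x unfolding flips_def by blast
  then show "mutrel n \<Delta> d (insert x (\<Delta> - {d})) x" using d' by simp
  show "y = x" if "y \<noteq> d" "triangulation n (insert y (\<Delta> - {d}))" using d' \<open>x = d'\<close> that unfolding flips_def by blast
qed

lemma act_star: "0 < n \<Longrightarrow> act n c s ` star n e = star n (s * e)"
proof -
  assume n: "0 < n"
  have "\<exists>a<n. (a + c) mod n = b" if "b < n" for b
    using mod_shift_back(2)[OF that, of c] n by (intro exI[of _ "(b + (n - c mod n)) mod n"]) auto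
  then have "(\<lambda>a. (a + c) mod n) ` {..<n} = {..<n}" using n by fastforce
  then have "(\<lambda>a. (a, n, s * e)) ` (\<lambda>a. (a + c) mod n) ` {..<n} = star n (s * e)" by (simp add: star_def)
  then show ?thesis by (simp add: star_def image_image act_def)
qed

lemma mod_Suc_cancel:
  fixes a b c n :: nat
  assumes "a < n" "b < n"
  shows "((b + c) mod n = ((a + c) mod n + 1) mod n) = (b = (a + 1) mod n)"
proof -
  have "((a + c) mod n + 1) mod n = ((a + 1) mod n + c) mod n"
  proof -
    have "((a + c) mod n + 1) mod n = (a + c + 1) mod n" by (rule mod_add_left_eq)
    also have "a + c + 1 = a + 1 + c" by simp
    also have "\<dots> mod n = ((a + 1) mod n + c) mod n" by (rule mod_add_left_eq[symmetric])
    finally show ?thesis .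
  qed
  moreover have "((b + c) mod n = (x + c) mod n) = (b = x)" if "x < n" for x
  proof -
    show ?thesis using mod_shift_back[of b n c] mod_shift_back[of x n c] assms that by metis
  qed
  ultimately show ?thesis using assms by simp
qed

text \<open>Induction along flips avoids transporting triangles, whose chosen representatives a
  rotation does not preserve: symmetries map flips to flips, so only stars have to be
  computed.\<close>

theorem act_giso:
  assumes n: "3 \<le> n" and s: "s = 1 \<or> s = -1" and t: "triangulation n \<Delta>"
  shows "giso (act n c s) \<Delta> (quiver_of n \<Delta>) (act n c s ` \<Delta>) (quiver_of n (act n c s ` \<Delta>))"
  using n t
proof (induction rule: triangulation_induct)
  case (star e)
  have se: "s * e = 1 \<or> s * e = -1" using s star by auto
  have "inj_on (act n c s) (star n e)" using act_inj[of n s "star n e" c] s n star_triangulation[OF n star] by (auto simp: triangulation_def)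
  moreover have "quiver_of n (star n (s * e)) (act n c s x) (act n c s y) = quiver_of n (star n e) x y"
    if xy: "x \<in> star n e" "y \<in> star n e" for x y
  proof -
    obtain a b where ab: "x = (a,n,e)" "y = (b,n,e)" "a < n" "b < n" using xy by (auto simp: star_def)
    have "act n c s x = ((a + c) mod n, n, s * e)" "act n c s y = ((b + c) mod n, n, s * e)"
      by (auto simp: act_def ab)
    then show ?thesis using star_quiver[OF n se, of "(a + c) mod n" "(b + c) mod n"] star_quiver[OF n star ab(3,4)]
      ab(1,2) mod_Suc_cancel[OF ab(3,4)] mod_Suc_cancel[OF ab(4,3)] n by simp
  qed
  ultimately show ?case using n by (simp add: giso_def act_star bij_betw_def)
next
  case (step \<Delta> d \<Delta>' d')
  have n0: "0 < n" using n by simp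
  let ?g = "act n c s"
  have m: "d \<in> \<Delta>" "d' \<in> \<Delta>'" "d' \<notin> \<Delta>" "\<Delta> - {d} = \<Delta>' - {d'}" using step by (auto simp: mutrel_def)
  then have D': "\<Delta>' = insert d' (\<Delta> - {d})" by blast
  have in_diags: "\<Delta> \<subseteq> diags n" "\<Delta>' \<subseteq> diags n" using step by (auto simp: triangulation_def)
  have inj: "inj_on ?g (\<Delta> \<union> \<Delta>')" using act_inj[OF n0 s, of "\<Delta> \<union> \<Delta>'" c] in_diags by blast
  have "?g ` (\<Delta> - {d}) = ?g ` \<Delta> - {?g d}" using inj m(1) by (auto simp: inj_on_def)
  then have e: "?g ` \<Delta>' = insert (?g d') (?g ` \<Delta> - {?g d})" by (simp add: D')
  have ne: "?g d' \<noteq> ?g d" using inj m unfolding inj_on_def by blast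
  have T: "triangulation n (?g ` \<Delta>)" "triangulation n (?g ` \<Delta>')" using act_triangulation[OF n0 s] step by blast+
  have "mutrel n (?g ` \<Delta>) (?g d) (?g ` \<Delta>') (?g d')"
    using flip_unique(1)[OF n T(1) _ ne] T(2) m(1) unfolding e by blast
  from giso_flip[OF step(4) mutrel_grel[OF step(3)] mutrel_grel[OF this]]
  show ?case by (simp add: fun_upd_idem)
qed

lemma rotate_act: "rotate_tri n i \<Delta> = act n (n - i mod n) 1 ` \<Delta>"
  unfolding rotate_tri_def act_def by (rule image_cong) auto

lemma invert_act: "\<Delta> \<subseteq> diags n \<Longrightarrow> invert_tags n \<Delta> = act n 0 (-1) ` \<Delta>"
  unfolding invert_tags_def act_def by (rule image_cong) (auto simp: diags_def)

lemma tri_equiv_imp_iso: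
  assumes n: "3 \<le> n" and "tri_equiv n \<Delta> \<Delta>'"
  shows "quiver_iso \<Delta> (quiver_of n \<Delta>) \<Delta>' (quiver_of n \<Delta>')"
proof -
  have g: "quiver_iso x (quiver_of n x) y (quiver_of n y)" if "tri_gen n x y" for x y
  proof -
    have t: "triangulation n x" using that by (simp add: tri_gen_def triangulations_def)
    then have "x \<subseteq> diags n" by (simp add: triangulation_def)
    then have "\<exists>c s. (s = 1 \<or> s = -1) \<and> y = act n c s ` x"
      using that rotate_act invert_act unfolding tri_gen_def by metis
    then show ?thesis using act_giso[OF n _ t] quiver_iso_giso by blast
  qed
  show ?thesis using assms(2) unfolding tri_equiv_def
  proof (induction rule: rtranclp_induct)
    case base show ?case by (rule quiver_iso_refl)
  next
    case (step y z)
    then show ?case using g quiver_iso_sym quiver_iso_trans by blast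
  qed
qed

lemma act_imp_tri_equiv:
  assumes n: "3 \<le> n" and s: "s = 1 \<or> s = -1" and t: "triangulation n \<Delta>"
  shows "tri_equiv n \<Delta> (act n c s ` \<Delta>)"
proof -
  \<comment> \<open>\<open>rotate_tri\<close> turns clockwise and \<open>act\<close>
    counterclockwise.\<close>
  let ?i = "n - c mod n"
  have n0: "0 < n" using n by simp
  let ?R = "rotate_tri n ?i \<Delta>"
  have in_diags: "\<Delta> \<subseteq> diags n" using t by (simp add: triangulation_def)
  have R: "?R = act n (n - ?i mod n) 1 ` \<Delta>" by (rule rotate_act)
  have tR: "triangulation n ?R" unfolding R using act_triangulation[OF n0 _ t] by blast
  have c: "(a + (n - (n - c mod n) mod n)) mod n = (a + c) mod n" for a
  proof (cases "c mod n = 0")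
    case True
    then have "(a + c) mod n = a mod n" by (metis add_0_right mod_add_right_eq)
    then show ?thesis using True by simp
  next
    case False
    then have "(n - c mod n) mod n = n - c mod n" using n0 by simp
    moreover have "c mod n \<le> n" using n0 by (simp add: less_imp_le)
    ultimately show ?thesis by (simp add: mod_add_right_eq)
  qed
  have R1: "?R = act n c 1 ` \<Delta>" unfolding R act_def c ..
  have sR: "?R \<subseteq> diags n" using tR by (simp add: triangulation_def)
  have g1: "tri_gen n \<Delta> ?R" using t tR by (auto simp: tri_gen_def triangulations_def)
  have I: "invert_tags n ?R = act n c (-1) ` \<Delta>"
    unfolding invert_act[OF sR] unfolding R1 image_image
    by (rule image_cong) (auto simp: act_def)
  have "triangulation n (invert_tags n ?R)" unfolding I using act_triangulation[OF n0 _ t] by blast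
  then have g2: "tri_gen n ?R (invert_tags n ?R)" using tR by (auto simp: tri_gen_def triangulations_def)
  show ?thesis using s
  proof
    assume "s = 1" then show ?thesis using g1 R1 unfolding tri_equiv_def by auto
  next
    assume "s = -1"
    moreover have "tri_equiv n \<Delta> (invert_tags n ?R)" unfolding tri_equiv_def 
    proof (rule rtranclp.rtrancl_into_rtrancl[OF r_into_rtranclp])
      show "tri_gen n \<Delta> ?R \<or> tri_gen n ?R \<Delta>" using g1 by simp
      show "tri_gen n ?R (invert_tags n ?R) \<or> tri_gen n (invert_tags n ?R) ?R" using g2 by simp
    qed
    ultimately show ?thesis by (simp add: I)
  qed
qed

section \<open>Rigidity\<close>

text \<open>For \<open>n \<ge> 3\<close> the successor and the predecessor of a vertex differ, so
  the two terms of \<open>star_quiver\<close> never cancel.\<close>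

lemma star_arrow:
  assumes n: "3 \<le> n" and e: "e = 1 \<or> e = -1" and ab: "a < n" "b < n"
  shows "quiver_of n (star n e) (a, n, e) (b, n, e) = 1 \<longleftrightarrow> b = (a + 1) mod n"
proof -
  have "a \<noteq> ((a + 1) mod n + 1) mod n"
  proof
    assume "a = ((a + 1) mod n + 1) mod n"
    then have "a = (a + 2) mod n" by (simp add: mod_Suc_eq)
    moreover have "(a + 2) mod n = a + 2 \<or> n \<le> a + 2 \<and> (a + 2) mod n = a + 2 - n"
    proof (cases "a + 2 < n")
      case False
      then have "(a + 2) mod n = (a + 2 - n) mod n" by (simp add: le_mod_geq)
      then show ?thesis using ab n False by simp
    qed simp
    ultimately show False using n ab by linarith
  qed
  then show ?thesis unfolding star_quiver[OF assms] by (auto simp: of_bool_def split: if_splits)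
qed

section \<open>Stars are recognised by their quivers\<close>

context
  fixes n :: nat and f :: "diag \<Rightarrow> diag" and e :: int and \<Delta> :: "diag set"
  assumes n: "5 \<le> n" and e: "e = 1 \<or> e = -1" 
    and iso: "giso f (star n e) (quiver_of n (star n e)) \<Delta> (quiver_of n \<Delta>)"
begin

lemma iso_elem: "x \<in> \<Delta> \<Longrightarrow> \<exists>a<n. x = f (a, n, e)"
  using iso by (auto simp: giso_def bij_betw_def star_def)

lemma iso_arrow: "a < n \<Longrightarrow> b < n \<Longrightarrow> quiver_of n \<Delta> (f (a, n, e)) (f (b, n, e)) = 1 \<longleftrightarrow> b = (a + 1) mod n"
  using star_arrow[of n e a b] n e iso by (auto simp: giso_def star_def)

lemma succ_unique:
  assumes "x \<in> \<Delta>" "y \<in> \<Delta>" "y' \<in> \<Delta>" "quiver_of n \<Delta> x y = 1" "quiver_of n \<Delta> x y' = 1"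
  shows "y = y'"
  using iso_elem[OF assms(1)] iso_elem[OF assms(2)] iso_elem[OF assms(3)] iso_arrow assms(4,5) by metis

lemma pred_unique:
  assumes "x \<in> \<Delta>" "x' \<in> \<Delta>" "y \<in> \<Delta>" "quiver_of n \<Delta> x y = 1" "quiver_of n \<Delta> x' y = 1"
  shows "x = x'"
proof -
  obtain a a' b where ab: "a < n" "a' < n" "b < n" "x = f (a,n,e)" "x' = f (a',n,e)" "y = f (b,n,e)"
    using iso_elem assms by meson
  then have "(a + 1) mod n = (a' + 1) mod n" using iso_arrow assms by metis
  then have "a = a'" using mod_shift_back(1) ab by metis
  then show ?thesis using ab by simp
qed

lemma succ_exists:
  assumes "x \<in> \<Delta>"
  shows "\<exists>y\<in>\<Delta>. quiver_of n \<Delta> x y = 1"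
proof -
  obtain a where a: "a < n" "x = f (a,n,e)" using iso_elem assms by blast
  have b: "(a + 1) mod n < n" using n by simp
  then have "f ((a + 1) mod n, n, e) \<in> \<Delta>" using iso by (auto simp: giso_def bij_betw_def star_def)
  then show ?thesis using iso_arrow[OF a(1) b] a(2) by blast
qed

text \<open>Inversion of tags exchanges the two members of a pair and fixes all other diagonals. By
  \<open>act_giso\<close> both members have the same successors, whereas predecessors in an oriented
  cycle are unique.\<close>

lemma not_paired:
  assumes t: "triangulation n \<Delta>"
  shows "\<not> has_pair n \<Delta> a"
proof
  assume a: "has_pair n \<Delta> a"
  interpret triang n \<Delta> using t n by unfold_locales auto
  let ?g = "act n 0 (-1)" and ?P = "(a, n, 1::int)" and ?P' = "(a, n, -1::int)" and ?Q = "quiver_of n \<Delta>"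
  have m: "?P \<in> \<Delta>" "?P' \<in> \<Delta>" using a by (auto simp: has_pair_def)
  have an: "a < n" using in_diags[OF m(1)] by (auto simp: diags_def)
  have gP: "?g ?P = ?P'" "?g ?P' = ?P" using an by (auto simp: act_def)
  have ry: "c = ?P \<or> c = ?P'" if c: "c \<in> \<Delta>" "is_ray n c" for c
    using pair_rays[OF a c] ray_form[OF c] by auto
  have gc: "?g c = c" if "c \<in> \<Delta>" "\<not> is_ray n c" for c
    using in_diags[OF that(1)] that(2) by (auto simp: act_def diags_def)
  have "?g c \<in> \<Delta>" if "c \<in> \<Delta>" for c
    using ry[OF that] gc[OF that] gP m that by (cases "is_ray n c") metis+
  moreover have "c \<in> ?g ` \<Delta>" if "c \<in> \<Delta>" for c
    using ry[OF that] gc[OF that] gP m that by (cases "is_ray n c") (metis image_eqI)+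
  ultimately have im: "?g ` \<Delta> = \<Delta>" by blast
  have "giso ?g \<Delta> ?Q (?g ` \<Delta>) (quiver_of n (?g ` \<Delta>))" using act_giso[OF n3 _ tri, of "-1"] by simp
  then have inv: "?Q (?g x) (?g y) = ?Q x y" if "x \<in> \<Delta>" "y \<in> \<Delta>" for x y
    using that unfolding im giso_def by blast
  obtain y where y: "y \<in> \<Delta>" "?Q ?P y = 1" using succ_exists m by blast
  have "?Q ?P ?P' = ?Q ?P' ?P" using inv[OF m] gP by simp
  then have "?Q ?P ?P' = 0" using quiver_skew[of n \<Delta> ?P ?P'] by simp
  then have "y \<noteq> ?P" "y \<noteq> ?P'" using y by auto
  then have "\<not> is_ray n y" using ry y by blast
  then have y2: "?Q ?P' y = 1" using inv[OF m(1) y(1)] gP gc y by simp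
  have "?P = ?P'" by (rule pred_unique[OF m y y2])
  then show False by simp
qed

text \<open>The chord over the gap has the ray at \<open>x\<close> as successor and the ray at
  \<open>v\<close> as predecessor. A diagonal bounding the triangle below the chord would be a
  second successor or predecessor, so both lower sides are border edges.\<close>

lemma gap_two:
  assumes t: "triangulation n \<Delta>"
    and s: "side_present n \<Delta> x None" "side_present n \<Delta> v None" "side_present n \<Delta> x (Some v)" "x + 2 \<le> v" "v < x + int n"
  shows "v = x + 2"
proof -
  interpret triang n \<Delta> using t n by unfold_locales auto
  let ?Q = "quiver_of n \<Delta>"
  obtain y where y: "x < y" "y < v" "side x (Some y)" "side y (Some v)" using inner s by blast
  have Q: "quad x y v None" using s y by (simp add: quad_def)
  obtain C where C: "C \<in> lab x (Some v)" using s(3) s(4) unfolding side_present_def by auto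
  have l: "lab x (Some v) = {C}" using single_lab[OF C] not_paired[OF t] by blast
  obtain rx where rx: "rx \<in> \<Delta>" "rx \<in> lab x None" using ray_at s by blast
  obtain rv where rv: "rv \<in> \<Delta>" "rv \<in> lab v None" using ray_at s by blast
  have CD: "C \<in> \<Delta>" using C by (simp add: lab_iff)
  note row = row_xz[OF Q l]
  note dj = quad_disjoint(1-5)[OF Q, unfolded l] lab_same_start[of "Some v" "None" x, simplified]
  have dj2: "lab x None \<inter> lab y (Some v) = {}" "lab x (Some y) \<inter> lab v None = {}"
    using y s(5) by (auto intro!: lab_near_start)
  have ne: "z \<noteq> C" if "z \<in> lab x (Some y) \<union> lab y (Some v) \<union> lab v None \<union> lab x None" for z
    using that dj(5) by blast
  have 1: "?Q C rx = 1"
    using row[of rx] ne[of rx] rx ind_eq_0[OF rx(2)] ind_eq_1[OF rx(2)] dj dj2 by simp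
  have 2: "?Q rv C = 1"
    using row[of rv] ne[of rv] rv ind_eq_0[OF rv(2)] ind_eq_1[OF rv(2)] dj dj2 quiver_skew[of n \<Delta> rv C] by simp
  have "v = y + 1"
  proof (rule ccontr)
    assume "v \<noteq> y + 1"
    then obtain D where D: "D \<in> lab y (Some v)" using y unfolding side_present_def by auto
    then have "D \<in> \<Delta>" by (simp add: lab_iff)
    have "?Q C D = 1"
      using row[of D] ne[of D] D ind_eq_0[OF D] ind_eq_1[OF D] dj dj2 by simp
    then have "D = rx" using succ_unique 1 CD rx \<open>D \<in> \<Delta>\<close> by blast
    then show False using D rx dj2 by blast
  qed
  moreover have "y = x + 1"
  proof (rule ccontr)
    assume "y \<noteq> x + 1"
    then obtain D where D: "D \<in> lab x (Some y)" using y unfolding side_present_def by auto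
    then have "D \<in> \<Delta>" by (simp add: lab_iff)
    have "?Q D C = 1"
      using row[of D] ne[of D] D ind_eq_0[OF D] ind_eq_1[OF D] dj dj2 quiver_skew[of n \<Delta> D C] by simp
    then have "D = rv" using pred_unique 2 CD rv \<open>D \<in> \<Delta>\<close> by blast
    then show False using D rv dj2 by blast
  qed
  ultimately show ?thesis by simp
qed

text \<open>Two puncture diagonals at opposite vertices of a square also have an oriented \<open>4\<close>-cycle as
quiver, so the last case of the proof needs \<open>n \<ge> 5\<close>.\<close>

lemma cycle_is_star:
  assumes t: "triangulation n \<Delta>"
  shows "\<exists>e'. (e' = 1 \<or> e' = -1) \<and> \<Delta> = star n e'"
proof (rule ccontr)
  assume ns: "\<not> ?thesis"
  interpret triang n \<Delta> using t n by unfold_locales auto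
  let ?Q = "quiver_of n \<Delta>"
  note np = not_paired[OF t]
  have "ray_vertices n \<Delta> \<noteq> {..<n}" using star_if_all_rays np ns by blast
  then obtain x v where s: "side x None" "side v None" "side x (Some v)" "x + 2 \<le> v" "v < x + int n"
    using ray_gap[OF np] by blast
  obtain t' where t': "v < t'" "t' < v + int n" "side t' None" "side v (Some t')" using inner_None(1)[OF s(2)] by blast
  show False
  proof (cases "t' < x + int n")
    \<comment> \<open>The ray at \<open>v\<close> has two successors, the chord over the gap and the
      ray at \<open>t'\<close>.\<close>
    case True
    then have Q: "quad x v t' None" using s t' by (simp add: quad_def)
    obtain C where C: "C \<in> lab x (Some v)" using s(3) s(4) unfolding side_present_def by auto
    obtain rv where rv: "rv \<in> \<Delta>" "rv \<in> lab v None" using ray_at s by blast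
    obtain rt where rt: "rt \<in> \<Delta>" "rt \<in> lab t' None" using ray_at t' by blast
    have l: "lab v None = {rv}" using single_lab[OF rv(2)] np by blast
    have CD: "C \<in> \<Delta>" using C by (simp add: lab_iff)
    note dj = quad_disjoint[OF Q, unfolded l]
    have dj2: "lab x (Some v) \<inter> lab t' None = {}" using s t' True by (intro lab_near_start) auto
    have ne: "z \<noteq> rv" if "z \<in> lab x (Some v) \<union> lab v (Some t') \<union> lab t' None \<union> lab x None" for z
      using that dj(6) by blast
    have "?Q rv C = 1"
      using row_yw[OF Q l, of C] ne[of C] C ind_eq_0[OF C] ind_eq_1[OF C] dj dj2 by simp
    moreover have "?Q rv rt = 1"
      using row_yw[OF Q l, of rt] ne[of rt] rt ind_eq_0[OF rt(2)] ind_eq_1[OF rt(2)] dj dj2 by simp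
    ultimately have "C = rt" using succ_unique rv rt CD by blast
    then show False using C rt dj2 by blast
  next
    \<comment> \<open>There are only two rays, and by \<open>gap_two\<close> both gaps between them
      have width two, so \<open>n = 4\<close>.\<close>
    case False
    have "side (x + int n) None" using side_shift[of x 1 None] s by simp
    then have "\<not> crs (x + int n) None v (Some t')" using side_nc t' by blast
    then have tx: "t' = x + int n" using s False by (auto simp: crs_def)
    have "v = x + 2" using gap_two[OF t s] .
    moreover have "t' = v + 2" using gap_two[OF t s(2) t'(3,4) _ t'(2)] tx calculation n by simp
    ultimately show False using tx n by simp
  qed
qed

end

text \<open>An isomorphism of oriented cycles is determined by the image of one vertex, which gives
  the rotation; the sign \<open>e' * e\<close> turns the tag \<open>e\<close> into
  \<open>e'\<close>.\<close>

lemma star_iso_act: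
  assumes n: "3 \<le> n" and e: "e = 1 \<or> e = -1" "e' = 1 \<or> e' = -1"
    and iso: "giso f (star n e) (quiver_of n (star n e)) (star n e') (quiver_of n (star n e'))"
  shows "\<exists>c s. (s = 1 \<or> s = -1) \<and> (\<forall>x\<in>star n e. f x = act n c s x)"
proof -
  have fm: "f x \<in> star n e'" if "x \<in> star n e" for x using iso that by (auto simp: giso_def bij_betw_def)
  have "(0, n, e) \<in> star n e" using n by (auto simp: star_def)
  then have "f (0, n, e) \<in> star n e'" by (rule fm)
  then obtain c where c: "c < n" "f (0, n, e) = (c, n, e')" by (auto simp: star_def)
  have "f (i, n, e) = ((i + c) mod n, n, e')" if "i < n" for i
    using that
  proof (induction i)
    case 0 then show ?case using c by simp
  next
    case (Suc i)
    have i: "(i, n, e) \<in> star n e" "(Suc i, n, e) \<in> star n e" using Suc by (auto simp: star_def)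
    obtain b where b: "b < n" "f (Suc i, n, e) = (b, n, e')" using fm[OF i(2)] by (auto simp: star_def)
    have "quiver_of n (star n e) (i, n, e) (Suc i, n, e) = 1" using star_arrow[OF n e(1), of i "Suc i"] Suc by simp
    then have "quiver_of n (star n e') ((i + c) mod n, n, e') (b, n, e') = 1"
    proof -
      have "quiver_of n (star n e') (f (i, n, e)) (f (Suc i, n, e)) = quiver_of n (star n e) (i, n, e) (Suc i, n, e)"
        using iso i unfolding giso_def by blast
      moreover have "f (i, n, e) = ((i + c) mod n, n, e')" using Suc by simp
      ultimately show ?thesis using b(2) by (simp add: \<open>quiver_of n (star n e) (i, n, e) (Suc i, n, e) = 1\<close>)
    qed
    then have "b = ((i + c) mod n + 1) mod n" using star_arrow[OF n e(2) _ b(1), of "(i + c) mod n"] n by simp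
    then show ?case using b by (simp add: mod_Suc_eq)
  qed
  then have "\<forall>x\<in>star n e. f x = act n c (e' * e) x" using e by (auto simp: star_def act_def)
  then show ?thesis using e by (intro exI[of _ c] exI[of _ "e' * e"]) auto
qed

text \<open>\<Delta>' and \<open>f\<close> stay in the conclusion because the induction has to vary
  both.\<close>

theorem quiver_iso_is_act:
  assumes n: "5 \<le> n" and t: "triangulation n \<Delta>" 
  shows "triangulation n \<Delta>' \<Longrightarrow> giso f \<Delta> (quiver_of n \<Delta>) \<Delta>' (quiver_of n \<Delta>') \<Longrightarrow>
    \<exists>c s. (s = 1 \<or> s = -1) \<and> (\<forall>x\<in>\<Delta>. f x = act n c s x)"
proof -
  have n3: "3 \<le> n" and n0: "0 < n" using n by auto
  show "triangulation n \<Delta>' \<Longrightarrow> giso f \<Delta> (quiver_of n \<Delta>) \<Delta>' (quiver_of n \<Delta>') \<Longrightarrow>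
    \<exists>c s. (s = 1 \<or> s = -1) \<and> (\<forall>x\<in>\<Delta>. f x = act n c s x)"
    using n3 t
  proof (induction arbitrary: \<Delta>' f rule: triangulation_induct)
    case (star e)
    obtain e' where "e' = 1 \<or> e' = -1" "\<Delta>' = star n e'"
      using cycle_is_star[OF n star(1,3,2)] by blast
    then show ?case using star_iso_act[OF n3 star(1)] star(3) by blast
  next
    case (step \<Delta> d \<Delta>1 d1)
    have m: "d \<in> \<Delta>" "d1 \<in> \<Delta>1" "d1 \<notin> \<Delta>" "d \<notin> \<Delta>1" "\<Delta> - {d} = \<Delta>1 - {d1}" using step(3) by (auto simp: mutrel_def)
    have fd: "f d1 \<in> \<Delta>'" using step(6) m(2) by (auto simp: giso_def bij_betw_def)
    interpret B: triang n \<Delta>' using step(5) n3 by unfold_locales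
    \<comment> \<open>The isomorphism is given on \<Delta>1, but the induction hypothesis concerns
      \<Delta>. Flipping \<open>d1\<close> back to \<open>d\<close> is matched by flipping
      \<open>f d1\<close> on the other side.\<close>
    obtain d2 where d2: "flips n \<Delta>' (f d1) d2" "mutrel n \<Delta>' (f d1) (insert d2 (\<Delta>' - {f d1})) d2"
      using B.flip_exists[OF fd] by blast
    define \<Delta>2 where "\<Delta>2 = insert d2 (\<Delta>' - {f d1})"
    have t2: "triangulation n \<Delta>2" using d2(1) by (simp add: flips_def \<Delta>2_def)
    have d2n: "d2 \<notin> \<Delta>'" using d2(1) by (simp add: flips_def)
    let ?f = "f(d := d2)"
    have g: "giso ?f \<Delta> (quiver_of n \<Delta>) \<Delta>2 (quiver_of n \<Delta>2)"
      using giso_flip[OF step(6) mutrel_grel[OF mutrel_sym[OF step(3)]] mutrel_grel[OF d2(2)]]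
      by (simp add: \<Delta>2_def)
    obtain c s where s: "s = 1 \<or> s = -1" and fa: "\<forall>x\<in>\<Delta>. ?f x = act n c s x"
      using step(4)[OF t2 g] by blast
    have fK: "f x = act n c s x" if "x \<in> \<Delta> - {d}" for x using fa that by auto
    have ad: "act n c s d = d2" using fa m(1) by auto
    have im: "act n c s ` \<Delta> = \<Delta>2"
    proof -
      have "act n c s ` \<Delta> = ?f ` \<Delta>" by (rule image_cong) (use fa in auto)
      then show ?thesis using g unfolding giso_def bij_betw_def by blast
    qed
    have in_diags: "\<Delta> \<subseteq> diags n" "\<Delta>1 \<subseteq> diags n" using step(1,2) by (auto simp: triangulation_def)
    have inj: "inj_on (act n c s) (\<Delta> \<union> \<Delta>1)" using act_inj[OF n0 s, of "\<Delta> \<union> \<Delta>1" c] in_diags by blast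
    have ne: "act n c s d1 \<noteq> d2" using inj m ad unfolding inj_on_def by blast
    have "act n c s ` (\<Delta> - {d}) = \<Delta>2 - {d2}" using inj m(1) im ad by (auto simp: inj_on_def)
    moreover have "\<Delta>1 = insert d1 (\<Delta> - {d})" using m by blast
    ultimately have a1: "act n c s ` \<Delta>1 = insert (act n c s d1) (\<Delta>2 - {d2})" by simp
    have x1: "triangulation n (insert (act n c s d1) (\<Delta>2 - {d2}))"
      using act_triangulation[OF n0 s step(2), of c] unfolding a1 .
    have "insert (f d1) (\<Delta>2 - {d2}) = \<Delta>'" using fd d2n by (auto simp: \<Delta>2_def)
    then have x2: "triangulation n (insert (f d1) (\<Delta>2 - {d2}))" using step(5) by simp
    have "d2 \<in> \<Delta>2" by (simp add: \<Delta>2_def)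
    moreover have "f d1 \<noteq> d2" using fd d2n by auto
    \<comment> \<open>Both values complete \<Delta>2 - {d2} to a triangulation and differ from
      \<open>d2\<close>, so both are the unique flip of \<open>d2\<close>.\<close>
    ultimately have "f d1 = act n c s d1" using flip_unique(2)[OF n3 t2 _ ne x1 _ x2] by blast
    then have "\<forall>x\<in>\<Delta>1. f x = act n c s x" using fK m by blast
    then show ?case using s by blast
  qed
qed

corollary iso_imp_tri_equiv:
  assumes n: "5 \<le> n" and t: "triangulation n \<Delta>" "triangulation n \<Delta>'"
    and i: "quiver_iso \<Delta> (quiver_of n \<Delta>) \<Delta>' (quiver_of n \<Delta>')"
  shows "tri_equiv n \<Delta> \<Delta>'"
proof -
  obtain f where f: "giso f \<Delta> (quiver_of n \<Delta>) \<Delta>' (quiver_of n \<Delta>')" using i quiver_iso_giso by blast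
  obtain c s where s: "s = 1 \<or> s = -1" "\<forall>x\<in>\<Delta>. f x = act n c s x"
    using quiver_iso_is_act[OF n t f] by blast
  have "f ` \<Delta> = \<Delta>'" using f by (simp add: giso_def bij_betw_def)
  then have "act n c s ` \<Delta> = \<Delta>'" using s(2) by auto
  then show ?thesis using act_imp_tri_equiv[OF _ s(1) t(1), of c] n by simp
qed

section \<open>The mutation class of type D\<close>

lemma mutate_gmut: "mutate k B i j = (if i = k \<or> j = k then - B i j else gmut k B i j)"
  by (simp add: mutate_def gmut_def)

lemma mutate_mutate [simp]: "mutate k (mutate k B) = B"
  by (intro ext) (simp add: mutate_def sgn_minus)

lemma mutate_grel: "k < n \<Longrightarrow> B k k = 0 \<Longrightarrow> grel {0..<n} B k {0..<n} (mutate k B) k"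
  by (auto simp: grel_def mutate_gmut)

text \<open>The product is positive only if both factors have the same sign. The correction term may
  thus use the sign of either factor, which is why mutation preserves skew-symmetry.\<close>

lemma sgn_max_mult: "sgn x * max (x * y) 0 = sgn y * max (x * y) (0::int)"
proof (cases "x * y \<le> 0")
  case False
  then have "0 < x \<and> 0 < y \<or> x < 0 \<and> y < 0" by (simp add: zero_less_mult_iff not_le)
  then show ?thesis by (elim disjE) (simp_all add: sgn_if)
qed (simp add: max_absorb2)

lemma mutation_class_skew: "B \<in> mutation_class_D n \<Longrightarrow> B i j = - B j i"
proof (induction arbitrary: i j rule: mutation_class_D.induct)
  case (orient B)
  then show ?case unfolding D_orientation_def by blast
next
  case (mut B k)
  have a: "B j k = - B k j" "B k i = - B i k" "B i j = - B j i" by (rule mut.IH)+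
  have "sgn (B j k) * max (B j k * B k i) 0 = - (sgn (B k j) * max (B k j * B i k) 0)"
    unfolding a(1,2) by (simp add: sgn_minus)
  also have "\<dots> = - (sgn (B i k) * max (B i k * B k j) 0)"
    by (simp only: sgn_max_mult[of "B i k" "B k j"] mult.commute[of "B k j" "B i k"])
  finally have "sgn (B j k) * max (B j k * B k i) 0 = - (sgn (B i k) * max (B i k * B k j) 0)" .
  then show ?case unfolding mutate_def using a by (cases "i = k"; cases "j = k") simp_all
qed

section \<open>Flips answer mutations and mutations answer flips\<close>

definition realized :: "nat \<Rightarrow> (nat \<Rightarrow> nat \<Rightarrow> int) \<Rightarrow> bool" where
  "realized n B \<longleftrightarrow> (\<exists>\<Delta>\<in>triangulations n. quiver_iso \<Delta> (quiver_of n \<Delta>) {0..<n} B)"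

lemma realized_mutate:
  assumes n: "3 \<le> n" and r: "realized n B" and k: "k < n"
  shows "realized n (mutate k B)"
proof -
  obtain \<Delta> f where t: "triangulation n \<Delta>" and f: "giso f \<Delta> (quiver_of n \<Delta>) {0..<n} B"
    using r by (auto simp: realized_def triangulations_def quiver_iso_giso)
  interpret triang n \<Delta> using t n by unfold_locales
  obtain d where d: "d \<in> \<Delta>" "f d = k" using f k unfolding giso_def bij_betw_def
    by (metis atLeastLessThan_iff imageE zero_le)
  obtain d' where d': "flips n \<Delta> d d'" "mutrel n \<Delta> d (insert d' (\<Delta> - {d})) d'" using flip_exists[OF d(1)] by blast
  have "B k k = 0" using f d unfolding giso_def by (metis quiver_diag)
  then have "grel {0..<n} B (f d) {0..<n} (mutate k B) k" using mutate_grel k d(2) by simp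
  from giso_flip[OF f mutrel_grel[OF d'(2)] this] show ?thesis
    using d'(1) by (auto simp: realized_def triangulations_def quiver_iso_giso flips_def)
qed

lemma class_closed_flip:
  assumes "mutrel n \<Delta> d \<Delta>' d'" "\<exists>B\<in>mutation_class_D n. quiver_iso \<Delta> (quiver_of n \<Delta>) {0..<n} B"
  shows "\<exists>B\<in>mutation_class_D n. quiver_iso \<Delta>' (quiver_of n \<Delta>') {0..<n} B"
proof -
  obtain B f where B: "B \<in> mutation_class_D n" and f: "giso f \<Delta> (quiver_of n \<Delta>) {0..<n} B"
    using assms(2) by (auto simp: quiver_iso_giso)
  have "d \<in> \<Delta>" using assms(1) by (simp add: mutrel_def)
  then have k: "f d < n" using f by (auto simp: giso_def bij_betw_def)
  have "B (f d) (f d) = 0" using mutation_class_skew[OF B, of "f d" "f d"] by simp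
  then have "grel {0..<n} B (f d) {0..<n} (mutate (f d) B) (f d)" using mutate_grel k by blast
  from giso_flip[OF f mutrel_grel[OF assms(1)] this] show ?thesis
    using mutation_class_D.mut[OF B k] quiver_iso_giso by blast
qed

text \<open>The quiver of the triangulation with the chords from vertex \<open>0\<close> to \<open>2, \<dots>, m + 1\<close> and
puncture diagonals at \<open>0, m + 1, \<dots>, n - 1\<close>, for \<open>n = q + 5\<close>.  Chord \<open>[0, i + 2]\<close> and puncture
diagonal \<open>i + 1\<close> share the label \<open>i\<close>; the labels \<open>q + 3\<close> and \<open>q + 4\<close> stand for the diagonals at \<open>0\<close>
and \<open>q + 4\<close>.\<close>

definition fan_arrow :: "nat \<Rightarrow> nat \<Rightarrow> nat \<Rightarrow> nat \<Rightarrow> bool" where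
  "fan_arrow q m i j \<longleftrightarrow> j = Suc i \<and> j \<le> q + 2 \<and> j \<noteq> m
     \<or> i = q + 2 \<and> j = q + 4 \<and> m \<le> q + 2 \<or> i = q + 4 \<and> j = q + 3 \<and> m \<le> q + 2
     \<or> i = q + 3 \<and> j = m \<and> m \<le> q + 2
     \<or> Suc j = m \<and> i = (if m = q + 3 then q + 4 else m)
     \<or> Suc i = m \<and> j = q + 3"

definition fan :: "nat \<Rightarrow> nat \<Rightarrow> nat \<Rightarrow> nat \<Rightarrow> int" where
  "fan q m i j = of_bool (fan_arrow q m i j) - of_bool (fan_arrow q m j i)"

text \<open>The only arrow into \<open>m\<close> comes from \<open>q + 3\<close>; arrows leave to
  \<open>m - 1\<close>, if present, and to the next vertex of the cycle. In
  \<open>fan_Suc_col\<close> these arrows are reversed.\<close>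

lemma fan_col:
  assumes "m \<le> q + 2"
  shows "fan q m i m = of_bool (i = q + 3) - of_bool (Suc i = m \<or> i = (if m = q + 2 then q + 4 else Suc m))"
  using assms by (auto simp: fan_def fan_arrow_def)

lemma fan_Suc_col:
  assumes "m \<le> q + 2"
  shows "fan q (Suc m) i m = of_bool (Suc i = m \<or> i = (if m = q + 2 then q + 4 else Suc m)) - of_bool (i = q + 3)"
  using assms by (auto simp: fan_def fan_arrow_def)

lemma fan_skew: "fan q m i j = - fan q m j i"
  by (simp add: fan_def)

lemma of_bool_disj: "\<not> (P \<and> Q) \<Longrightarrow> of_bool (P \<or> Q) = (of_bool P + of_bool Q :: int)"
  by auto

text \<open>The paths through \<open>m\<close> add an arrow from \<open>q + 3\<close> to
  \<open>m - 1\<close>, which cancels an existing one, and an arrow from \<open>q + 3\<close> to the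
  next vertex of the cycle, which shortens the cycle by one. For \<open>m = q + 2\<close> this next
  vertex is \<open>q + 4\<close>, whose arrow to \<open>q + 3\<close> is cancelled as well, so the
  cycle disappears. \<open>P\<close> collects arrows present both before and after.\<close>

lemma fan_off_mutation:
  assumes ij: "i \<noteq> m" "j \<noteq> m" and m: "m \<le> q + 2"
  defines "out \<equiv> (if m = q + 2 then q + 4 else Suc m)"
  shows "fan q m i j + (of_bool (i = q + 3 \<and> (Suc j = m \<or> j = out)) - of_bool (j = q + 3 \<and> (Suc i = m \<or> i = out)))
    = fan q (Suc m) i j"
proof (cases "m = q + 2")
  case False
  define P where "P i j \<longleftrightarrow> j = Suc i \<and> j \<le> q + 2 \<or> i = q + 2 \<and> j = q + 4 \<or> i = q + 4 \<and> j = q + 3" for i j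
  have 1: "fan_arrow q m i j \<longleftrightarrow> P i j \<or> (Suc i = m \<and> j = q + 3)" 
    "fan_arrow q (Suc m) i j \<longleftrightarrow> P i j \<or> (i = q + 3 \<and> j = Suc m)"
    "\<not> (P i j \<and> (Suc i = m \<and> j = q + 3))" "\<not> (P i j \<and> (i = q + 3 \<and> j = Suc m))"
    "i = q + 3 \<and> (Suc j = m \<or> j = out) \<longleftrightarrow> (Suc j = m \<and> i = q + 3) \<or> (i = q + 3 \<and> j = Suc m)"
    "\<not> ((Suc j = m \<and> i = q + 3) \<and> (i = q + 3 \<and> j = Suc m))"
    if "i \<noteq> m" "j \<noteq> m" for i j
    using that False m by (auto simp: fan_arrow_def P_def out_def)
  show ?thesis
    unfolding fan_def 1[OF ij] 1[OF ij(2,1)] of_bool_disj[OF 1(3)[OF ij]] of_bool_disj[OF 1(3)[OF ij(2,1)]]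
      of_bool_disj[OF 1(4)[OF ij]] of_bool_disj[OF 1(4)[OF ij(2,1)]]
      of_bool_disj[OF 1(6)[OF ij]] of_bool_disj[OF 1(6)[OF ij(2,1)]] by simp
next
  case True
  define P where "P i j \<longleftrightarrow> j = Suc i \<and> j \<le> q + 1" for i j
  have 1: "fan_arrow q m i j \<longleftrightarrow> (P i j \<or> (i = q + 4 \<and> j = q + 3)) \<or> (Suc i = m \<and> j = q + 3)" 
    "fan_arrow q (Suc m) i j \<longleftrightarrow> P i j"
    "\<not> ((P i j \<or> (i = q + 4 \<and> j = q + 3)) \<and> (Suc i = m \<and> j = q + 3))" "\<not> (P i j \<and> (i = q + 4 \<and> j = q + 3))"
    "i = q + 3 \<and> (Suc j = m \<or> j = out) \<longleftrightarrow> (Suc j = m \<and> i = q + 3) \<or> (j = q + 4 \<and> i = q + 3)"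
    "\<not> ((Suc j = m \<and> i = q + 3) \<and> (j = q + 4 \<and> i = q + 3))"
    if "i \<noteq> m" "j \<noteq> m" for i j
    using that True by (auto simp: fan_arrow_def P_def out_def)
  show ?thesis
    unfolding fan_def 1[OF ij] 1[OF ij(2,1)] of_bool_disj[OF 1(3)[OF ij]] of_bool_disj[OF 1(3)[OF ij(2,1)]]
      of_bool_disj[OF 1(4)[OF ij]] of_bool_disj[OF 1(4)[OF ij(2,1)]]
      of_bool_disj[OF 1(6)[OF ij]] of_bool_disj[OF 1(6)[OF ij(2,1)]] by simp
qed

lemma mutation_of_bool:
  assumes "\<not> (P \<and> R)" "\<not> (Q \<and> S)"
  shows "sgn (of_bool P - of_bool R :: int) * max ((of_bool P - of_bool R) * (of_bool S - of_bool Q)) 0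
    = of_bool (P \<and> S) - of_bool (Q \<and> R)"
  using assms by (cases P; cases Q; cases R; cases S; simp)

lemma fan_mutate:
  assumes m: "m \<le> q + 2"
  shows "mutate m (fan q m) = fan q (Suc m)"
proof (intro ext)
  fix i j
  let ?o = "\<lambda>i. Suc i = m \<or> i = (if m = q + 2 then q + 4 else Suc m)"
  have row: "fan q m m j = of_bool (?o j) - of_bool (j = q + 3)" for j
    using fan_col[OF m, of j] by (simp add: fan_def)
  have dis: "\<not> ?o (q + 3)" using m by auto
  show "mutate m (fan q m) i j = fan q (Suc m) i j"
  proof (cases "i = m \<or> j = m")
    case True
    have "fan q (Suc m) i m = - fan q m i m" for i unfolding fan_Suc_col[OF m] fan_col[OF m] by simp
    then show ?thesis using True fan_skew[of q m m j] fan_skew[of q "Suc m" m j] by (auto simp: mutate_def)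
  next
    case False
    have "sgn (fan q m i m) * max (fan q m i m * fan q m m j) 0
      = of_bool (i = q + 3 \<and> ?o j) - of_bool (j = q + 3 \<and> ?o i)"
      unfolding row fan_col[OF m] by (rule mutation_of_bool) (use dis in blast)+
    then have "mutate m (fan q m) i j = fan q m i j + (of_bool (i = q + 3 \<and> ?o j) - of_bool (j = q + 3 \<and> ?o i))"
      using False by (simp add: mutate_def)
    also have "\<dots> = fan q (Suc m) i j"
      using False m by (intro fan_off_mutation) auto
    finally show ?thesis .
  qed
qed

lemma fan_0_star:
  assumes n: "n = q + 5"
  shows "quiver_iso (star n 1) (quiver_of n (star n 1)) {0..<n} (fan q 0)"
proof -
  \<comment> \<open>The cycle of \<open>fan q 0\<close> ends with \<open>q + 2\<close>,
    \<open>q + 4\<close>, \<open>q + 3\<close> before returning to \<open>0\<close>, so the last two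
    labels are exchanged.\<close>
  define p where "p a = (if a = q + 3 then q + 4 else if a = q + 4 then q + 3 else a)" for a :: nat
  have b: "bij_betw (\<lambda>d. p (fst d)) (star n 1) {0..<n}"
    by (rule bij_betw_byWitness[of _ "\<lambda>i. (p i, n, 1)"]) (auto simp: star_def p_def n)
  have "fan q 0 (p a) (p b) = quiver_of n (star n 1) (a, n, 1) (b, n, 1)" if ab: "a < n" "b < n" for a b
  proof -
    have s: "fan_arrow q 0 (p a) (p b) \<longleftrightarrow> b = (a + 1) mod n" if "a < n" "b < n" for a b
    proof -
      have "(a + 1) mod n = (if a = q + 4 then 0 else a + 1)"
      proof (cases "a = q + 4")
        case True
        then have "a + 1 = n" using n by simp
        then show ?thesis using True by simp
      qed (use that n in auto)
      then show ?thesis using that n by (auto simp: fan_arrow_def p_def)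
    qed
    show ?thesis using star_quiver[of n 1 a b] s[OF ab] s[OF ab(2,1)] ab n by (simp add: fan_def)
  qed
  then show ?thesis using b unfolding quiver_iso_def
    by (intro exI[of _ "\<lambda>d. p (fst d)"]) (auto simp: star_def)
qed

text \<open>The orientation of \<open>D\<^sub>n\<close>, \<open>n = q + 5\<close>, rooted at \<open>0\<close>, in which \<open>s j\<close> is the sign of the edge from
the parent of \<open>j\<close> to \<open>j\<close>.\<close>

definition parent :: "nat \<Rightarrow> nat \<Rightarrow> nat" where
  "parent q j = (if j = q + 4 then q + 2 else j - 1)"

definition tedge :: "nat \<Rightarrow> nat \<Rightarrow> nat \<Rightarrow> bool" where
  "tedge q i j \<longleftrightarrow> 1 \<le> j \<and> j < q + 5 \<and> i = parent q j"

lemma tedge_asym: "tedge q i j \<Longrightarrow> \<not> tedge q j i"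
  by (auto simp: tedge_def parent_def split: if_splits)

definition treemat :: "nat \<Rightarrow> (nat \<Rightarrow> int) \<Rightarrow> nat \<Rightarrow> nat \<Rightarrow> int" where
  "treemat q s i j = (if tedge q i j then s j else if tedge q j i then - s i else 0)"

lemma D_adj_tedge: "n = q + 5 \<Longrightarrow> D_adj n i j \<longleftrightarrow> tedge q i j \<or> tedge q j i"
  by (auto simp: D_adj_def tedge_def parent_def)

lemma D_orientation_treemat:
  assumes n: "n = q + 5" and B: "D_orientation n B"
  shows "\<exists>s. (\<forall>j. s j = 1 \<or> s j = -1) \<and> B = treemat q s"
proof -
  define s where "s j = (if 1 \<le> j \<and> j < q + 5 then B (parent q j) j else 1)" for j
  have sk: "B i j = - B j i" for i j using B unfolding D_orientation_def by blast
  have a: "if D_adj n i j then B i j = 1 \<or> B i j = -1 else B i j = 0" for i j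
    using B unfolding D_orientation_def by blast
  have "s j = 1 \<or> s j = -1" for j
  proof (cases "tedge q (parent q j) j")
    case True
    then have "D_adj n (parent q j) j" using D_adj_tedge[OF n] by blast
    moreover have "s j = B (parent q j) j" using True by (simp add: s_def tedge_def)
    ultimately show ?thesis using a[of "parent q j" j] by simp
  next
    case False
    then show ?thesis by (auto simp: s_def tedge_def)
  qed
  moreover have "B i j = treemat q s i j" for i j
  proof -
    have "s j = B i j" if "tedge q i j" for i j using that by (simp add: s_def tedge_def)
    moreover have "B i j = 0" if "\<not> tedge q i j" "\<not> tedge q j i"
      using a[of i j] that D_adj_tedge[OF n] by simp
    ultimately show ?thesis using sk[of i j] unfolding treemat_def by simp
  qed
  ultimately show ?thesis by blast
qed

lemma fan_last_treemat: "fan q (q + 3) = treemat q (\<lambda>j. if j = q + 4 then -1 else 1)"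
proof (intro ext)
  fix i j
  have a: "fan_arrow q (q + 3) i j \<longleftrightarrow> tedge q i j \<and> j \<noteq> q + 4 \<or> tedge q j i \<and> i = q + 4" for i j
    by (auto simp: fan_arrow_def tedge_def parent_def)
  show "fan q (q + 3) i j = treemat q (\<lambda>j. if j = q + 4 then -1 else 1) i j"
    unfolding fan_def a treemat_def using tedge_asym[of q i j] by (cases "tedge q i j"; cases "tedge q j i") auto
qed

lemma treemat_skew: "treemat q s i j = - treemat q s j i"
  unfolding treemat_def using tedge_asym[of q i j] by simp

lemma treemat_orientation:
  assumes n: "n = q + 5" and s: "\<And>j. s j = 1 \<or> s j = -1"
  shows "D_orientation n (treemat q s)"
  unfolding D_orientation_def
proof (intro conjI allI)
  show "treemat q s i j = - treemat q s j i" for i j by (rule treemat_skew)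
  show "if D_adj n i j then treemat q s i j = 1 \<or> treemat q s i j = -1 else treemat q s i j = 0" for i j
    unfolding treemat_def D_adj_tedge[OF n] using s[of i] s[of j] by auto
qed

text \<open>All arrows at \<open>v\<close> point the same way, so no path runs through
  \<open>v\<close> and mutation there merely reverses them.\<close>

lemma treemat_sink_source:
  assumes "\<And>i. treemat q s i v = 0 \<or> treemat q s i v = c"
  shows "treemat q s i v * treemat q s v j \<le> 0"
  using assms[of i] assms[of j] treemat_skew[of q s v j] by (elim disjE) simp_all

lemma mutate_sink_source:
  assumes "\<And>i j. B i v * B v j \<le> 0"
  shows "mutate v B i j = (if i = v \<or> j = v then - B i j else B i j)"
  using assms[of i j] by (simp add: mutate_def max_absorb2)

lemma mutate_treemat:
  assumes "\<And>i j. treemat q s i v * treemat q s v j \<le> 0"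
    and "\<And>j. 1 \<le> j \<Longrightarrow> j < q + 5 \<Longrightarrow> s' j = (if j = v \<or> parent q j = v then - s j else s j)"
  shows "mutate v (treemat q s) = treemat q s'"
proof (intro ext)
  fix i j
  show "mutate v (treemat q s) i j = treemat q s' i j"
  proof -
    have e: "s' j = (if i = v \<or> j = v then - s j else s j)" if "tedge q i j" for i j
      using assms(2)[of j] that by (auto simp: tedge_def)
    show ?thesis
      unfolding mutate_sink_source[of "treemat q s" v, OF assms(1)] treemat_def using e[of i j] e[of j i] by simp
  qed
qed

text \<open>A leaf edge is reversed by mutating at the leaf. Any other edge is reversed by mutating
  at its end nearer to \<open>0\<close>, which also reverses the preceding edge. Induction restores
  that edge afterwards, or reverses it beforehand if the vertex is not yet a sink or source.\<close>

lemma flip_edge: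
  assumes n: "n = q + 5" and s: "\<And>j. s j = 1 \<or> s j = -1" and r: "realized n (treemat q s)" and j: "1 \<le> j" "j < n"
  shows "realized n (treemat q (s(j := - s j)))"
proof -
  have n3: "3 \<le> n" using n by simp
  have rm: "realized n (treemat q s')" if "realized n (treemat q s)" "v < n" 
    "\<And>i j. treemat q s i v * treemat q s v j \<le> 0" 
    "\<And>j. 1 \<le> j \<Longrightarrow> j < q + 5 \<Longrightarrow> s' j = (if j = v \<or> parent q j = v then - s j else s j)" for s s' v
    using realized_mutate[OF n3 that(1,2)] mutate_treemat[OF that(3,4)] by metis
  \<comment> \<open>The bound on \<open>i\<close> keeps the mutated vertices away from the branching
    vertex \<open>q + 2\<close>, so each has at most two neighbours.\<close>
  have path: "realized n (treemat q (s(Suc i := - s (Suc i))))" 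
    if "i \<le> q + 1" "\<And>j. s j = 1 \<or> s j = -1" "realized n (treemat q s)" for i s
    using that
  proof (induction i arbitrary: s)
    case 0
    have "realized n (treemat q (s(Suc 0 := - s (Suc 0))))"
    proof (rule rm[OF 0(3)])
      show "0 < n" using n by simp
      show "treemat q s i 0 * treemat q s 0 j \<le> 0" for i j
        by (rule treemat_sink_source[where c = "- s (Suc 0)"]) (auto simp: treemat_def tedge_def parent_def)
    qed (auto simp: parent_def)
    then show ?case .
  next
    case (Suc i)
    have main: "realized n (treemat q (s(Suc i := - s (Suc i), Suc (Suc i) := - s (Suc (Suc i)))))"
      if "realized n (treemat q s)" "s (Suc i) = - s (Suc (Suc i))" for s
    proof (rule rm[OF that(1)])
      show "Suc i < n" using n Suc by simp
      show "treemat q s a (Suc i) * treemat q s (Suc i) b \<le> 0" for a b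
      proof (rule treemat_sink_source)
        show "treemat q s a (Suc i) = 0 \<or> treemat q s a (Suc i) = s (Suc i)" for a
          using Suc(2) that(2) by (auto simp: treemat_def tedge_def parent_def)
      qed
    qed (use Suc(2) in \<open>auto simp: parent_def\<close>)
    show ?case
    proof (cases "s (Suc i) = - s (Suc (Suc i))")
      case True
      let ?s = "s(Suc i := - s (Suc i), Suc (Suc i) := - s (Suc (Suc i)))"
      have r2: "realized n (treemat q ?s)" using main Suc.prems(3) True by blast
      have v2: "?s j = 1 \<or> ?s j = -1" for j
        using Suc.prems(2)[of j] Suc.prems(2)[of "Suc i"] Suc.prems(2)[of "Suc (Suc i)"] by auto
      have "realized n (treemat q (?s(Suc i := - ?s (Suc i))))"
        by (rule Suc.IH[OF _ v2 r2]) (use Suc.prems(1) in simp)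
      moreover have "?s(Suc i := - ?s (Suc i)) = s(Suc (Suc i) := - s (Suc (Suc i)))" by auto
      ultimately show ?thesis by metis
    next
      case False
      let ?s = "s(Suc i := - s (Suc i))"
      have "realized n (treemat q ?s)" by (rule Suc.IH[OF _ Suc.prems(2,3)]) (use Suc.prems(1) in simp)
      moreover have "?s (Suc i) = - ?s (Suc (Suc i))" using False Suc.prems(2)[of "Suc i"] Suc.prems(2)[of "Suc (Suc i)"] by auto
      ultimately have "realized n (treemat q (?s(Suc i := - ?s (Suc i), Suc (Suc i) := - ?s (Suc (Suc i)))))"
        using main by blast
      moreover have "?s(Suc i := - ?s (Suc i), Suc (Suc i) := - ?s (Suc (Suc i))) = s(Suc (Suc i) := - s (Suc (Suc i)))"
        by auto
      ultimately show ?thesis by metis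
    qed
  qed
  show ?thesis
  proof (cases "j \<le> q + 2")
    case True
    then show ?thesis using path[of "j - 1" s] s r j by simp
  next
    case False
    then have jq: "j = q + 3 \<or> j = q + 4" using j n by auto
    show ?thesis
    proof (rule rm[OF r])
      show "j < n" by fact
      show "treemat q s a j * treemat q s j b \<le> 0" for a b
      proof (rule treemat_sink_source)
        show "treemat q s a j = 0 \<or> treemat q s a j = s j" for a
          using jq by (auto simp: treemat_def tedge_def parent_def)
      qed
    qed (use jq in \<open>auto simp: parent_def\<close>)
  qed
qed

text \<open>The signs are changed one at a time. The prefix starts with length one because
  \<open>s 0\<close> belongs to no edge.\<close>

lemma orientation_realized:
  assumes n: "n = q + 5" and s: "\<And>j. s j = 1 \<or> s j = -1" and s': "\<And>j. s' j = 1 \<or> s' j = -1" 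
    and r: "realized n (treemat q s)"
  shows "realized n (treemat q s')"
proof -
  have "realized n (treemat q (\<lambda>j. if j < k then s' j else s j))" if "1 \<le> k" "k \<le> n" for k
    using that
  proof (induction k rule: dec_induct)
    case base
    have "treemat q (\<lambda>j. if j < 1 then s' j else s j) = treemat q s"
      by (intro ext) (auto simp: treemat_def tedge_def)
    then show ?case using r by simp
  next
    case (step k)
    let ?s = "\<lambda>j. if j < k then s' j else s j"
    have re: "realized n (treemat q ?s)" using step by simp
    show ?case
    proof (cases "s k = s' k")
      case True
      then have "(\<lambda>j. if j < Suc k then s' j else s j) = ?s" by (auto simp: less_Suc_eq)
      then show ?thesis using re by simp
    next
      case False
      have "?s j = 1 \<or> ?s j = -1" for j using s s' by auto
      then have "realized n (treemat q (?s(k := - ?s k)))" using flip_edge[OF n _ re, of k] step by auto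
      moreover have "- s k = s' k" using False s[of k] s'[of k] by auto
      then have "?s(k := - ?s k) = (\<lambda>j. if j < Suc k then s' j else s j)" by (auto simp: less_Suc_eq)
      ultimately show ?thesis by simp
    qed
  qed
  from this[of n] have "realized n (treemat q (\<lambda>j. if j < n then s' j else s j))" using n by simp
  moreover have "treemat q (\<lambda>j. if j < n then s' j else s j) = treemat q s'"
    by (intro ext) (auto simp: treemat_def tedge_def n)
  ultimately show ?thesis by simp
qed

section \<open>The quivers of triangulations form exactly the mutation class\<close>

lemma class_realized:
  assumes n: "5 \<le> n" and B: "B \<in> mutation_class_D n"
  shows "realized n B"
  using B
proof (induction rule: mutation_class_D.induct)
  case (orient B)
  obtain q where q: "n = q + 5" using n by (metis add.commute le_Suc_ex)
  have n3: "3 \<le> n" using n by simp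
  have "realized n (fan q m)" if "m \<le> q + 3" for m
    using that
  proof (induction m)
    case 0
    have "star n 1 \<in> triangulations n" using star_triangulation[OF n3] by (simp add: triangulations_def)
    then show ?case using fan_0_star[OF q] by (auto simp: realized_def)
  next
    case (Suc m)
    then show ?case using fan_mutate[of m q] realized_mutate[OF n3, of "fan q m" m] q by simp
  qed
  then have r: "realized n (treemat q (\<lambda>j. if j = q + 4 then -1 else 1))" using fan_last_treemat by (metis order_refl)
  obtain s where s: "\<forall>j. s j = 1 \<or> s j = -1" "B = treemat q s" using D_orientation_treemat[OF q orient] by blast
  show ?case unfolding s(2) by (rule orientation_realized[OF q _ _ r]) (use s in auto)
next
  case (mut B k)
  then show ?case using realized_mutate n by simp
qed

lemma triangulation_in_class:
  assumes n: "5 \<le> n" and t: "triangulation n \<Delta>"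
  shows "\<exists>B\<in>mutation_class_D n. quiver_iso \<Delta> (quiver_of n \<Delta>) {0..<n} B"
proof -
  have n3: "3 \<le> n" using n by simp
  obtain q where q: "n = q + 5" using n by (metis add.commute le_Suc_ex)
  \<comment> \<open>The mutations are run backwards, from the orientation of the tree to the cycle;
    each is its own inverse.\<close>
  have fan: "fan q (q + 3 - k) \<in> mutation_class_D n" if "k \<le> q + 3" for k
    using that
  proof (induction k)
    case 0
    show ?case using mutation_class_D.orient[OF treemat_orientation[OF q, of "\<lambda>j. if j = q + 4 then -1 else 1"]]
      by (simp add: fan_last_treemat)
  next
    case (Suc k)
    let ?m = "q + 3 - Suc k"
    have "Suc ?m = q + 3 - k" using Suc by simp
    then have "mutate ?m (fan q ?m) = fan q (q + 3 - k)" using fan_mutate[of ?m q] by simp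
    then have "fan q ?m = mutate ?m (fan q (q + 3 - k))" by (metis mutate_mutate)
    then show ?case using mutation_class_D.mut[OF Suc.IH, of ?m] Suc q by simp
  qed
  show ?thesis
    using n3 t
  proof (induction rule: triangulation_induct)
    case (star e)
    have 1: "quiver_iso (star n 1) (quiver_of n (star n 1)) {0..<n} (fan q 0)" by (rule fan_0_star[OF q])
    \<comment> \<open>Acting with the sign \<open>e\<close> turns every tag into
      \<open>e * e = 1\<close>, so only the star with tag \<open>1\<close> has to be compared with
      the fan.\<close>
    have "quiver_iso (star n e) (quiver_of n (star n e)) (star n (e * e)) (quiver_of n (star n (e * e)))"
      using act_giso[OF n3 star star_triangulation[OF n3 star], of 0] act_star[of n 0 e e] n quiver_iso_giso by fastforce
    moreover have "e * e = 1" using star by auto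
    ultimately show ?case using quiver_iso_trans[OF _ 1] fan[of "q + 3"] by auto
  next
    case (step \<Delta> d \<Delta>' d')
    then show ?case using class_closed_flip by blast
  qed
qed

theorem theorem5p7:
  fixes n :: nat
  assumes "n \<ge> 5"
  shows "(\<forall>\<Delta>\<in>triangulations n. \<exists>B\<in>mutation_class_D n.
            quiver_iso \<Delta> (quiver_of n \<Delta>) {0..<n} B)
       \<and> (\<forall>\<Delta>\<in>triangulations n. \<forall>\<Delta>'\<in>triangulations n.
            tri_equiv n \<Delta> \<Delta>' \<longleftrightarrow> quiver_iso \<Delta> (quiver_of n \<Delta>) \<Delta>' (quiver_of n \<Delta>'))
       \<and> (\<forall>B\<in>mutation_class_D n. \<exists>\<Delta>\<in>triangulations n.
            quiver_iso \<Delta> (quiver_of n \<Delta>) {0..<n} B)"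
proof (intro conjI ballI iffI)
  show "\<exists>B\<in>mutation_class_D n. quiver_iso \<Delta> (quiver_of n \<Delta>) {0..<n} B" if "\<Delta> \<in> triangulations n" for \<Delta>
    using triangulation_in_class[OF assms] that by (simp add: triangulations_def)
  show "quiver_iso \<Delta> (quiver_of n \<Delta>) \<Delta>' (quiver_of n \<Delta>')" if "tri_equiv n \<Delta> \<Delta>'" for \<Delta> \<Delta>'
    using tri_equiv_imp_iso[OF _ that] assms by simp
  show "tri_equiv n \<Delta> \<Delta>'" if "\<Delta> \<in> triangulations n" "\<Delta>' \<in> triangulations n"
    "quiver_iso \<Delta> (quiver_of n \<Delta>) \<Delta>' (quiver_of n \<Delta>')" for \<Delta> \<Delta>'
    using iso_imp_tri_equiv[OF assms] that by (simp add: triangulations_def)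
  show "\<exists>\<Delta>\<in>triangulations n. quiver_iso \<Delta> (quiver_of n \<Delta>) {0..<n} B" if "B \<in> mutation_class_D n" for B
    using class_realized[OF assms that] by (simp add: realized_def)
qed

end
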